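(* Let $(\Omega,\mathfrak A,(\mathcal F_t)_{t\ge 0},P)$ be a filtered probability space satisfying the usual conditions and let $W$ be a one-dimensional standard $(\mathcal F_t)_{t\ge0}$-Brownian motion. Let $\beta$ be a bounded progressively measurable process with values in $\mathbb R$, let $\alpha\in(0,1)$, and let $X$ be an $(\mathcal F_t)_{t\ge0}$-adapted real-valued stochastic process such that $dX(t)=\beta(t)\,dt+dW(t)$, i.e. $X(t)=X(0)+\int_0^t\beta(s)\,ds+W(t)$ for all $t\ge 0$. Then for any $T>0$ the random variable $X(T)$ has an $\alpha$-H\"older continuous density with respect to Lebesgue measure. Furthermore, if $\beta$ is bounded by $K>0$ (i.e. $|\beta|\le K$), then the H\"older constant of this density is at most $$C^K_\alpha(T):=K^{1+\alpha}\left(\frac{1}{\sqrt{2\pi e^\alpha}\,(TK^2)^{(1+\alpha)/2}}+\frac{4}{\sqrt{2\pi e^\alpha}}\int_0^{TK^2}\left(\frac{\varphi(\sqrt s)}{\sqrt s}+\Phi(\sqrt s)\right)\frac{1}{(TK^2-s)^{(1+\alpha)/2}}\,ds\right).$$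
   Context: Usual conditions: $\mathcal F_0$ contains all $P$-null sets and $(\mathcal F_t)_{t\ge0}$ is right-continuous. $\varphi$ and $\Phi$ denote the density and the distribution function of the standard normal law. A function $f:I\to\mathbb R$ on an interval $I\subseteq\mathbb R$ with at least two points is called $\alpha$-H\"older continuous with constant $C$ if $|f(x)-f(y)|\le C|x-y|^\alpha$ for all $x,y\in I$ (always understood globally). That $X(T)$ has an $\alpha$-H\"older continuous density means that its law is absolutely continuous with respect to Lebesgue measure and some version of the density is $\alpha$-H\"older continuous on $\mathbb R$. *)

theory Defs
  imports "HOL-Probability.Probability"
begin

text \<open>
  Processes are functions \<open>real \<Rightarrow> 'a \<Rightarrow> real\<close> and filtrations are functions \<open>real \<Rightarrow> 'a measure\<close>;
  only times \<open>t \<ge> 0\<close> are ever constrained. (The library locale \<open>filtration\<close> over the index type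
  \<open>real\<close> would also constrain negative times.) Of \<open>F t\<close> only the space and the
  sigma-algebra are relevant, not the measure it carries.
\<close>

locale filtered_prob_space = prob_space M
  for M :: "'a measure" and F :: "real \<Rightarrow> 'a measure" +
  assumes subalgebra_F: "\<And>t. 0 \<le> t \<Longrightarrow> subalgebra M (F t)"
    and F_mono: "\<And>s t. 0 \<le> s \<Longrightarrow> s \<le> t \<Longrightarrow> subalgebra (F t) (F s)"

locale usual_filtered_prob_space = filtered_prob_space +
  assumes null_sets_F: "null_sets M \<subseteq> sets (F 0)"
    and right_continuous_F: "\<And>t. 0 \<le> t \<Longrightarrow> sets (F t) = (\<Inter>s\<in>{t<..}. sets (F s))"

definition adapted_process :: "(real \<Rightarrow> 'a measure) \<Rightarrow> (real \<Rightarrow> 'a \<Rightarrow> real) \<Rightarrow> bool" where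
  "adapted_process F X \<longleftrightarrow> (\<forall>t\<ge>0. X t \<in> borel_measurable (F t))"

definition progressively_measurable :: "(real \<Rightarrow> 'a measure) \<Rightarrow> (real \<Rightarrow> 'a \<Rightarrow> real) \<Rightarrow> bool" where
  "progressively_measurable F X \<longleftrightarrow>
     (\<forall>t\<ge>0. (\<lambda>(s, \<omega>). X s \<omega>) \<in> borel_measurable (restrict_space borel {0..t} \<Otimes>\<^sub>M F t))"

definition process_bounded_by :: "'a measure \<Rightarrow> (real \<Rightarrow> 'a \<Rightarrow> real) \<Rightarrow> real \<Rightarrow> bool" where
  "process_bounded_by M X K \<longleftrightarrow> (\<forall>t\<ge>0. \<forall>\<omega>\<in>space M. \<bar>X t \<omega>\<bar> \<le> K)"

text \<open>The initial value and the continuity of paths are required almost surely; \<open>normal_density\<close>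
  is parametrised by the standard deviation. The \<open>vimage_algebra\<close> is the sigma-algebra generated
  by the increment.\<close>

definition standard_brownian_motion ::
    "'a measure \<Rightarrow> (real \<Rightarrow> 'a measure) \<Rightarrow> (real \<Rightarrow> 'a \<Rightarrow> real) \<Rightarrow> bool" where
  "standard_brownian_motion M F W \<longleftrightarrow>
     adapted_process F W \<and>
     (AE \<omega> in M. W 0 \<omega> = 0) \<and>
     (AE \<omega> in M. continuous_on {0..} (\<lambda>t. W t \<omega>)) \<and>
     (\<forall>s t. 0 \<le> s \<longrightarrow> s < t \<longrightarrow>
        distributed M lborel (\<lambda>\<omega>. W t \<omega> - W s \<omega>) (\<lambda>x. ennreal (normal_density 0 (sqrt (t - s)) x)) \<and>
        prob_space.indep_set M (sets (F s))
          (sets (vimage_algebra (space M) (\<lambda>\<omega>. W t \<omega> - W s \<omega>) borel)))"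

definition holder_continuous_on :: "real \<Rightarrow> real \<Rightarrow> real set \<Rightarrow> (real \<Rightarrow> real) \<Rightarrow> bool" where
  "holder_continuous_on \<alpha> C I f \<longleftrightarrow> (\<forall>x\<in>I. \<forall>y\<in>I. \<bar>f x - f y\<bar> \<le> C * \<bar>x - y\<bar> powr \<alpha>)"

text \<open>Nonnegativity has to be explicit because \<open>ennreal\<close> truncates negative values to \<open>0\<close>.\<close>

definition has_density :: "'a measure \<Rightarrow> ('a \<Rightarrow> real) \<Rightarrow> (real \<Rightarrow> real) \<Rightarrow> bool" where
  "has_density M Y p \<longleftrightarrow> (\<forall>x. 0 \<le> p x) \<and> distributed M lborel Y (\<lambda>x. ennreal (p x))"

abbreviation std_normal_cdf :: "real \<Rightarrow> real" where
  "std_normal_cdf \<equiv> cdf std_normal_distribution"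

definition holder_bound :: "real \<Rightarrow> real \<Rightarrow> real \<Rightarrow> real" where
  "holder_bound K \<alpha> T =
     K powr (1 + \<alpha>) *
     (1 / (sqrt (2 * pi * exp \<alpha>) * (T * K\<^sup>2) powr ((1 + \<alpha>) / 2)) +
      4 / sqrt (2 * pi * exp \<alpha>) *
        (LBINT s:{0<..<T * K\<^sup>2}.
           (std_normal_density (sqrt s) / sqrt s + std_normal_cdf (sqrt s)) *
           (1 / (T * K\<^sup>2 - s) powr ((1 + \<alpha>) / 2))))"

end

theory Submission
  imports Defs "HOL-Real_Asymp.Real_Asymp"
begin

text \<open>
  Only one feature of the equation matters: for \<open>s < t\<close> the increment of \<open>X\<close> over \<open>[s, t]\<close> is a
  centred normal variable of variance \<open>t - s\<close>, independent of \<open>X s\<close>, up to an error of at most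
  \<open>K * (t - s)\<close>. The locale \<open>bounded_drift_motion\<close> records this. Stochastic integration is replaced
  by a second order Taylor expansion over one step of length \<open>h\<close> (\<open>one_step_expansion\<close>): the error is
  \<open>O(h powr (3/2))\<close>, so it disappears when the steps are summed (\<open>increment_le_integral\<close>).

  Write \<open>g\<close> for the Gaussian kernel, with variance as its first argument. Taking \<open>g (T + \<epsilon> - t)\<close> at
  \<open>X t - y\<close> as test function, the heat equation cancels the second order term, and the expectation
  changes in \<open>t\<close> at a rate given by the drift times \<open>g' (T + \<epsilon> - t)\<close> alone. Subtracting the same
  identity for another point \<open>z\<close>, the rate is at most
  \<open>K * E \<bar>g' (T + \<epsilon> - t) (X t - y) - g' (T + \<epsilon> - t) (X t - z)\<bar>\<close>. A pointwise estimate of this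
  difference is of order \<open>(T - t) powr -(1 + \<alpha> / 2)\<close> and cannot be integrated. However, if the law
  of \<open>X t\<close> has a density bounded by \<open>m t\<close>, then the expectation is at most \<open>m t\<close> times the \<open>L\<^sup>1\<close> norm
  of the difference, which is of the integrable order \<open>(T - t) powr -((1 + \<alpha>) / 2)\<close>
  (\<open>gauss_deriv_L1_holder\<close>). The constants \<open>1 / sqrt (2 * pi * exp \<alpha>)\<close> come from interpolating
  between the trivial case \<open>\<alpha> = 0\<close> and the Lipschitz case \<open>\<alpha> = 1\<close>.

  The bound \<open>m t\<close> has to be the optimal one. The density of a motion with drift bounded by \<open>K\<close> at a
  point \<open>y\<close> is largest when the motion starts in \<open>y\<close> and is always driven towards \<open>y\<close> at full speed
  \<open>K\<close>. The density at \<open>0\<close> of that extremal motion, as a function of the elapsed time \<open>r\<close> and of the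
  starting point \<open>x\<close>, is explicit (\<open>extremal_density\<close>) and solves the Hamilton-Jacobi-Bellman equation
  \<open>q_r = q_xx / 2 + K * \<bar>q_x\<bar>\<close> (\<open>extremal_density_hjb\<close>). Hence \<open>E (q (s - t) (X t - y))\<close> is
  nonincreasing in \<open>t\<close> for every admissible drift, which gives \<open>m s = q s 0\<close>
  (\<open>expectation_le_extremal_density_times_integral\<close>). For \<open>K = 0\<close> the function \<open>q\<close> is the Gaussian
  kernel, so one set of estimates serves both arguments.

  Integrating over time yields the stated constant for the law of \<open>X T\<close> mollified by a Gaussian of
  variance \<open>\<epsilon>\<close>, uniformly in \<open>\<epsilon>\<close> (\<open>expectation_gauss_diff_le\<close>, \<open>holder_bound_eq\<close>). Since the mollified
  density for \<open>\<epsilon>\<close> is the one for \<open>\<delta> < \<epsilon>\<close> convolved with \<open>g (\<epsilon> - \<delta>)\<close>, the uniform Hoelder bound makes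
  the mollified densities converge uniformly as \<open>\<epsilon>\<close> tends to \<open>0\<close>; the limit inherits the Hoelder
  bound and is a density of \<open>X T\<close>.
\<close>

section \<open>The Gaussian kernel\<close>

text \<open>The first argument is the variance, because the kernel is differentiated in it.\<close>
definition gauss :: "real \<Rightarrow> real \<Rightarrow> real" where
  "gauss r x = exp (- x\<^sup>2 / (2 * r)) / sqrt (2 * pi * r)"

lemma gauss_eq_normal_density: "0 < r \<Longrightarrow> gauss r x = normal_density 0 (sqrt r) x"
  by (simp add: gauss_def normal_density_def)

lemma gauss_nonneg: "0 < r \<Longrightarrow> 0 \<le> gauss r x"
  by (simp add: gauss_def)

lemma gauss_even: "gauss r (- x) = gauss r x"
  by (simp add: gauss_def)

lemma gauss_minus_commute: "gauss r (x - y) = gauss r (y - x)"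
  by (metis gauss_even minus_diff_eq)

lemma gauss_eq_std_normal: "0 < r \<Longrightarrow> gauss r x = std_normal_density (x / sqrt r) / sqrt r"
  by (simp add: gauss_def std_normal_density_def power_divide real_sqrt_mult)

lemma borel_measurable_gauss [measurable]: "gauss r \<in> borel_measurable borel"
  unfolding gauss_def[abs_def] by measurable

lemma DERIV_gauss:
  assumes "0 < r"
  shows "(gauss r has_real_derivative - (x / r) * gauss r x) (at x within S)"
  unfolding gauss_def using assms
  by (auto intro!: derivative_eq_intros simp: field_simps power2_eq_square)

lemma DERIV_gauss_comp [derivative_intros]:
  assumes "0 < r" "(f has_real_derivative f') (at x within S)"
  shows "((\<lambda>x. gauss r (f x)) has_real_derivative - (f x / r) * gauss r (f x) * f') (at x within S)"
  using DERIV_chain2[OF DERIV_gauss[OF assms(1)] assms(2)] by simp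

text \<open>
  The centre moves with the variance: this is the form in which the kernel enters the density of a
  motion with constant drift \<open>K\<close>.
\<close>
lemma DERIV_gauss_variance:
  assumes r: "0 < r"
  shows "((\<lambda>r. gauss r (z - K * r)) has_real_derivative
           (z\<^sup>2 - K\<^sup>2 * r\<^sup>2 - r) / (2 * r\<^sup>2) * gauss r (z - K * r)) (at r within S)"
proof -
  have sq: "sqrt (2 * pi * r) * sqrt (2 * pi * r) = 2 * pi * r" "sqrt (2 * pi * r) \<noteq> 0"
    using r by auto
  have "((\<lambda>r. sqrt (2 * pi * r)) has_real_derivative sqrt (2 * pi * r) / (2 * r)) (at r within S)"
    using r sq by (auto intro!: derivative_eq_intros simp: field_simps mult_less_0_iff)
  moreover have "((\<lambda>r. exp (- (z - K * r)\<^sup>2 / (2 * r))) has_real_derivative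
      exp (- (z - K * r)\<^sup>2 / (2 * r)) * ((z\<^sup>2 - K\<^sup>2 * r\<^sup>2) / (2 * r\<^sup>2))) (at r within S)"
    using r by (auto intro!: derivative_eq_intros simp: field_simps power2_eq_square)
  ultimately have "((\<lambda>r. gauss r (z - K * r)) has_real_derivative
       (exp (- (z - K * r)\<^sup>2 / (2 * r)) * ((z\<^sup>2 - K\<^sup>2 * r\<^sup>2) / (2 * r\<^sup>2)) * sqrt (2 * pi * r)
        - exp (- (z - K * r)\<^sup>2 / (2 * r)) * (sqrt (2 * pi * r) / (2 * r)))
        / (sqrt (2 * pi * r) * sqrt (2 * pi * r))) (at r within S)"
    unfolding gauss_def using sq by (intro DERIV_divide)
  also have "(exp (- (z - K * r)\<^sup>2 / (2 * r)) * ((z\<^sup>2 - K\<^sup>2 * r\<^sup>2) / (2 * r\<^sup>2)) * sqrt (2 * pi * r)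
        - exp (- (z - K * r)\<^sup>2 / (2 * r)) * (sqrt (2 * pi * r) / (2 * r)))
        / (sqrt (2 * pi * r) * sqrt (2 * pi * r))
      = ((z\<^sup>2 - K\<^sup>2 * r\<^sup>2) / (2 * r\<^sup>2) - 1 / (2 * r)) * gauss r (z - K * r)"
  proof -
    have "(E * A * s - E * (s / (2 * r))) / (s * s) = (A - 1 / (2 * r)) * (E / s)" if "s \<noteq> 0" for E A s :: real
      using that by (simp add: divide_simps) (simp add: algebra_simps)
    from this[OF sq(2)] show ?thesis unfolding gauss_def .
  qed
  also have "(z\<^sup>2 - K\<^sup>2 * r\<^sup>2) / (2 * r\<^sup>2) - 1 / (2 * r) = (z\<^sup>2 - K\<^sup>2 * r\<^sup>2 - r) / (2 * r\<^sup>2)"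
    using r by (simp add: field_simps power2_eq_square)
  finally show ?thesis .
qed

lemma DERIV_std_normal_cdf: "(std_normal_cdf has_real_derivative std_normal_density x) (at x)"
proof -
  interpret N: real_distribution std_normal_distribution
    by (rule real_dist_normal_dist)
  have int: "std_normal_density integrable_on {a..b}" for a b
    by (intro integrable_continuous_interval) (auto simp: std_normal_density_def intro!: continuous_intros)
  have m: "measure std_normal_distribution {a<..b} = integral {a..b} std_normal_density" if "a \<le> b" for a b
  proof -
    have "measure std_normal_distribution {a<..b} = integral\<^sup>L std_normal_distribution (indicator {a<..b})"
      by simp
    also have "\<dots> = (LBINT x:{a<..b}. std_normal_density x)"
      by (subst integral_density)
         (auto simp: set_lebesgue_integral_def normal_density_nonneg intro!: Bochner_Integration.integral_cong)
    also have "\<dots> = integral {a<..b} std_normal_density"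
      by (intro set_borel_integral_eq_integral)
         (auto simp: set_integrable_def intro!: integrable_mult_indicator[where 'b=real, simplified])
    also have "\<dots> = integral {a..b} std_normal_density"
      by (rule integral_spike_set) (auto intro: negligible_subset[of "{a}"])
    finally show ?thesis .
  qed
  have eq: "std_normal_cdf t = std_normal_cdf (x - 1) + integral {x - 1..t} std_normal_density" if "x - 1 < t" for t
    using N.cdf_diff_eq[OF that] m[of "x - 1" t] that by simp
  have "((\<lambda>t. std_normal_cdf (x - 1) + integral {x - 1..t} std_normal_density) has_real_derivative
      std_normal_density x) (at x within {x-1..x+1})"
  proof -
    have "continuous_on {x - 1..x + 1} std_normal_density"
      unfolding normal_density_def by (intro continuous_intros) auto
    then have "((\<lambda>t. integral {x - 1..t} std_normal_density) has_real_derivative std_normal_density x)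
        (at x within {x - 1..x + 1})"
      by (rule integral_has_real_derivative) auto
    from DERIV_add[OF DERIV_const this] show ?thesis
      by simp
  qed
  then have "((\<lambda>t. std_normal_cdf (x - 1) + integral {x - 1..t} std_normal_density) has_real_derivative
      std_normal_density x) (at x)"
    using at_within_interior[of x "{x - 1..x + 1}"] by (simp only: interior_atLeastAtMost_real) auto
  then show ?thesis
    by (rule DERIV_cong_ev[THEN iffD1, rotated -1])
     (auto intro!: eventually_nhds_in_open[of "{x-1<..}" x, THEN eventually_mono] eq[symmetric])
qed

lemma DERIV_std_normal_cdf_comp [derivative_intros]:
  assumes "(f has_real_derivative f') (at x within S)"
  shows "((\<lambda>x. std_normal_cdf (f x)) has_real_derivative std_normal_density (f x) * f') (at x within S)"
  using DERIV_chain2[OF DERIV_std_normal_cdf assms] by simp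

section \<open>The extremal density\<close>

text \<open>
  For \<open>z \<ge> 0\<close> this is the density at \<open>0\<close> after time \<open>r\<close> of the motion that starts in \<open>z\<close> and has drift
  \<open>K\<close> towards \<open>0\<close> on both sides of \<open>0\<close>. The formula is smooth in \<open>z\<close> on the whole line; it is the
  even extension of its restriction to \<open>z \<ge> 0\<close> that has the probabilistic meaning.
\<close>
definition drift_profile :: "real \<Rightarrow> real \<Rightarrow> real \<Rightarrow> real" where
  "drift_profile K r z = gauss r (z - K * r) + K * std_normal_cdf ((K * r - z) / sqrt r)"

lemma DERIV_drift_profile:
  assumes r: "0 < r"
  shows "(drift_profile K r has_real_derivative - (z / r) * gauss r (z - K * r)) (at z within S)"
proof -
  have "(drift_profile K r has_real_derivative - ((z - K * r) / r) * gauss r (z - K * r)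
      - K * (std_normal_density ((K * r - z) / sqrt r) / sqrt r)) (at z within S)"
    unfolding drift_profile_def using r
    by (auto intro!: derivative_eq_intros simp: divide_inverse mult_ac)
  also have "std_normal_density ((K * r - z) / sqrt r) / sqrt r = gauss r (z - K * r)"
    using r by (simp add: gauss_eq_std_normal[symmetric] gauss_minus_commute)
  finally show ?thesis
    using r by (simp add: field_simps)
qed

lemma DERIV_drift_profile_variance:
  assumes r: "0 < r"
  shows "((\<lambda>r. drift_profile K r z) has_real_derivative
           (z\<^sup>2 + K * r * z - r) / (2 * r\<^sup>2) * gauss r (z - K * r)) (at r within S)"
proof -
  have ring: "A * G + K * (G * B) = (A + K * B) * G" for A B G :: real
    by (simp add: algebra_simps)
  have d: "((\<lambda>r. (K * r - z) / sqrt r) has_real_derivative (K * r + z) / (2 * r * sqrt r)) (at r within S)"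
    using r by (auto intro!: derivative_eq_intros simp: field_simps)
  have "((\<lambda>r. drift_profile K r z) has_real_derivative
     (z\<^sup>2 - K\<^sup>2 * r\<^sup>2 - r) / (2 * r\<^sup>2) * gauss r (z - K * r)
      + K * (std_normal_density ((K * r - z) / sqrt r) * ((K * r + z) / (2 * r * sqrt r)))) (at r within S)"
    unfolding drift_profile_def using r
    by (intro DERIV_add DERIV_cmult DERIV_gauss_variance DERIV_std_normal_cdf_comp d)
  also have "std_normal_density ((K * r - z) / sqrt r) * ((K * r + z) / (2 * r * sqrt r))
      = gauss r (z - K * r) * ((K * r + z) / (2 * r))"
    using r by (subst gauss_minus_commute) (simp add: gauss_eq_std_normal field_simps)
  also have "(z\<^sup>2 - K\<^sup>2 * r\<^sup>2 - r) / (2 * r\<^sup>2) * gauss r (z - K * r)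
      + K * (gauss r (z - K * r) * ((K * r + z) / (2 * r)))
      = ((z\<^sup>2 - K\<^sup>2 * r\<^sup>2 - r) / (2 * r\<^sup>2) + K * ((K * r + z) / (2 * r))) * gauss r (z - K * r)"
    using ring[of "(z\<^sup>2 - K\<^sup>2 * r\<^sup>2 - r) / (2 * r\<^sup>2)"] by blast
  also have "(z\<^sup>2 - K\<^sup>2 * r\<^sup>2 - r) / (2 * r\<^sup>2) + K * ((K * r + z) / (2 * r)) = (z\<^sup>2 + K * r * z - r) / (2 * r\<^sup>2)"
  proof -
    have "K * ((K * r + z) / (2 * r)) = (K\<^sup>2 * r\<^sup>2 + K * r * z) / (2 * r\<^sup>2)"
      using r by (simp add: divide_simps power2_eq_square) (simp add: algebra_simps)
    then show ?thesis
      by (simp add: add_divide_distrib[symmetric])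
  qed
  finally show ?thesis .
qed

text \<open>
  The next fact and \<open>DERIV_odd_extension\<close> show that \<open>drift_profile\<close> remains twice differentiable when it is
  reflected at \<open>0\<close>: its derivative has a factor \<open>z\<close>, so it vanishes at \<open>0\<close> and the kink of \<open>\<bar>x\<bar>\<close>
  disappears.
\<close>
lemma DERIV_even_extension:
  fixes f g :: "real \<Rightarrow> real"
  assumes f: "\<And>z. 0 \<le> z \<Longrightarrow> (f has_real_derivative z * g z) (at z)"
  shows "((\<lambda>x. f \<bar>x\<bar>) has_real_derivative x * g \<bar>x\<bar>) (at x)"
proof -
  consider "x > 0" | "x < 0" | "x = 0" by linarith
  then show ?thesis
  proof cases
    case 3
    have "((\<lambda>h. (f h - f 0) / h) \<longlongrightarrow> 0) (at 0)"
      using f[of 0] by (simp add: DERIV_def)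
    moreover have "filterlim abs (at 0) (at (0::real))"
      by (auto simp: filterlim_at tendsto_rabs_zero_iff eventually_at_filter)
    ultimately have "((\<lambda>h. (f \<bar>h\<bar> - f 0) / \<bar>h\<bar>) \<longlongrightarrow> 0) (at 0)"
      by (rule filterlim_compose)
    from tendsto_rabs_zero[OF this] have "((\<lambda>h. \<bar>(f \<bar>h\<bar> - f 0) / h\<bar>) \<longlongrightarrow> 0) (at 0)"
      by (simp add: abs_divide)
    from tendsto_rabs_zero_cancel[OF this] show ?thesis
      using 3 by (simp add: DERIV_def)
  next
    case 1
    have "((\<lambda>x. f x) has_real_derivative x * g \<bar>x\<bar>) (at x)" using f[of x] 1 by simp
    then show ?thesis
      by (rule DERIV_cong_ev[THEN iffD1, rotated -1])
       (use 1 in \<open>auto intro!: eventually_nhds_in_open[of "{0<..}" x, THEN eventually_mono]\<close>)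
  next
    case 2
    have "((\<lambda>x. f (- x)) has_real_derivative x * g \<bar>x\<bar>) (at x)"
      by (rule DERIV_cong[OF DERIV_mirror[THEN iffD1, OF f]]) (use 2 in auto)
    then show ?thesis
      by (rule DERIV_cong_ev[THEN iffD1, rotated -1])
       (use 2 in \<open>auto intro!: eventually_nhds_in_open[of "{..<0}" x, THEN eventually_mono]\<close>)
  qed
qed

definition extremal_density :: "real \<Rightarrow> real \<Rightarrow> real \<Rightarrow> real" where
  "extremal_density K r x = drift_profile K r \<bar>x\<bar>"

definition extremal_density_dx :: "real \<Rightarrow> real \<Rightarrow> real \<Rightarrow> real" where
  "extremal_density_dx K r x = - (x / r) * gauss r (\<bar>x\<bar> - K * r)"

definition extremal_density_dxx :: "real \<Rightarrow> real \<Rightarrow> real \<Rightarrow> real" where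
  "extremal_density_dxx K r x = (\<bar>x\<bar>\<^sup>2 - K * r * \<bar>x\<bar> - r) / r\<^sup>2 * gauss r (\<bar>x\<bar> - K * r)"

definition extremal_density_dr :: "real \<Rightarrow> real \<Rightarrow> real \<Rightarrow> real" where
  "extremal_density_dr K r x = (\<bar>x\<bar>\<^sup>2 + K * r * \<bar>x\<bar> - r) / (2 * r\<^sup>2) * gauss r (\<bar>x\<bar> - K * r)"

lemma extremal_density_zero_drift: "extremal_density 0 r x = gauss r x"
  by (simp add: extremal_density_def drift_profile_def gauss_def)

lemma extremal_density_dx_zero_drift: "extremal_density_dx 0 r x = - (x / r) * gauss r x"
  by (simp add: extremal_density_dx_def gauss_def)

lemma DERIV_extremal_density:
  assumes "0 < r" shows "(extremal_density K r has_real_derivative extremal_density_dx K r x) (at x)"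
  using DERIV_even_extension[of "drift_profile K r" "\<lambda>z. - (1 / r) * gauss r (z - K * r)" x]
    DERIV_drift_profile[OF assms, of K]
  unfolding extremal_density_def[abs_def] extremal_density_dx_def by simp

lemma DERIV_odd_extension:
  fixes g g' :: "real \<Rightarrow> real"
  assumes g: "\<And>z. 0 \<le> z \<Longrightarrow> (g has_real_derivative g' z) (at z)"
  shows "((\<lambda>x. x * g \<bar>x\<bar>) has_real_derivative g \<bar>x\<bar> + \<bar>x\<bar> * g' \<bar>x\<bar>) (at x)"
proof (cases "x = 0")
  case False
  have "(abs has_real_derivative sgn x) (at x)"
  proof -
    have "((\<lambda>x. sqrt (x\<^sup>2)) has_real_derivative inverse (sqrt (x\<^sup>2)) / 2 * (2 * x)) (at x)"
      using False by (intro DERIV_chain2[OF DERIV_real_sqrt]) (auto intro!: derivative_eq_intros)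
    then show ?thesis
      unfolding real_sqrt_abs by (rule DERIV_cong) (use False in \<open>simp add: sgn_if\<close>)
  qed
  then have "((\<lambda>x. g \<bar>x\<bar>) has_real_derivative g' \<bar>x\<bar> * sgn x) (at x)"
    by (intro DERIV_chain2[OF g]) auto
  from DERIV_mult[OF DERIV_ident this] show ?thesis
    by (simp add: algebra_simps abs_sgn)
next
  case True
  have "isCont g 0" using g[of 0] by (auto intro: DERIV_isCont)
  then have "((\<lambda>h. g \<bar>h\<bar>) \<longlongrightarrow> g 0) (at 0)"
    by (intro isCont_tendsto_compose[of 0 g]) (auto simp: tendsto_rabs_zero_iff)
  then have "((\<lambda>h. h * g \<bar>h\<bar> / h) \<longlongrightarrow> g 0) (at 0)"
    by (rule filterlim_cong[THEN iffD1, rotated -1]) (auto simp: eventually_at_filter)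
  then show ?thesis using True by (simp add: DERIV_def)
qed

lemma DERIV_extremal_density_dx:
  assumes "0 < r" shows "(extremal_density_dx K r has_real_derivative extremal_density_dxx K r x) (at x)"
proof -
  have "((\<lambda>z. - (1 / r) * gauss r (z - K * r)) has_real_derivative
    (z - K * r) / r\<^sup>2 * gauss r (z - K * r)) (at z)" for z
    using assms by (auto intro!: derivative_eq_intros simp: power2_eq_square)
  from DERIV_odd_extension[OF this, of x]
  have "(extremal_density_dx K r has_real_derivative - (1 / r) * gauss r (\<bar>x\<bar> - K * r)
      + \<bar>x\<bar> * ((\<bar>x\<bar> - K * r) / r\<^sup>2 * gauss r (\<bar>x\<bar> - K * r))) (at x)"
    unfolding extremal_density_dx_def[abs_def] by simp
  also have "- (1 / r) * gauss r (\<bar>x\<bar> - K * r)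
      + \<bar>x\<bar> * ((\<bar>x\<bar> - K * r) / r\<^sup>2 * gauss r (\<bar>x\<bar> - K * r)) = extremal_density_dxx K r x"
    unfolding extremal_density_dxx_def using assms
    by (simp add: divide_simps) (simp add: algebra_simps power2_eq_square)
  finally show ?thesis .
qed

lemma DERIV_extremal_density_variance:
  assumes "0 < r" shows "((\<lambda>r. extremal_density K r x) has_real_derivative extremal_density_dr K r x) (at r within S)"
  unfolding extremal_density_def extremal_density_dr_def by (rule DERIV_drift_profile_variance[OF assms])

lemma borel_measurable_extremal_density_dx [measurable]: "extremal_density_dx K r \<in> borel_measurable borel"
  unfolding extremal_density_dx_def[abs_def] by measurable

lemma borel_measurable_extremal_density_dxx [measurable]: "extremal_density_dxx K r \<in> borel_measurable borel"
  unfolding extremal_density_dxx_def[abs_def] by measurable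

lemma borel_measurable_extremal_density:
  "0 < r \<Longrightarrow> extremal_density K r \<in> borel_measurable borel"
  by (auto intro!: borel_measurable_continuous_onI DERIV_continuous_on
      DERIV_extremal_density[THEN has_field_derivative_at_within])

text \<open>
  The Hamilton-Jacobi-Bellman equation. The absolute value arises because the drift \<open>K\<close> towards \<open>0\<close>
  always has the direction in which the density at \<open>0\<close> increases; among all drifts bounded by \<open>K\<close> it
  maximises the first order term.
\<close>
lemma extremal_density_hjb:
  assumes "0 < r" "0 \<le> K"
  shows "extremal_density_dr K r x = extremal_density_dxx K r x / 2 + K * \<bar>extremal_density_dx K r x\<bar>"
  unfolding extremal_density_dr_def extremal_density_dxx_def extremal_density_dx_def
  using assms by (simp add: abs_mult gauss_nonneg field_simps power2_eq_square)

section \<open>Uniform regularity of the extremal density\<close>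

text \<open>
  All derivatives of \<open>drift_profile\<close> are products of the Gaussian kernel with a polynomial in \<open>z\<close> whose
  coefficients are rational in \<open>r\<close>. The closure properties below reduce their boundedness to a
  syntactic check.
\<close>
definition poly_growth :: "real set \<Rightarrow> (real \<Rightarrow> real \<Rightarrow> real) \<Rightarrow> bool" where
  "poly_growth I f \<longleftrightarrow> (\<exists>C n. \<forall>r\<in>I. \<forall>z. \<bar>f r z\<bar> \<le> C * (1 + \<bar>z\<bar>) ^ n)"

lemma poly_growthE:
  assumes "poly_growth I f"
  obtains C n where "0 \<le> C" "\<And>r z. r \<in> I \<Longrightarrow> \<bar>f r z\<bar> \<le> C * (1 + \<bar>z\<bar>) ^ n"
proof -
  obtain C n where C: "\<forall>r\<in>I. \<forall>z. \<bar>f r z\<bar> \<le> C * (1 + \<bar>z\<bar>) ^ n"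
    using assms unfolding poly_growth_def by blast
  show thesis
  proof (rule that[of "\<bar>C\<bar>" n])
    show "\<bar>f r z\<bar> \<le> \<bar>C\<bar> * (1 + \<bar>z\<bar>) ^ n" if "r \<in> I" for r z
      by (rule order_trans[OF C[rule_format, OF that]], rule mult_right_mono) auto
  qed auto
qed

lemma poly_growth_arg: "poly_growth I (\<lambda>r z. z)"
  unfolding poly_growth_def by (intro exI[of _ 1]) auto

lemma poly_growth_bounded:
  assumes "\<And>r. r \<in> I \<Longrightarrow> \<bar>c r\<bar> \<le> C"
  shows "poly_growth I (\<lambda>r z. c r)"
  unfolding poly_growth_def using assms by (intro exI[of _ C] exI[of _ 0]) auto

lemma poly_growth_add:
  assumes "poly_growth I f" "poly_growth I g"
  shows "poly_growth I (\<lambda>r z. f r z + g r z)"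
proof -
  obtain C n where C: "0 \<le> C" "\<And>r z. r \<in> I \<Longrightarrow> \<bar>f r z\<bar> \<le> C * (1 + \<bar>z\<bar>) ^ n"
    using assms(1) by (rule poly_growthE) auto
  obtain D m where D: "0 \<le> D" "\<And>r z. r \<in> I \<Longrightarrow> \<bar>g r z\<bar> \<le> D * (1 + \<bar>z\<bar>) ^ m"
    using assms(2) by (rule poly_growthE) auto
  have "\<bar>f r z + g r z\<bar> \<le> (C + D) * (1 + \<bar>z\<bar>) ^ (n + m)" if "r \<in> I" for r z
  proof -
    have "C * (1 + \<bar>z\<bar>) ^ n \<le> C * (1 + \<bar>z\<bar>) ^ (n + m)" "D * (1 + \<bar>z\<bar>) ^ m \<le> D * (1 + \<bar>z\<bar>) ^ (n + m)"
      using C(1) D(1) by (auto intro!: mult_left_mono power_increasing)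
    then show ?thesis using C(2)[OF that, of z] D(2)[OF that, of z] unfolding distrib_right by linarith
  qed
  then show ?thesis unfolding poly_growth_def by blast
qed

lemma poly_growth_mult:
  assumes "poly_growth I f" "poly_growth I g"
  shows "poly_growth I (\<lambda>r z. f r z * g r z)"
proof -
  obtain C n where C: "0 \<le> C" "\<And>r z. r \<in> I \<Longrightarrow> \<bar>f r z\<bar> \<le> C * (1 + \<bar>z\<bar>) ^ n"
    using assms(1) by (rule poly_growthE) auto
  obtain D m where D: "0 \<le> D" "\<And>r z. r \<in> I \<Longrightarrow> \<bar>g r z\<bar> \<le> D * (1 + \<bar>z\<bar>) ^ m"
    using assms(2) by (rule poly_growthE) auto
  have "\<bar>f r z * g r z\<bar> \<le> (C * D) * (1 + \<bar>z\<bar>) ^ (n + m)" if "r \<in> I" for r z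
  proof -
    have "\<bar>f r z\<bar> * \<bar>g r z\<bar> \<le> (C * (1 + \<bar>z\<bar>) ^ n) * (D * (1 + \<bar>z\<bar>) ^ m)"
      using C D that by (intro mult_mono) auto
    then show ?thesis by (simp add: abs_mult power_add algebra_simps)
  qed
  then show ?thesis unfolding poly_growth_def by blast
qed

lemma poly_growth_inverse:
  assumes "0 < a"
  shows "poly_growth {a..b} (\<lambda>r z. inverse (c * r ^ n))"
proof (rule poly_growth_bounded[of _ _ "\<bar>inverse c\<bar> * inverse (a ^ n)"])
  fix r assume "r \<in> {a..b}"
  then have "inverse (r ^ n) \<le> inverse (a ^ n)" "0 < r"
    using assms by (auto intro!: le_imp_inverse_le power_mono)
  then show "\<bar>inverse (c * r ^ n)\<bar> \<le> \<bar>inverse c\<bar> * inverse (a ^ n)"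
    by (simp add: abs_mult mult_left_mono)
qed

lemma poly_growth_variance: "poly_growth {a..b} (\<lambda>r z. r)"
  by (rule poly_growth_bounded[of _ _ "\<bar>a\<bar> + \<bar>b\<bar>"]) auto

lemma poly_growth_const: "poly_growth I (\<lambda>r z. c)"
  by (rule poly_growth_bounded[of _ _ "\<bar>c\<bar>"]) auto

lemma poly_growth_minus: "poly_growth I f \<Longrightarrow> poly_growth I (\<lambda>r z. - f r z)"
  unfolding poly_growth_def by auto

lemma poly_growth_diff: "poly_growth I f \<Longrightarrow> poly_growth I g \<Longrightarrow> poly_growth I (\<lambda>r z. f r z - g r z)"
  using poly_growth_add[OF _ poly_growth_minus] by fastforce

lemma poly_growth_power: "poly_growth I f \<Longrightarrow> poly_growth I (\<lambda>r z. f r z ^ n)"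
  by (induction n) (auto intro: poly_growth_const poly_growth_mult)

lemma poly_growth_divide:
  "poly_growth I f \<Longrightarrow> poly_growth I (\<lambda>r z. inverse (g r z)) \<Longrightarrow> poly_growth I (\<lambda>r z. f r z / g r z)"
  using poly_growth_mult[of I f] by (simp add: divide_inverse)

lemmas poly_growth_intros = poly_growth_arg poly_growth_const poly_growth_add poly_growth_mult
  poly_growth_inverse poly_growth_inverse[where c=1, simplified]
  poly_growth_inverse[where c=1 and n=1, simplified] poly_growth_variance poly_growth_minus poly_growth_diff poly_growth_power poly_growth_divide

text \<open>
  A power is dominated by \<open>exp \<bar>z\<bar>\<close>, and the quadratic exponent of the kernel dominates
  \<open>(K + 1) * \<bar>z\<bar>\<close> up to a constant, by completing the square.
\<close>
lemma poly_growth_gauss_bounded: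
  assumes "poly_growth {a..b} f" "0 < a" "0 \<le> K"
  obtains C where "0 \<le> C" "\<And>r z. r \<in> {a..b} \<Longrightarrow> \<bar>f r z * gauss r (z - K * r)\<bar> \<le> C"
proof -
  obtain D n where D: "0 \<le> D" "\<And>r z. r \<in> {a..b} \<Longrightarrow> \<bar>f r z\<bar> \<le> D * (1 + \<bar>z\<bar>) ^ n"
    using assms(1) by (rule poly_growthE) auto
  \<comment> \<open>The maximum over \<open>z\<close> of \<open>(K + 1) * \<bar>z\<bar> - z\<^sup>2 / (2 * b)\<close> is \<open>(K + 1)\<^sup>2 * b / 2\<close>.\<close>
  define C where "C = D * fact n * exp 1 * exp (((K + 1)\<^sup>2) * b / 2) / sqrt (2 * pi * a)"
  show thesis
  proof (cases "a \<le> b")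
    case False
    then show thesis using that[of 0] by auto
  next
    case True
    have "\<bar>f r z * gauss r (z - K * r)\<bar> \<le> C" if r: "r \<in> {a..b}" for r z
    proof -
      have r0: "0 < r" using r assms by auto
      have 1: "(1 + \<bar>z\<bar>) ^ n \<le> fact n * (exp 1 * exp \<bar>z\<bar>)"
      proof -
        have "(\<Sum>k\<in>{n}. (1 + \<bar>z\<bar>) ^ k /\<^sub>R fact k) \<le> (\<Sum>k. (1 + \<bar>z\<bar>) ^ k /\<^sub>R fact k)"
          by (intro sum_le_suminf summable_exp_generic) auto
        then have "(1 + \<bar>z\<bar>) ^ n / fact n \<le> exp (1 + \<bar>z\<bar>)"
          by (simp add: exp_def divide_inverse mult.commute)
        then show ?thesis by (simp add: field_simps exp_add)
      qed
      have 2: "gauss r (z - K * r) \<le> exp (- z\<^sup>2 / (2 * r) + K * \<bar>z\<bar>) / sqrt (2 * pi * a)"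
      proof -
        have "- (z - K * r)\<^sup>2 / (2 * r) = - z\<^sup>2 / (2 * r) + K * z - K\<^sup>2 * r / 2"
          using r0 by (simp add: field_simps power2_eq_square)
        also have "\<dots> \<le> - z\<^sup>2 / (2 * r) + K * \<bar>z\<bar>"
        proof -
          have "0 \<le> K\<^sup>2 * r" using r0 by simp
          with mult_left_mono[OF abs_ge_self assms(3), of z] show ?thesis by linarith
        qed
        finally show ?thesis
          unfolding gauss_def using r assms by (intro frac_le) auto
      qed
      have 3: "\<bar>z\<bar> + (- z\<^sup>2 / (2 * r) + K * \<bar>z\<bar>) \<le> (K + 1)\<^sup>2 * b / 2"
      proof -
        have "0 \<le> (\<bar>z\<bar> - (K + 1) * r)\<^sup>2 / (2 * r)" using r0 by simp
        also have "(\<bar>z\<bar> - (K + 1) * r)\<^sup>2 / (2 * r) = z\<^sup>2 / (2 * r) - (K + 1) * \<bar>z\<bar> + (K + 1)\<^sup>2 * r / 2"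
          using r0 by (simp add: field_simps power2_diff power2_eq_square)
        finally have "\<bar>z\<bar> + (- z\<^sup>2 / (2 * r) + K * \<bar>z\<bar>) \<le> (K + 1)\<^sup>2 * r / 2"
          by (simp add: algebra_simps)
        also have "\<dots> \<le> (K + 1)\<^sup>2 * b / 2" using r by (auto intro!: mult_left_mono)
        finally show ?thesis .
      qed
      have "\<bar>f r z * gauss r (z - K * r)\<bar> = \<bar>f r z\<bar> * gauss r (z - K * r)"
        using gauss_nonneg[OF r0] by (simp add: abs_mult)
      also have "\<dots> \<le> (D * (fact n * (exp 1 * exp \<bar>z\<bar>))) * (exp (- z\<^sup>2 / (2 * r) + K * \<bar>z\<bar>) / sqrt (2 * pi * a))"
        using D(1) 1 by (intro mult_mono order_trans[OF D(2)[OF r]] 2 gauss_nonneg r0 mult_left_mono) auto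
      also have "\<dots> = D * fact n * exp 1 * exp (\<bar>z\<bar> + (- z\<^sup>2 / (2 * r) + K * \<bar>z\<bar>)) / sqrt (2 * pi * a)"
        by (simp add: exp_add)
      also have "\<dots> \<le> C"
        unfolding C_def
        by (intro divide_right_mono mult_left_mono iffD2[OF exp_le_cancel_iff] 3) (use D(1) assms in auto)
      finally show ?thesis .
    qed
    moreover have "0 \<le> C" unfolding C_def using D assms by auto
    ultimately show thesis using that by blast
  qed
qed

lemma extremal_density_nonneg: "0 < r \<Longrightarrow> 0 \<le> K \<Longrightarrow> 0 \<le> extremal_density K r x"
  unfolding extremal_density_def drift_profile_def
  by (simp add: gauss_nonneg cdf_def)

text \<open>
  For \<open>K > 0\<close> the third derivative in \<open>x\<close> jumps at \<open>0\<close>, so the Lipschitz bound for the second derivative is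
  obtained on the half line and transported by \<open>\<bar>\<bar>x\<bar> - \<bar>y\<bar>\<bar> \<le> \<bar>x - y\<bar>\<close>.
\<close>
lemma extremal_density_dxx_lipschitz:
  assumes a: "0 < a" and K: "0 \<le> K"
  obtains C where "0 \<le> C"
    "\<And>r x y. r \<in> {a..b} \<Longrightarrow> \<bar>extremal_density_dxx K r x - extremal_density_dxx K r y\<bar> \<le> C * \<bar>x - y\<bar>"
proof -
  define p where "p r z = (2 * z - K * r) / r\<^sup>2 - (z\<^sup>2 - K * r * z - r) / r\<^sup>2 * ((z - K * r) / r)" for r z :: real
  have "poly_growth {a..b} p"
    unfolding p_def[abs_def] using a
    by (intro poly_growth_intros)
  then obtain C where C: "0 \<le> C" "\<And>r z. r \<in> {a..b} \<Longrightarrow> \<bar>p r z * gauss r (z - K * r)\<bar> \<le> C"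
    using a K by (rule poly_growth_gauss_bounded) auto
  have "\<bar>extremal_density_dxx K r x - extremal_density_dxx K r y\<bar> \<le> C * \<bar>x - y\<bar>" if r: "r \<in> {a..b}" for r x y
  proof -
    have r0: "0 < r" using r a by auto
    define q where "q z = (z\<^sup>2 - K * r * z - r) / r\<^sup>2 * gauss r (z - K * r)" for z
    have "(q has_real_derivative p r z * gauss r (z - K * r)) (at z)" for z
    proof -
      have "((\<lambda>z. (z\<^sup>2 - K * r * z - r) / r\<^sup>2) has_real_derivative (2 * z - K * r) / r\<^sup>2) (at z)"
        using r0 by (auto intro!: derivative_eq_intros simp: divide_simps)
      moreover have "((\<lambda>z. gauss r (z - K * r)) has_real_derivative
          - ((z - K * r) / r) * gauss r (z - K * r)) (at z)"
        using r0 by (auto intro!: derivative_eq_intros)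
      moreover have "A * g + - w * g * B = (A - B * w) * g" for A B g w :: real
        by (simp add: algebra_simps)
      ultimately show ?thesis
        unfolding q_def[abs_def] p_def by (intro DERIV_cong[OF DERIV_mult])
    qed
    then have "norm (q \<bar>x\<bar> - q \<bar>y\<bar>) \<le> C * norm (\<bar>x\<bar> - \<bar>y\<bar>)"
      using C(2)[OF r] by (intro field_differentiable_bound[of UNIV]) (auto intro: has_field_derivative_at_within)
    also have "\<dots> \<le> C * \<bar>x - y\<bar>"
      using C(1) by (auto intro!: mult_left_mono)
    finally show ?thesis by (simp add: q_def extremal_density_dxx_def)
  qed
  with C(1) show thesis using that by blast
qed

lemma extremal_density_variance_taylor:
  assumes a: "0 < a" and K: "0 \<le> K"
  obtains C where "0 \<le> C"
    "\<And>r h x. a \<le> r \<Longrightarrow> 0 \<le> h \<Longrightarrow> r + h \<le> b \<Longrightarrow>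
       \<bar>extremal_density K (r + h) x - extremal_density K r x - h * extremal_density_dr K r x\<bar> \<le> C * h\<^sup>2"
proof -
  define q where "q r z = (z\<^sup>2 + K * r * z - r) / (2 * r\<^sup>2)" for r z :: real
  define p where "p r z = (K * z - 1) / (2 * r\<^sup>2) - (z\<^sup>2 + K * r * z - r) / r ^ 3 +
      q r z * ((z\<^sup>2 - K\<^sup>2 * r\<^sup>2 - r) / (2 * r\<^sup>2))" for r z :: real
  have "poly_growth {a..b} p"
    unfolding p_def[abs_def] q_def[abs_def] using a
    by (intro poly_growth_intros)
  then obtain C where C: "0 \<le> C" "\<And>r z. r \<in> {a..b} \<Longrightarrow> \<bar>p r z * gauss r (z - K * r)\<bar> \<le> C"
    using a K by (rule poly_growth_gauss_bounded) auto
  have "\<bar>extremal_density K (r + h) x - extremal_density K r x - h * extremal_density_dr K r x\<bar> \<le> C * h\<^sup>2"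
    if r: "a \<le> r" "0 \<le> h" "r + h \<le> b" for r h x
  proof (cases "h = 0")
    case False
    then have h: "0 < h" using r by simp
    have dr: "((\<lambda>r. extremal_density_dr K r x) has_real_derivative p s \<bar>x\<bar> * gauss s (\<bar>x\<bar> - K * s)) (at s within S)"
      if "0 < s" for s S
    proof -
      have "((\<lambda>s. q s z) has_real_derivative (K * z - 1) / (2 * s\<^sup>2) - (z\<^sup>2 + K * s * z - s) / s ^ 3) (at s within S)" for z
      proof -
        have "((\<lambda>s. q s z) has_real_derivative
            ((K * z - 1) * (2 * s\<^sup>2) - (z\<^sup>2 + K * s * z - s) * (4 * s)) / (2 * s\<^sup>2 * (2 * s\<^sup>2))) (at s within S)"
          unfolding q_def using that by (intro DERIV_divide) (auto intro!: derivative_eq_intros)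
        also have "((K * z - 1) * (2 * s\<^sup>2) - A * (4 * s)) / (2 * s\<^sup>2 * (2 * s\<^sup>2))
            = (K * z - 1) / (2 * s\<^sup>2) - A / s ^ 3" for A
          using that by (simp add: divide_simps) (simp add: algebra_simps eval_nat_numeral)
        finally show ?thesis .
      qed
      from DERIV_mult[OF this DERIV_gauss_variance[OF that, of "\<bar>x\<bar>" K S], of "\<bar>x\<bar>"] show ?thesis
        unfolding extremal_density_dr_def q_def p_def by (rule DERIV_cong) (simp only: distrib_left distrib_right mult_ac)
    qed
    obtain s where s: "r < s" "s < r + h" "extremal_density K (r + h) x - extremal_density K r x = (r + h - r) * extremal_density_dr K s x"
      using MVT2[of r "r + h" "\<lambda>r. extremal_density K r x" "\<lambda>r. extremal_density_dr K r x"] DERIV_extremal_density_variance[of _ K x] h r a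
      by force
    have "norm (extremal_density_dr K s x - extremal_density_dr K r x) \<le> C * norm (s - r)"
      by (rule field_differentiable_bound[of "{a..b}" "\<lambda>r. extremal_density_dr K r x"
            "\<lambda>s. p s \<bar>x\<bar> * gauss s (\<bar>x\<bar> - K * s)"])
         (use C(2) dr s r a in auto)
    also have "\<dots> \<le> C * h" using s C(1) by (auto intro!: mult_left_mono)
    finally have "h * \<bar>extremal_density_dr K s x - extremal_density_dr K r x\<bar> \<le> h * (C * h)"
      using h by (intro mult_left_mono) auto
    moreover have "extremal_density K (r + h) x - extremal_density K r x - h * extremal_density_dr K r x = h * (extremal_density_dr K s x - extremal_density_dr K r x)"
      using s(3) by (simp add: algebra_simps)
    ultimately show ?thesis using h by (simp add: abs_mult power2_eq_square mult_ac)
  qed simp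
  with C(1) show thesis using that by blast
qed

lemma extremal_density_bounded:
  assumes a: "0 < a" and K: "0 \<le> K"
  obtains C where "0 \<le> C"
    "\<And>r x. r \<in> {a..b} \<Longrightarrow> \<bar>extremal_density K r x\<bar> \<le> C"
    "\<And>r x. r \<in> {a..b} \<Longrightarrow> \<bar>extremal_density_dx K r x\<bar> \<le> C"
    "\<And>r x. r \<in> {a..b} \<Longrightarrow> \<bar>extremal_density_dxx K r x\<bar> \<le> C"
proof -
  have g: "poly_growth {a..b} (\<lambda>r z. 1)" "poly_growth {a..b} (\<lambda>r z. - (z / r))"
    "poly_growth {a..b} (\<lambda>r z. (z\<^sup>2 - K * r * z - r) / r\<^sup>2)"
    by (intro poly_growth_intros a)+
  obtain C0 where C0: "0 \<le> C0" "\<And>r z. r \<in> {a..b} \<Longrightarrow> \<bar>1 * gauss r (z - K * r)\<bar> \<le> C0"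
    using poly_growth_gauss_bounded[OF g(1) a K] by blast
  obtain C1 where C1: "0 \<le> C1" "\<And>r z. r \<in> {a..b} \<Longrightarrow> \<bar>- (z / r) * gauss r (z - K * r)\<bar> \<le> C1"
    using poly_growth_gauss_bounded[OF g(2) a K] by blast
  obtain C2 where C2: "0 \<le> C2" "\<And>r z. r \<in> {a..b} \<Longrightarrow>
      \<bar>(z\<^sup>2 - K * r * z - r) / r\<^sup>2 * gauss r (z - K * r)\<bar> \<le> C2"
    using poly_growth_gauss_bounded[OF g(3) a K] by blast
  interpret N: real_distribution std_normal_distribution
    by (rule real_dist_normal_dist)
  show thesis
  proof (rule that[of "C0 + K + C1 + C2"])
    fix r x assume r: "r \<in> {a..b}"
    have "\<bar>extremal_density K r x\<bar> \<le> \<bar>gauss r (\<bar>x\<bar> - K * r)\<bar> + K * \<bar>std_normal_cdf ((K * r - \<bar>x\<bar>) / sqrt r)\<bar>"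
      unfolding extremal_density_def drift_profile_def using K by (intro order_trans[OF abs_triangle_ineq]) (simp add: abs_mult)
    also have "\<dots> \<le> C0 + K * 1"
      using C0(2)[OF r, of "\<bar>x\<bar>"] K N.cdf_bounded_prob N.cdf_nonneg by (intro add_mono mult_left_mono) auto
    finally show "\<bar>extremal_density K r x\<bar> \<le> C0 + K + C1 + C2" using C1(1) C2(1) by simp
    show "\<bar>extremal_density_dx K r x\<bar> \<le> C0 + K + C1 + C2"
      using C1(2)[OF r, of "\<bar>x\<bar>"] C0 C1 C2 K by (simp add: extremal_density_dx_def abs_mult)
    show "\<bar>extremal_density_dxx K r x\<bar> \<le> C0 + K + C1 + C2"
      using C2(2)[OF r, of "\<bar>x\<bar>"] C0 C1 C2 K by (simp add: extremal_density_dxx_def)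
  qed (use C0 C1 C2 K in auto)
qed

section \<open>Expectations over one short time step\<close>
lemma lipschitz_of_bounded_deriv:
  fixes f f' :: "real \<Rightarrow> real"
  assumes "\<And>x. (f has_real_derivative f' x) (at x)" "\<And>x. \<bar>f' x\<bar> \<le> C"
  shows "\<bar>f x - f y\<bar> \<le> C * \<bar>x - y\<bar>"
  using field_differentiable_bound[of UNIV f f' C x y] assms
  by (simp add: has_field_derivative_at_within)

lemma small_of_small_deriv:
  fixes f f' :: "real \<Rightarrow> real"
  assumes "\<And>x. (f has_real_derivative f' x) (at x)" "\<And>x. \<bar>x\<bar> \<le> \<bar>d\<bar> \<Longrightarrow> \<bar>f' x\<bar> \<le> C" "f 0 = 0"
  shows "\<bar>f d\<bar> \<le> C * \<bar>d\<bar>"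
proof -
  have "norm (f d - f 0) \<le> C * norm (d - 0)"
    by (rule field_differentiable_bound[of "{- \<bar>d\<bar>..\<bar>d\<bar>}" f f'])
       (use assms in \<open>auto intro: has_field_derivative_at_within\<close>)
  then show ?thesis using assms(3) by simp
qed

lemma taylor_first_order:
  fixes f f' :: "real \<Rightarrow> real"
  assumes f: "\<And>x. (f has_real_derivative f' x) (at x)"
    and f': "\<And>x y. \<bar>f' x - f' y\<bar> \<le> C * \<bar>x - y\<bar>"
  shows "\<bar>f (x + d) - f x - d * f' x\<bar> \<le> C * d\<^sup>2"
proof -
  have C: "0 \<le> C" using f'[of 1 0] by simp
  have "\<bar>f (x + d) - f x - d * f' x\<bar> \<le> (C * \<bar>d\<bar>) * \<bar>d\<bar>"
  proof (rule small_of_small_deriv[of "\<lambda>d. f (x + d) - f x - d * f' x" "\<lambda>d. f' (x + d) - f' x"])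
    show "((\<lambda>d. f (x + d) - f x - d * f' x) has_real_derivative f' (x + e) - f' x) (at e)" for e
      by (auto intro!: derivative_eq_intros DERIV_chain2[OF f])
    show "\<bar>f' (x + e) - f' x\<bar> \<le> C * \<bar>d\<bar>" if "\<bar>e\<bar> \<le> \<bar>d\<bar>" for e
      using f'[of "x + e" x] mult_left_mono[OF that C] by simp
  qed simp
  then show ?thesis by (simp add: power2_eq_square mult.assoc)
qed

lemma taylor_second_order:
  fixes f f' f'' :: "real \<Rightarrow> real"
  assumes f: "\<And>x. (f has_real_derivative f' x) (at x)" and f': "\<And>x. (f' has_real_derivative f'' x) (at x)"
    and f'': "\<And>x y. \<bar>f'' x - f'' y\<bar> \<le> C * \<bar>x - y\<bar>"
  shows "\<bar>f (x + d) - f x - d * f' x - d\<^sup>2 / 2 * f'' x\<bar> \<le> C * \<bar>d\<bar> ^ 3"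
proof -
  have C: "0 \<le> C" using f''[of 1 0] by simp
  have "\<bar>f (x + d) - f x - d * f' x - d\<^sup>2 / 2 * f'' x\<bar> \<le> (C * d\<^sup>2) * \<bar>d\<bar>"
  proof (rule small_of_small_deriv[of "\<lambda>d. f (x + d) - f x - d * f' x - d\<^sup>2 / 2 * f'' x"
        "\<lambda>d. f' (x + d) - f' x - d * f'' x"])
    show "((\<lambda>d. f (x + d) - f x - d * f' x - d\<^sup>2 / 2 * f'' x) has_real_derivative
        f' (x + e) - f' x - e * f'' x) (at e)" for e
      by (auto intro!: derivative_eq_intros DERIV_chain2[OF f])
    show "\<bar>f' (x + e) - f' x - e * f'' x\<bar> \<le> C * d\<^sup>2" if "\<bar>e\<bar> \<le> \<bar>d\<bar>" for e
      using taylor_first_order[OF f' f'', of x e] mult_left_mono[OF power_mono[OF that, of 2] C] by simp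
  qed simp
  then show ?thesis by (simp add: eval_nat_numeral mult.assoc)
qed

lemma (in prob_space) normal_moments:
  assumes N: "distributed M lborel N (\<lambda>x. ennreal (normal_density 0 (sqrt h) x))" and h: "0 < h"
  shows "integrable M N" "integrable M (\<lambda>\<omega>. (N \<omega>)\<^sup>2)" "integrable M (\<lambda>\<omega>. \<bar>N \<omega>\<bar> ^ 3)"
    and "expectation N = 0" "expectation (\<lambda>\<omega>. (N \<omega>)\<^sup>2) = h"
    and "expectation (\<lambda>\<omega>. \<bar>N \<omega>\<bar>) \<le> sqrt h" "expectation (\<lambda>\<omega>. \<bar>N \<omega>\<bar> ^ 3) \<le> 2 * (h * sqrt h)"
proof -
  have s: "0 < sqrt h" using h by simp
  note I = distributed_integrable[OF N, simplified, symmetric]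
  note E = distributed_integral[OF N, simplified, symmetric]
  show "integrable M N"
    using integrable_normal_moment[OF s, of 0 1] I[of "\<lambda>x. x"] by simp
  show "integrable M (\<lambda>\<omega>. (N \<omega>)\<^sup>2)"
    using integrable_normal_moment[OF s, of 0 2] I[of "\<lambda>x. x\<^sup>2"] by simp
  show "integrable M (\<lambda>\<omega>. \<bar>N \<omega>\<bar> ^ 3)"
    using integrable_normal_moment_abs[OF s, of 0 3] I[of "\<lambda>x. \<bar>x\<bar> ^ 3"] by simp
  show "expectation N = 0"
    using integral_normal_moment_odd[OF s, of 0 0] E[of "\<lambda>x. x"] by simp
  show "expectation (\<lambda>\<omega>. (N \<omega>)\<^sup>2) = h"
    using integral_normal_moment_even[OF s, of 0 1] E[of "\<lambda>x. x\<^sup>2"] h by simp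
  have p: "sqrt (2 / pi) \<le> 1" using pi_gt3 by simp
  have "expectation (\<lambda>\<omega>. \<bar>N \<omega>\<bar>) = sqrt h * sqrt (2 / pi)"
    using integral_normal_moment_abs_odd[OF s, of 0 0] E[of "\<lambda>x. \<bar>x\<bar>"] by simp
  also have "\<dots> \<le> sqrt h * 1" using p h by (intro mult_left_mono) auto
  finally show "expectation (\<lambda>\<omega>. \<bar>N \<omega>\<bar>) \<le> sqrt h" by simp
  have "expectation (\<lambda>\<omega>. \<bar>N \<omega>\<bar> ^ 3) = 2 * sqrt h ^ 3 * sqrt (2 / pi)"
    using integral_normal_moment_abs_odd[OF s, of 0 1] E[of "\<lambda>x. \<bar>x\<bar> ^ 3"] by (simp add: eval_nat_numeral)
  also have "\<dots> \<le> 2 * sqrt h ^ 3 * 1" using p h by (intro mult_left_mono) auto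
  finally show "expectation (\<lambda>\<omega>. \<bar>N \<omega>\<bar> ^ 3) \<le> 2 * (h * sqrt h)" using h by (simp add: power3_eq_cube mult_ac)
qed

lemma power2_le_mult_sqrt:
  fixes h :: real
  assumes "0 \<le> h" "h \<le> 1"
  shows "h\<^sup>2 \<le> h * sqrt h"
proof -
  have "h = sqrt h * sqrt h" using assms by simp
  also have "\<dots> \<le> sqrt h * 1" using assms by (intro mult_left_mono) auto
  finally have "h \<le> sqrt h" by simp
  then show ?thesis unfolding power2_eq_square using assms by (intro mult_left_mono) auto
qed

text \<open>
  This plays the role of the Ito formula. Since \<open>N\<close> is centred with variance \<open>h\<close> and independent of
  \<open>Y\<close>, the terms in \<open>N\<close> and \<open>N\<^sup>2\<close> of the Taylor expansion have expectations \<open>0\<close> and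
  \<open>h / 2 * E (f'' Y)\<close>; every other term is \<open>O(h powr (3/2))\<close> because \<open>\<bar>N\<bar>\<close> is of order \<open>sqrt h\<close>. The
  variable \<open>b\<close> may depend on \<open>N\<close>, so the term \<open>b * f' (Y + N)\<close> is first replaced by \<open>b * f' Y\<close>.
\<close>
lemma (in prob_space) one_step_expansion:
  fixes Y N b :: "'a \<Rightarrow> real" and f f' f'' :: "real \<Rightarrow> real"
  assumes indep: "indep_var borel Y borel N"
    and N: "distributed M lborel N (\<lambda>x. ennreal (normal_density 0 (sqrt h) x))"
    and h: "0 < h" "h \<le> 1"
    and b [measurable]: "random_variable borel b" and b_le: "AE \<omega> in M. \<bar>b \<omega>\<bar> \<le> B * h" and B: "0 \<le> B"
    and f: "\<And>x. (f has_real_derivative f' x) (at x)" and f': "\<And>x. (f' has_real_derivative f'' x) (at x)"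
    and bounds: "\<And>x. \<bar>f x\<bar> \<le> C" "\<And>x. \<bar>f' x\<bar> \<le> C" "\<And>x. \<bar>f'' x\<bar> \<le> C"
    and lip: "\<And>x y. \<bar>f'' x - f'' y\<bar> \<le> C * \<bar>x - y\<bar>"
  shows "\<bar>expectation (\<lambda>\<omega>. f (Y \<omega> + N \<omega> + b \<omega>)) - expectation (\<lambda>\<omega>. f (Y \<omega>))
     - expectation (\<lambda>\<omega>. b \<omega> * f' (Y \<omega>)) - h / 2 * expectation (\<lambda>\<omega>. f'' (Y \<omega>))\<bar>
     \<le> C * (2 + B + B\<^sup>2) * (h * sqrt h)"
proof -
  have [measurable]: "random_variable borel Y" "random_variable borel N"
    using indep by (auto dest: indep_var_rv1 indep_var_rv2)
  have cont: "continuous_on UNIV f" "continuous_on UNIV f'" "continuous_on UNIV f''"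
  proof -
    show "continuous_on UNIV f" "continuous_on UNIV f'"
      using f f' by (auto intro!: DERIV_continuous_on intro: has_field_derivative_at_within)
    have "C-lipschitz_on UNIV f''"
      using lip bounds(1)[of 0] by (auto simp: lipschitz_on_def dist_real_def)
    then show "continuous_on UNIV f''" by (rule lipschitz_on_continuous_on)
  qed
  have [measurable]: "f \<in> borel_measurable borel" "f' \<in> borel_measurable borel" "f'' \<in> borel_measurable borel"
    using cont by (auto intro: borel_measurable_continuous_onI)
  have C: "0 \<le> C" using bounds(1)[of 0] by simp
  note mom = normal_moments[OF N h(1)]
  have int: "integrable M (\<lambda>\<omega>. f (Y \<omega> + N \<omega> + b \<omega>))" "integrable M (\<lambda>\<omega>. f (Y \<omega>))"
      "integrable M (\<lambda>\<omega>. f' (Y \<omega>))" "integrable M (\<lambda>\<omega>. f'' (Y \<omega>))"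
    using bounds by (auto intro!: integrable_const_bound[where B=C])
  have intb: "integrable M (\<lambda>\<omega>. b \<omega> * f' (Y \<omega>))"
  proof (rule integrable_const_bound[where B="B * h * C"])
    show "AE \<omega> in M. norm (b \<omega> * f' (Y \<omega>)) \<le> B * h * C"
      using b_le by eventually_elim (use bounds(2) B h in \<open>auto simp: abs_mult intro!: mult_mono\<close>)
  qed measurable
  have 1: "integrable M (\<lambda>\<omega>. f' (Y \<omega>) * N \<omega>)" "expectation (\<lambda>\<omega>. f' (Y \<omega>) * N \<omega>) = 0"
  proof -
    have i: "indep_var borel (\<lambda>\<omega>. f' (Y \<omega>)) borel N"
    proof -
      have "indep_var borel (f' \<circ> Y) borel ((\<lambda>x. x) \<circ> N)"
        by (rule indep_var_compose[OF indep]) auto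
      then show ?thesis by (simp only: comp_def)
    qed
    show "integrable M (\<lambda>\<omega>. f' (Y \<omega>) * N \<omega>)" "expectation (\<lambda>\<omega>. f' (Y \<omega>) * N \<omega>) = 0"
      using indep_var_integrable[OF i int(3) mom(1)] indep_var_lebesgue_integral[OF i int(3) mom(1)] mom(4) by simp_all
  qed
  have 2: "integrable M (\<lambda>\<omega>. f'' (Y \<omega>) * (N \<omega>)\<^sup>2)"
       "expectation (\<lambda>\<omega>. f'' (Y \<omega>) * (N \<omega>)\<^sup>2) = expectation (\<lambda>\<omega>. f'' (Y \<omega>)) * h"
  proof -
    have i: "indep_var borel (\<lambda>\<omega>. f'' (Y \<omega>)) borel (\<lambda>\<omega>. (N \<omega>)\<^sup>2)"
    proof -
      have "indep_var borel (f'' \<circ> Y) borel ((\<lambda>x. x\<^sup>2) \<circ> N)"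
        by (rule indep_var_compose[OF indep]) auto
      then show ?thesis by (simp only: comp_def)
    qed
    show "integrable M (\<lambda>\<omega>. f'' (Y \<omega>) * (N \<omega>)\<^sup>2)"
       "expectation (\<lambda>\<omega>. f'' (Y \<omega>) * (N \<omega>)\<^sup>2) = expectation (\<lambda>\<omega>. f'' (Y \<omega>)) * h"
      using indep_var_integrable[OF i int(4) mom(2)] indep_var_lebesgue_integral[OF i int(4) mom(2)] mom(5) by simp_all
  qed
  define R where "R \<omega> = f (Y \<omega> + N \<omega> + b \<omega>) - f (Y \<omega>) - b \<omega> * f' (Y \<omega>) - f' (Y \<omega>) * N \<omega>
    - f'' (Y \<omega>) * (N \<omega>)\<^sup>2 / 2" for \<omega>
  have R: "integrable M R"
    unfolding R_def[abs_def] using int intb 1 2 by (intro Bochner_Integration.integrable_diff integrable_divide)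
  have ER: "expectation R = expectation (\<lambda>\<omega>. f (Y \<omega> + N \<omega> + b \<omega>)) - expectation (\<lambda>\<omega>. f (Y \<omega>))
     - expectation (\<lambda>\<omega>. b \<omega> * f' (Y \<omega>)) - h / 2 * expectation (\<lambda>\<omega>. f'' (Y \<omega>))"
    unfolding R_def[abs_def] using int intb 1 2 by simp
  have "h\<^sup>2 \<le> h * sqrt h" using h by (intro power2_le_mult_sqrt) auto
  have R_le: "AE \<omega> in M. \<bar>R \<omega>\<bar> \<le> C * B\<^sup>2 * (h * sqrt h) + C * B * h * \<bar>N \<omega>\<bar> + C * \<bar>N \<omega>\<bar> ^ 3"
    using b_le
  proof eventually_elim
    fix \<omega> assume b: "\<bar>b \<omega>\<bar> \<le> B * h"
    have lip': "\<bar>f' x - f' y\<bar> \<le> C * \<bar>x - y\<bar>" for x y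
      using f' bounds(3) by (rule lipschitz_of_bounded_deriv)
    have "\<bar>f (Y \<omega> + N \<omega> + b \<omega>) - f (Y \<omega> + N \<omega>) - b \<omega> * f' (Y \<omega> + N \<omega>)\<bar> \<le> C * (b \<omega>)\<^sup>2"
      using f lip' by (rule taylor_first_order)
    also have "\<dots> \<le> C * (B * h)\<^sup>2"
      using power_mono[OF b, of 2] C by (intro mult_left_mono) auto
    also have "\<dots> \<le> C * B\<^sup>2 * (h * sqrt h)"
      using \<open>h\<^sup>2 \<le> h * sqrt h\<close> C by (simp add: power_mult_distrib mult.assoc mult_left_mono)
    finally have a: "\<bar>f (Y \<omega> + N \<omega> + b \<omega>) - f (Y \<omega> + N \<omega>) - b \<omega> * f' (Y \<omega> + N \<omega>)\<bar> \<le> C * B\<^sup>2 * (h * sqrt h)" .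
    have "\<bar>b \<omega> * f' (Y \<omega> + N \<omega>) - b \<omega> * f' (Y \<omega>)\<bar> = \<bar>b \<omega>\<bar> * \<bar>f' (Y \<omega> + N \<omega>) - f' (Y \<omega>)\<bar>"
      by (simp add: abs_mult[symmetric] right_diff_distrib)
    also have "\<dots> \<le> (B * h) * (C * \<bar>N \<omega>\<bar>)"
      using b lip'[of "Y \<omega> + N \<omega>" "Y \<omega>"] B h by (intro mult_mono) auto
    finally have c: "\<bar>b \<omega> * f' (Y \<omega> + N \<omega>) - b \<omega> * f' (Y \<omega>)\<bar> \<le> C * B * h * \<bar>N \<omega>\<bar>" by (simp add: mult_ac)
    have d: "\<bar>f (Y \<omega> + N \<omega>) - f (Y \<omega>) - N \<omega> * f' (Y \<omega>) - (N \<omega>)\<^sup>2 / 2 * f'' (Y \<omega>)\<bar> \<le> C * \<bar>N \<omega>\<bar> ^ 3"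
      using f f' lip by (rule taylor_second_order)
    show "\<bar>R \<omega>\<bar> \<le> C * B\<^sup>2 * (h * sqrt h) + C * B * h * \<bar>N \<omega>\<bar> + C * \<bar>N \<omega>\<bar> ^ 3"
      using a c d unfolding R_def by (simp add: mult_ac abs_le_iff)
  qed
  have "\<bar>expectation R\<bar> \<le> expectation (\<lambda>\<omega>. \<bar>R \<omega>\<bar>)"
    by (rule integral_abs_bound)
  also have "\<dots> \<le> expectation (\<lambda>\<omega>. C * B\<^sup>2 * (h * sqrt h) + C * B * h * \<bar>N \<omega>\<bar> + C * \<bar>N \<omega>\<bar> ^ 3)"
    using R R_le mom by (intro integral_mono_AE) auto
  also have "\<dots> = C * B\<^sup>2 * (h * sqrt h) + C * B * h * expectation (\<lambda>\<omega>. \<bar>N \<omega>\<bar>) + C * expectation (\<lambda>\<omega>. \<bar>N \<omega>\<bar> ^ 3)"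
    using mom by (simp add: prob_space)
  also have "\<dots> \<le> C * B\<^sup>2 * (h * sqrt h) + C * B * h * sqrt h + C * (2 * (h * sqrt h))"
    using mom(6,7) C B h by (intro add_mono mult_left_mono) auto
  finally show ?thesis unfolding ER by (simp add: algebra_simps)
qed

text \<open>
  The expansion is applied to the extremal density, whose elapsed time decreases from \<open>r + h\<close> to \<open>r\<close>
  while the motion advances by \<open>h\<close>. The equation \<open>extremal_density_hjb\<close> turns the second order term
  and the time derivative into the gain that full speed drift would produce. Here \<open>K\<close> is the
  parameter of the density and \<open>B\<close> the bound on the actual drift: they agree in the comparison
  argument, while \<open>K = 0\<close> gives the expansion for the heat kernel.
\<close>
lemma (in prob_space) extremal_density_step:
  assumes a: "0 < a" and K: "0 \<le> K" and B: "0 \<le> B"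
  obtains C where "0 \<le> C"
    "\<And>Y N b h r y. indep_var borel Y borel N \<Longrightarrow>
       distributed M lborel N (\<lambda>x. ennreal (normal_density 0 (sqrt h) x)) \<Longrightarrow>
       0 < h \<Longrightarrow> h \<le> 1 \<Longrightarrow> random_variable borel b \<Longrightarrow> (AE \<omega> in M. \<bar>b \<omega>\<bar> \<le> B * h) \<Longrightarrow>
       a \<le> r \<Longrightarrow> r + h \<le> c \<Longrightarrow>
       \<bar>expectation (\<lambda>\<omega>. extremal_density K r (Y \<omega> + N \<omega> + b \<omega> - y))
        - expectation (\<lambda>\<omega>. extremal_density K (r + h) (Y \<omega> - y))
        - expectation (\<lambda>\<omega>. b \<omega> * extremal_density_dx K r (Y \<omega> - y))
        + h * K * expectation (\<lambda>\<omega>. \<bar>extremal_density_dx K r (Y \<omega> - y)\<bar>)\<bar> \<le> C * (h * sqrt h)"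
proof -
  obtain C1 where C1: "0 \<le> C1"
    "\<And>r x. r \<in> {a..c} \<Longrightarrow> \<bar>extremal_density K r x\<bar> \<le> C1"
    "\<And>r x. r \<in> {a..c} \<Longrightarrow> \<bar>extremal_density_dx K r x\<bar> \<le> C1"
    "\<And>r x. r \<in> {a..c} \<Longrightarrow> \<bar>extremal_density_dxx K r x\<bar> \<le> C1"
    using extremal_density_bounded[OF a K, of c] by blast
  obtain C2 where C2: "0 \<le> C2"
    "\<And>r x y. r \<in> {a..c} \<Longrightarrow> \<bar>extremal_density_dxx K r x - extremal_density_dxx K r y\<bar> \<le> C2 * \<bar>x - y\<bar>"
    using extremal_density_dxx_lipschitz[OF a K, of c] by blast
  obtain C3 where C3: "0 \<le> C3"
    "\<And>r h x. a \<le> r \<Longrightarrow> 0 \<le> h \<Longrightarrow> r + h \<le> c \<Longrightarrow>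
       \<bar>extremal_density K (r + h) x - extremal_density K r x - h * extremal_density_dr K r x\<bar> \<le> C3 * h\<^sup>2"
    using extremal_density_variance_taylor[OF a K, of c] by blast
  define C where "C = C1 + C2"
  have C: "0 \<le> C" "C1 \<le> C" "C2 \<le> C" using C1(1) C2(1) by (auto simp: C_def)
  show thesis
  proof (rule that[of "C * (2 + B + B\<^sup>2) + C3"])
    show "0 \<le> C * (2 + B + B\<^sup>2) + C3" using C C3(1) B by simp
    fix Y N b :: "'a \<Rightarrow> real" and h r y :: real
    assume indep: "indep_var borel Y borel N"
      and N: "distributed M lborel N (\<lambda>x. ennreal (normal_density 0 (sqrt h) x))"
      and h: "0 < h" "h \<le> 1" and b: "random_variable borel b" "AE \<omega> in M. \<bar>b \<omega>\<bar> \<le> B * h"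
      and r: "a \<le> r" "r + h \<le> c"
    have r': "r \<in> {a..c}" "r + h \<in> {a..c}" "0 < r" "0 < r + h" using r h a by auto
    have Y [measurable]: "random_variable borel Y" using indep by (rule indep_var_rv1)
    have d1: "((\<lambda>x. extremal_density K r (x - y)) has_real_derivative extremal_density_dx K r (x - y)) (at x)" for x
      using DERIV_extremal_density[OF r'(3), of K "x - y"] DERIV_shift[of "extremal_density K r" _ x "- y"] by simp
    have d2: "((\<lambda>x. extremal_density_dx K r (x - y)) has_real_derivative extremal_density_dxx K r (x - y)) (at x)" for x
      using DERIV_extremal_density_dx[OF r'(3), of K "x - y"] DERIV_shift[of "extremal_density_dx K r" _ x "- y"] by simp
    have step: "\<bar>expectation (\<lambda>\<omega>. extremal_density K r (Y \<omega> + N \<omega> + b \<omega> - y))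
        - expectation (\<lambda>\<omega>. extremal_density K r (Y \<omega> - y))
        - expectation (\<lambda>\<omega>. b \<omega> * extremal_density_dx K r (Y \<omega> - y))
        - h / 2 * expectation (\<lambda>\<omega>. extremal_density_dxx K r (Y \<omega> - y))\<bar> \<le> C * (2 + B + B\<^sup>2) * (h * sqrt h)"
      by (rule one_step_expansion[OF indep N h b B d1 d2])
         (use order_trans[OF C1(2)[OF r'(1)] C(2)] order_trans[OF C1(3)[OF r'(1)] C(2)]
           order_trans[OF C1(4)[OF r'(1)] C(2)]
           order_trans[OF C2(2)[OF r'(1)] mult_right_mono[OF C(3) abs_ge_zero], of "_ - y" "_ - y"] in auto)
    note [measurable] = borel_measurable_extremal_density[OF r'(3)] borel_measurable_extremal_density[OF r'(4)]
    have int: "integrable M (\<lambda>\<omega>. extremal_density K r (Y \<omega> - y))"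
      "integrable M (\<lambda>\<omega>. extremal_density K (r + h) (Y \<omega> - y))"
      "integrable M (\<lambda>\<omega>. extremal_density_dxx K r (Y \<omega> - y))"
      "integrable M (\<lambda>\<omega>. \<bar>extremal_density_dx K r (Y \<omega> - y)\<bar>)"
      using C1 r' by (auto intro!: integrable_const_bound[where B=C1])
    have "h\<^sup>2 \<le> h * sqrt h" using h by (intro power2_le_mult_sqrt) auto
    have "\<bar>expectation (\<lambda>\<omega>. extremal_density K (r + h) (Y \<omega> - y) - extremal_density K r (Y \<omega> - y)
          - h * (extremal_density_dxx K r (Y \<omega> - y) / 2 + K * \<bar>extremal_density_dx K r (Y \<omega> - y)\<bar>))\<bar>
       \<le> expectation (\<lambda>\<omega>. C3 * (h * sqrt h))"
    proof (rule order_trans[OF integral_abs_bound integral_mono])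
      fix \<omega>
      have "\<bar>extremal_density K (r + h) (Y \<omega> - y) - extremal_density K r (Y \<omega> - y)
          - h * extremal_density_dr K r (Y \<omega> - y)\<bar> \<le> C3 * h\<^sup>2"
        using r h by (intro C3) auto
      also have "\<dots> \<le> C3 * (h * sqrt h)" using \<open>h\<^sup>2 \<le> h * sqrt h\<close> C3(1) by (rule mult_left_mono)
      finally show "\<bar>extremal_density K (r + h) (Y \<omega> - y) - extremal_density K r (Y \<omega> - y)
          - h * (extremal_density_dxx K r (Y \<omega> - y) / 2 + K * \<bar>extremal_density_dx K r (Y \<omega> - y)\<bar>)\<bar> \<le> C3 * (h * sqrt h)"
        using extremal_density_hjb[OF r'(3) K] by simp
    qed (use int in auto)
    then have "\<bar>expectation (\<lambda>\<omega>. extremal_density K (r + h) (Y \<omega> - y)) - expectation (\<lambda>\<omega>. extremal_density K r (Y \<omega> - y))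
          - h * (expectation (\<lambda>\<omega>. extremal_density_dxx K r (Y \<omega> - y)) / 2
               + K * expectation (\<lambda>\<omega>. \<bar>extremal_density_dx K r (Y \<omega> - y)\<bar>))\<bar> \<le> C3 * (h * sqrt h)"
      using int by (simp add: prob_space)
    with step show "\<bar>expectation (\<lambda>\<omega>. extremal_density K r (Y \<omega> + N \<omega> + b \<omega> - y))
        - expectation (\<lambda>\<omega>. extremal_density K (r + h) (Y \<omega> - y))
        - expectation (\<lambda>\<omega>. b \<omega> * extremal_density_dx K r (Y \<omega> - y))
        + h * K * expectation (\<lambda>\<omega>. \<bar>extremal_density_dx K r (Y \<omega> - y)\<bar>)\<bar> \<le> (C * (2 + B + B\<^sup>2) + C3) * (h * sqrt h)"
      unfolding distrib_right[of _ _ "h * sqrt h"] distrib_left[of h] abs_le_iff by (simp add: mult_ac)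
  qed
qed

text \<open>
  With \<open>n\<close> steps of length \<open>h = (T - \<tau>) / n\<close> the errors add up to \<open>C * (T - \<tau>) * sqrt h\<close>, and
  the remaining Riemann sum is controlled by the uniform continuity of \<open>a\<close>.
\<close>
lemma increment_le_integral:
  fixes D a :: "real \<Rightarrow> real"
  assumes T: "\<tau> \<le> T" and a: "continuous_on {\<tau>..T} a" and h0: "0 < h0"
    and step: "\<And>t h. \<tau> \<le> t \<Longrightarrow> t + h \<le> T \<Longrightarrow> 0 < h \<Longrightarrow> h \<le> h0 \<Longrightarrow> D (t + h) - D t \<le> h * a t + C * (h * sqrt h)"
  shows "D T - D \<tau> \<le> integral {\<tau>..T} a"
proof (rule field_le_epsilon)
  fix e :: real assume e: "0 < e"
  define \<eta> where "\<eta> = e / (2 * (T - \<tau> + 1))"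
  have \<eta>: "0 < \<eta>" using e T by (simp add: \<eta>_def)
  have "uniformly_continuous_on {\<tau>..T} a"
    using a by (rule compact_uniformly_continuous) simp
  then obtain d where d: "0 < d" "\<And>x y. x \<in> {\<tau>..T} \<Longrightarrow> y \<in> {\<tau>..T} \<Longrightarrow> \<bar>x - y\<bar> < d \<Longrightarrow> \<bar>a x - a y\<bar> < \<eta>"
    unfolding uniformly_continuous_on_def dist_real_def using \<eta> by metis
  \<comment> \<open>Steps shorter than \<open>q\<close> satisfy \<open>C * sqrt h \<le> \<eta>\<close>.\<close>
  define q where "q = (\<eta> / (\<bar>C\<bar> + 1))\<^sup>2"
  have q: "0 < q" using \<eta> by (auto simp: q_def)
  obtain n :: nat where n: "(T - \<tau>) / Min {d, h0, q} < real n"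
    using reals_Archimedean2 by blast
  have m: "0 < Min {d, h0, q}" using d h0 q by simp
  have "0 \<le> (T - \<tau>) / Min {d, h0, q}" using T m by (intro divide_nonneg_pos) auto
  then have n0: "0 < real n" using n by linarith
  define h where "h = (T - \<tau>) / n"
  have "h < Min {d, h0, q}"
  proof -
    have "T - \<tau> < real n * Min {d, h0, q}" using n by (simp only: pos_divide_less_eq[OF m])
    then show ?thesis unfolding h_def by (simp only: pos_divide_less_eq[OF n0] mult.commute)
  qed
  then have h: "h < d" "h < h0" "h < q" by auto
  have hn: "real n * h = T - \<tau>" unfolding h_def using n0 by simp
  show "D T - D \<tau> \<le> integral {\<tau>..T} a + e"
  proof (cases "\<tau> = T")
    case True then show ?thesis using e by simp
  next
    case False
    have hp: "0 < h" unfolding h_def using False T n0 by simp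
    have "sqrt h \<le> \<eta> / (\<bar>C\<bar> + 1)"
      using h(3) \<eta> unfolding q_def by (intro real_le_lsqrt) auto
    then have "\<bar>C\<bar> * sqrt h \<le> \<bar>C\<bar> * (\<eta> / (\<bar>C\<bar> + 1))" by (intro mult_left_mono) auto
    also have "\<dots> \<le> \<eta>" using \<eta> by (simp add: field_simps)
    finally have "\<bar>C\<bar> * sqrt h \<le> \<eta>" .
    moreover have "C * sqrt h \<le> \<bar>C\<bar> * sqrt h" using hp by (intro mult_right_mono) auto
    ultimately have Ch: "C * sqrt h \<le> \<eta>" by linarith
    have int: "a integrable_on {x..y}" if "\<tau> \<le> x" "y \<le> T" for x y
      using a that by (intro integrable_continuous_interval) (auto intro: continuous_on_subset)
    have "i \<le> n \<Longrightarrow> D (\<tau> + i * h) - D \<tau> \<le> integral {\<tau>..\<tau> + i * h} a + 2 * \<eta> * (i * h)" for i :: nat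
    proof (induction i)
      case (Suc i)
      define t where "t = \<tau> + i * h"
      have t: "\<tau> \<le> t" "t + h \<le> T"
      proof -
        show "\<tau> \<le> t" using hp by (simp add: t_def)
        have "(real i + 1) * h \<le> real n * h" using Suc.prems hp by (intro mult_right_mono) auto
        then show "t + h \<le> T" using hn by (simp add: t_def algebra_simps)
      qed
      have th: "\<tau> + real (Suc i) * h = t + h" by (simp add: t_def algebra_simps)
      have "D (t + h) - D t \<le> h * a t + h * (C * sqrt h)"
        using step[OF t hp] h by (simp add: mult_ac)
      also have "h * (C * sqrt h) \<le> h * \<eta>" using Ch hp by (intro mult_left_mono) auto
      finally have 1: "D (t + h) - D t \<le> h * a t + h * \<eta>" by simp
      have "integral {t..t + h} (\<lambda>_. a t - \<eta>) \<le> integral {t..t + h} a"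
      proof (rule integral_le)
        show "a integrable_on {t..t + h}" using t by (intro int) auto
        fix s assume "s \<in> {t..t + h}"
        then have "\<bar>a s - a t\<bar> < \<eta>" using t hp h by (intro d) auto
        then show "a t - \<eta> \<le> a s" by simp
      qed auto
      then have 2: "h * (a t - \<eta>) \<le> integral {t..t + h} a" using hp by simp
      have 3: "integral {\<tau>..t} a + integral {t..t + h} a = integral {\<tau>..t + h} a"
        using t hp by (intro Henstock_Kurzweil_Integration.integral_combine int) auto
      have "D t - D \<tau> \<le> integral {\<tau>..t} a + 2 * \<eta> * (i * h)"
        using Suc by (simp add: t_def)
      with 1 2 3 show ?case unfolding th by (simp add: algebra_simps)
    qed simp
    from this[of n] have "D T - D \<tau> \<le> integral {\<tau>..T} a + 2 * \<eta> * (T - \<tau>)"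
      unfolding hn by simp
    also have "2 * \<eta> * (T - \<tau>) = e * ((T - \<tau>) / (T - \<tau> + 1))"
    proof -
      have "2 * (e / (2 * u)) * w = e * (w / u)" for u w :: real by simp
      then show ?thesis unfolding \<eta>_def .
    qed
    also have "\<dots> \<le> e * 1" using T e by (intro mult_left_mono) auto
    finally show ?thesis by simp
  qed
qed

section \<open>Hoelder estimates for the Gaussian kernel\<close>

text \<open>
  Scaled to \<open>w = sqrt \<delta> * u\<close> this is \<open>\<bar>u\<bar> powr \<alpha> \<le> 1 + u\<^sup>2\<close>; it bounds the moment of order
  \<open>\<alpha>\<close> of a normal variable by its variance.
\<close>
lemma powr_le_one_plus_square:
  fixes w \<delta> \<alpha> :: real
  assumes "0 < \<delta>" "0 \<le> \<alpha>" "\<alpha> \<le> 1"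
  shows "\<bar>w\<bar> powr \<alpha> \<le> \<delta> powr (\<alpha> / 2) * (1 + w\<^sup>2 / \<delta>)"
proof -
  define u where "u = \<bar>w\<bar> / sqrt \<delta>"
  have u: "0 \<le> u" using assms by (simp add: u_def)
  have "u powr \<alpha> \<le> 1 + u\<^sup>2"
  proof (cases "u \<le> 1")
    case True
    then show ?thesis using u assms powr_mono2[of \<alpha> u 1] by (simp add: add_increasing2)
  next
    case False
    then have "u powr \<alpha> \<le> u powr 2" using assms by (intro powr_mono) auto
    then show ?thesis using False by simp
  qed
  moreover have "\<bar>w\<bar> powr \<alpha> = \<delta> powr (\<alpha> / 2) * u powr \<alpha>"
  proof -
    have "\<bar>w\<bar> = sqrt \<delta> * u" using assms by (simp add: u_def)
    then show ?thesis using assms u by (simp add: powr_mult powr_half_sqrt[symmetric] powr_powr)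
  qed
  moreover have "u\<^sup>2 = w\<^sup>2 / \<delta>" using assms by (simp add: u_def power_divide)
  ultimately show ?thesis by (simp add: mult_left_mono)
qed

lemma gauss_eq_normal_density_centered: "0 < \<delta> \<Longrightarrow> gauss \<delta> (x - z) = normal_density x (sqrt \<delta>) z"
  by (simp add: gauss_def normal_density_def power2_commute)

lemma gauss_mollification_error:
  fixes f :: "real \<Rightarrow> real"
  assumes \<delta>: "0 < \<delta>" and \<alpha>: "0 \<le> \<alpha>" "\<alpha> \<le> 1" and f [measurable]: "f \<in> borel_measurable borel" and B: "\<And>x. \<bar>f x\<bar> \<le> B"
    and holder: "\<And>x y. \<bar>f x - f y\<bar> \<le> C * \<bar>x - y\<bar> powr \<alpha>"
  shows "\<bar>(\<integral>z. f z * gauss \<delta> (x - z) \<partial>lborel) - f x\<bar> \<le> 2 * C * \<delta> powr (\<alpha> / 2)"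
proof -
  have C: "0 \<le> C" using holder[of 1 0] by simp
  have s: "0 < sqrt \<delta>" using \<delta> by simp
  define g where "g = normal_density x (sqrt \<delta>)"
  have [measurable]: "g \<in> borel_measurable borel" by (simp add: g_def)
  have g: "integrable lborel g" "(\<integral>z. g z \<partial>lborel) = 1" "\<And>z. 0 \<le> g z"
    using s by (auto simp: g_def)
  have g2: "integrable lborel (\<lambda>z. g z * (z - x)\<^sup>2)" "(\<integral>z. g z * (z - x)\<^sup>2 \<partial>lborel) = \<delta>"
    using integrable_normal_moment[OF s, of x 2] integral_normal_moment_even[OF s, of x 1] \<delta> by (auto simp: g_def)
  have fg: "integrable lborel (\<lambda>z. f z * g z)"
  proof (rule Bochner_Integration.integrable_bound)
    show "integrable lborel (\<lambda>z. B * g z)" using g by simp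
    show "AE z in lborel. norm (f z * g z) \<le> norm (B * g z)"
      using B g(3) by (intro AE_I2) (auto simp: abs_mult intro!: mult_right_mono order_trans[OF B])
  qed measurable
  have "(\<integral>z. f z * gauss \<delta> (x - z) \<partial>lborel) - f x = (\<integral>z. f z * g z \<partial>lborel) - (\<integral>z. f x * g z \<partial>lborel)"
    using g \<delta> by (simp add: gauss_eq_normal_density_centered g_def)
  also have "\<dots> = (\<integral>z. f z * g z - f x * g z \<partial>lborel)"
    using fg g by simp
  finally have "\<bar>(\<integral>z. f z * gauss \<delta> (x - z) \<partial>lborel) - f x\<bar> \<le> (\<integral>z. \<bar>f z * g z - f x * g z\<bar> \<partial>lborel)"
    by (simp only: integral_abs_bound)
  also have "\<dots> \<le> (\<integral>z. C * \<delta> powr (\<alpha> / 2) * (g z + g z * (z - x)\<^sup>2 / \<delta>) \<partial>lborel)"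
  proof (rule integral_mono)
    fix z
    have "\<bar>f z * g z - f x * g z\<bar> = \<bar>f z - f x\<bar> * g z"
      using g(3)[of z] by (simp add: abs_mult left_diff_distrib[symmetric])
    also have "\<dots> \<le> (C * (\<delta> powr (\<alpha> / 2) * (1 + (z - x)\<^sup>2 / \<delta>))) * g z"
      by (intro mult_right_mono g order_trans[OF holder] mult_left_mono powr_le_one_plus_square \<delta> \<alpha> C)
    finally show "\<bar>f z * g z - f x * g z\<bar> \<le> C * \<delta> powr (\<alpha> / 2) * (g z + g z * (z - x)\<^sup>2 / \<delta>)"
      by (simp add: algebra_simps)
  qed (use fg g g2 in auto)
  also have "\<dots> = C * \<delta> powr (\<alpha> / 2) * (1 + 1)"
    using g g2 \<delta> by simp
  finally show ?thesis by simp
qed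

text \<open>
  The device that produces both Hoelder bounds: a quantity with a bound independent of \<open>d\<close> and a bound
  linear in \<open>d\<close> has a bound proportional to \<open>d powr \<alpha>\<close>.
\<close>
lemma le_powr_interpolation:
  fixes x A B d \<alpha> :: real
  assumes "0 \<le> \<alpha>" "\<alpha> \<le> 1" "0 \<le> x" "x \<le> A" "x \<le> B * d" "0 \<le> B" "0 \<le> d"
  shows "x \<le> A powr (1 - \<alpha>) * B powr \<alpha> * d powr \<alpha>"
proof (cases "x = 0")
  case False
  then have "x = x powr (1 - \<alpha>) * x powr \<alpha>" using assms by (simp add: powr_add[symmetric])
  also have "\<dots> \<le> A powr (1 - \<alpha>) * (B * d) powr \<alpha>"
    using assms by (intro mult_mono powr_mono2) auto
  finally show ?thesis using assms by (simp add: powr_mult)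
qed simp

text \<open>
  The bases of the two powers on the left are the maxima of the kernel and of the absolute value of its derivative.
\<close>
lemma gauss_interpolated_constant:
  fixes r \<alpha> :: real
  assumes "0 < r"
  shows "(1 / sqrt (2 * pi * r)) powr (1 - \<alpha>) * (1 / (r * sqrt (2 * pi * exp 1))) powr \<alpha>
    = 1 / sqrt (2 * pi * exp \<alpha>) * r powr - ((1 + \<alpha>) / 2)" (is "?l = ?r")
proof -
  have "ln ?l = ln ?r"
    using assms by (simp add: ln_mult ln_div ln_sqrt ln_powr) (simp add: algebra_simps add_divide_distrib diff_divide_distrib)
  then show ?thesis using assms by (subst (asm) ln_inj_iff) auto
qed

lemma sqrt_exp: "sqrt (exp u) = exp (u / 2)"
  by (rule real_sqrt_unique) (auto simp: power2_eq_square exp_add[symmetric])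

lemma gauss_le_max: "0 < r \<Longrightarrow> gauss r x \<le> 1 / sqrt (2 * pi * r)"
  unfolding gauss_def by (intro divide_right_mono) auto

text \<open>
  With \<open>u = x\<^sup>2 / r\<close> this is \<open>u \<le> exp (u - 1)\<close>; equality holds at \<open>x = sqrt r\<close>.
\<close>
lemma gauss_deriv_abs_le:
  assumes r: "0 < r"
  shows "\<bar>- (x / r) * gauss r x\<bar> \<le> 1 / (r * sqrt (2 * pi * exp 1))"
proof -
  have "x\<^sup>2 / r \<le> exp (x\<^sup>2 / r - 1)" using exp_ge_add_one_self[of "x\<^sup>2 / r - 1"] by simp
  then have "sqrt (x\<^sup>2 / r) \<le> sqrt (exp (x\<^sup>2 / r - 1))" by (rule real_sqrt_le_mono)
  then have "\<bar>x\<bar> / sqrt r \<le> exp ((x\<^sup>2 / r - 1) / 2)"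
    by (simp add: real_sqrt_divide sqrt_exp)
  then have "\<bar>x\<bar> \<le> sqrt r * exp ((x\<^sup>2 / r - 1) / 2)"
    using r by (simp add: pos_divide_le_eq mult.commute)
  then have "\<bar>x\<bar> * exp (- x\<^sup>2 / (2 * r)) \<le> sqrt r * exp ((x\<^sup>2 / r - 1) / 2) * exp (- x\<^sup>2 / (2 * r))"
    by (rule mult_right_mono) simp
  also have "\<dots> = sqrt r * exp (- 1 / 2)"
    by (simp add: mult.assoc exp_add[symmetric] diff_divide_distrib)
  finally have "\<bar>x\<bar> * exp (- x\<^sup>2 / (2 * r)) / (r * sqrt (2 * pi * r)) \<le> sqrt r * exp (- 1 / 2) / (r * sqrt (2 * pi * r))"
    using r by (intro divide_right_mono) auto
  also have "\<dots> = 1 / (r * sqrt (2 * pi * exp 1))"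
    using r by (simp add: real_sqrt_mult sqrt_exp exp_minus field_simps)
  finally show ?thesis
    using r by (simp add: gauss_def abs_mult)
qed

lemma gauss_holder:
  assumes r: "0 < r" and \<alpha>: "0 \<le> \<alpha>" "\<alpha> \<le> 1"
  shows "\<bar>gauss r x - gauss r y\<bar> \<le> 1 / sqrt (2 * pi * exp \<alpha>) * r powr - ((1 + \<alpha>) / 2) * \<bar>x - y\<bar> powr \<alpha>"
  unfolding gauss_interpolated_constant[OF r, symmetric]
proof (rule le_powr_interpolation[OF \<alpha>])
  show "\<bar>gauss r x - gauss r y\<bar> \<le> 1 / sqrt (2 * pi * r)"
    using gauss_le_max[OF r, of x] gauss_le_max[OF r, of y] gauss_nonneg[OF r, of x] gauss_nonneg[OF r, of y]
    unfolding abs_le_iff by linarith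
  show "\<bar>gauss r x - gauss r y\<bar> \<le> 1 / (r * sqrt (2 * pi * exp 1)) * \<bar>x - y\<bar>"
    using DERIV_gauss[OF r] gauss_deriv_abs_le[OF r] by (rule lipschitz_of_bounded_deriv)
qed (use r in auto)

lemma nn_integral_translation_difference_le:
  fixes f f' :: "real \<Rightarrow> real"
  assumes f: "\<And>x. (f has_real_derivative f' x) (at x)" and f': "continuous_on UNIV f'" and d: "0 \<le> d"
  shows "(\<integral>\<^sup>+x. ennreal \<bar>f (x + d) - f x\<bar> \<partial>lborel) \<le> ennreal d * (\<integral>\<^sup>+x. ennreal \<bar>f' x\<bar> \<partial>lborel)"
proof -
  have [measurable]: "f' \<in> borel_measurable borel" using f' by (rule borel_measurable_continuous_onI)
  have "ennreal \<bar>f (x + d) - f x\<bar> \<le> (\<integral>\<^sup>+s. ennreal \<bar>f' (x + s)\<bar> * indicator {0..d} s \<partial>lborel)" for x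
  proof -
    have g: "((\<lambda>s. f (x + s)) has_vector_derivative f' (x + s)) (at s within {0..d})" for s
      unfolding has_real_derivative_iff_has_vector_derivative[symmetric]
      unfolding add.commute[of x]
      by (rule has_field_derivative_at_within, rule DERIV_shift[THEN iffD1, OF f])
    have c: "continuous_on {0..d} (\<lambda>s. f' (x + s))"
      by (rule continuous_on_compose2[OF f']) (auto intro!: continuous_intros)
    have b: "has_bochner_integral lborel (\<lambda>s. indicator {0..d} s *\<^sub>R f' (x + s)) (f (x + d) - f (x + 0))"
      using has_bochner_integral_FTC_Icc[OF d g c] by simp
    then have "ennreal (norm (f (x + d) - f (x + 0))) \<le> (\<integral>\<^sup>+s. ennreal (norm (indicator {0..d} s *\<^sub>R f' (x + s))) \<partial>lborel)"
      using integral_norm_bound_ennreal[of lborel "\<lambda>s. indicator {0..d} s *\<^sub>R f' (x + s)"]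
      by (simp add: has_bochner_integral_iff)
    also have "\<dots> = (\<integral>\<^sup>+s. ennreal \<bar>f' (x + s)\<bar> * indicator {0..d} s \<partial>lborel)"
      by (intro nn_integral_cong) (auto split: split_indicator)
    finally show ?thesis by simp
  qed
  then have "(\<integral>\<^sup>+x. ennreal \<bar>f (x + d) - f x\<bar> \<partial>lborel)
      \<le> (\<integral>\<^sup>+x. \<integral>\<^sup>+s. ennreal \<bar>f' (x + s)\<bar> * indicator {0..d} s \<partial>lborel \<partial>lborel)"
    by (intro nn_integral_mono)
  also have "\<dots> = (\<integral>\<^sup>+s. \<integral>\<^sup>+x. ennreal \<bar>f' (x + s)\<bar> * indicator {0..d} s \<partial>lborel \<partial>lborel)"
    by (rule lborel_pair.Fubini') measurable
  also have "\<dots> = (\<integral>\<^sup>+s. (\<integral>\<^sup>+x. ennreal \<bar>f' x\<bar> \<partial>lborel) * indicator {0..d} s \<partial>lborel)"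
  proof (rule nn_integral_cong)
    fix s :: real
    have "(\<integral>\<^sup>+x. ennreal \<bar>f' (x + s)\<bar> \<partial>lborel) = (\<integral>\<^sup>+x. ennreal \<bar>f' x\<bar> \<partial>lborel)"
      using nn_integral_real_affine[of "\<lambda>x. ennreal \<bar>f' x\<bar>" 1 s] by (simp add: add.commute)
    then show "(\<integral>\<^sup>+x. ennreal \<bar>f' (x + s)\<bar> * indicator {0..d} s \<partial>lborel)
        = (\<integral>\<^sup>+x. ennreal \<bar>f' x\<bar> \<partial>lborel) * indicator {0..d} s"
      by (simp add: nn_integral_multc)
  qed
  also have "\<dots> = ennreal d * (\<integral>\<^sup>+x. ennreal \<bar>f' x\<bar> \<partial>lborel)"
    using d by (subst nn_integral_cmult) (auto simp: mult.commute)
  finally show ?thesis .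
qed

lemma continuous_extremal_density_dxx: "0 < r \<Longrightarrow> continuous_on UNIV (extremal_density_dxx K r)"
  unfolding extremal_density_dxx_def gauss_def by (intro continuous_intros) auto

lemma extremal_density_dxx_zero_drift: "extremal_density_dxx 0 r x = (x\<^sup>2 - r) / r\<^sup>2 * gauss r x"
  by (simp add: extremal_density_dxx_def gauss_def)

text \<open>
  The integral is the total variation of the first derivative, which rises from \<open>0\<close> to its maximum at
  \<open>- sqrt r\<close>, falls to the opposite value at \<open>sqrt r\<close> and rises to \<open>0\<close> again: four times the maximum.
\<close>
lemma nn_integral_gauss_second_deriv:
  assumes r: "0 < r"
  shows "(\<integral>\<^sup>+x. ennreal \<bar>extremal_density_dxx 0 r x\<bar> \<partial>lborel) \<le> ennreal (4 / (r * sqrt (2 * pi * exp 1)))"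
proof -
  let ?v = "extremal_density_dx 0 r" and ?v' = "extremal_density_dxx 0 r"
  define c where "c = 1 / (r * sqrt (2 * pi * exp 1))"
  have c0: "0 \<le> c" using r by (simp add: c_def)
  have [measurable]: "?v' \<in> borel_measurable borel"
    using continuous_extremal_density_dxx[OF r] by (rule borel_measurable_continuous_onI)
  note dv = DERIV_extremal_density_dx[OF r, of 0]
  have sgn: "0 \<le> ?v' x" if "sqrt r \<le> x" for x
  proof -
    have "r \<le> x\<^sup>2" using power_mono[OF that, of 2] r by simp
    then show ?thesis using r by (simp add: extremal_density_dxx_zero_drift gauss_nonneg)
  qed
  have sgn': "?v' x \<le> 0" if "- sqrt r \<le> x" "x \<le> sqrt r" for x
  proof -
    have "x\<^sup>2 \<le> r" using that r abs_le_square_iff[of x "sqrt r"] by (simp add: abs_le_iff)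
    then show ?thesis using r by (simp add: extremal_density_dxx_zero_drift gauss_nonneg mult_nonpos_nonneg divide_nonpos_nonneg)
  qed
  have v: "?v (sqrt r) = - c" "?v (- sqrt r) = c"
  proof -
    have "gauss r (sqrt r) = exp (- 1 / 2) / sqrt (2 * pi * r)" using r by (simp add: gauss_def)
    moreover have "exp (- 1 / 2) = 1 / sqrt (exp (1::real))"
      by (simp add: sqrt_exp exp_minus inverse_eq_divide)
    ultimately have "gauss r (sqrt r) = 1 / (sqrt (2 * pi * r) * sqrt (exp 1))" by simp
    then show "?v (sqrt r) = - c"
      using r by (simp add: extremal_density_dx_zero_drift c_def real_sqrt_mult field_simps)
    then show "?v (- sqrt r) = c" by (simp add: extremal_density_dx_zero_drift gauss_even)
  qed
  have "(?v \<longlongrightarrow> 0) at_top"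
    unfolding extremal_density_dx_zero_drift[abs_def] gauss_def using r by real_asymp
  then have 1: "(\<integral>\<^sup>+x. ennreal (?v' x) * indicator {sqrt r..} x \<partial>lborel) = ennreal (0 - ?v (sqrt r))"
    by (intro nn_integral_FTC_atLeast dv sgn) auto
  have 2: "(\<integral>\<^sup>+x. ennreal (- ?v' x) * indicator {- sqrt r..sqrt r} x \<partial>lborel) = ennreal (- ?v (sqrt r) - - ?v (- sqrt r))"
  proof (rule nn_integral_FTC_Icc)
    show "((\<lambda>x. - ?v x) has_real_derivative - ?v' x) (at x)" for x by (intro DERIV_minus dv)
    show "- sqrt r \<le> sqrt r" using r by simp
  qed (auto simp: sgn')
  have even: "?v' (- x) = ?v' x" for x by (simp add: extremal_density_dxx_zero_drift gauss_even)
  have 3: "(\<integral>\<^sup>+x. ennreal (?v' x) * indicator {..- sqrt r} x \<partial>lborel)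
      = (\<integral>\<^sup>+x. ennreal (?v' x) * indicator {sqrt r..} x \<partial>lborel)"
    by (subst nn_integral_real_affine[of _ "-1" 0]) (auto simp: even intro!: nn_integral_cong split: split_indicator)
  have "(\<integral>\<^sup>+x. ennreal \<bar>?v' x\<bar> \<partial>lborel) \<le>
     (\<integral>\<^sup>+x. ennreal (?v' x) * indicator {sqrt r..} x + ennreal (- ?v' x) * indicator {- sqrt r..sqrt r} x
       + ennreal (?v' x) * indicator {..- sqrt r} x \<partial>lborel)"
  proof (rule nn_integral_mono)
    fix x
    consider "sqrt r \<le> x" | "x \<le> - sqrt r" | "- sqrt r \<le> x" "x \<le> sqrt r" by linarith
    then show "ennreal \<bar>?v' x\<bar> \<le> ennreal (?v' x) * indicator {sqrt r..} x + ennreal (- ?v' x) * indicator {- sqrt r..sqrt r} x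
       + ennreal (?v' x) * indicator {..- sqrt r} x"
    proof cases
      case 1 then show ?thesis using sgn[of x] by (auto intro!: add_increasing2)
    next
      case 2 then show ?thesis using sgn[of "- x"] by (auto simp: even intro!: add_increasing)
    next
      case 3 then show ?thesis using sgn'[of x] by (auto intro!: add_increasing2 add_increasing)
    qed
  qed
  also have "\<dots> = ennreal c + ennreal (2 * c) + ennreal c"
    using 1 2 3 v by (simp add: nn_integral_add)
  also have "\<dots> = ennreal (4 * c)" using c0 by (simp add: ennreal_plus[symmetric] del: ennreal_plus)
  finally show ?thesis by (simp add: c_def)
qed

lemma integrable_gauss_deriv:
  assumes r: "0 < r"
  shows "integrable lborel (extremal_density_dx 0 r)"
    "(\<integral>x. \<bar>extremal_density_dx 0 r x\<bar> \<partial>lborel) = 2 / sqrt (2 * pi * r)"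
proof -
  have s: "0 < sqrt r" using r by simp
  have eq: "extremal_density_dx 0 r = (\<lambda>x. - (1 / r) * (normal_density 0 (sqrt r) x * x))"
    "(\<lambda>x. \<bar>extremal_density_dx 0 r x\<bar>) = (\<lambda>x. (1 / r) * (normal_density 0 (sqrt r) x * \<bar>x\<bar>))"
    using r normal_density_nonneg
    by (auto simp: extremal_density_dx_zero_drift gauss_eq_normal_density fun_eq_iff abs_mult)
  show "integrable lborel (extremal_density_dx 0 r)"
    using integrable_normal_moment[OF s, of 0 1] unfolding eq by simp
  have "(\<integral>x. \<bar>extremal_density_dx 0 r x\<bar> \<partial>lborel) = (1 / r) * (sqrt r * sqrt (2 / pi))"
    using integral_normal_moment_abs_odd[OF s, of 0 0] unfolding eq(2) by simp
  also have "\<dots> = 2 / sqrt (2 * pi * r)"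
    using r by (simp add: real_sqrt_mult real_sqrt_divide field_simps)
  finally show "(\<integral>x. \<bar>extremal_density_dx 0 r x\<bar> \<partial>lborel) = 2 / sqrt (2 * pi * r)" .
qed

text \<open>
  Interpolation between twice the \<open>L\<^sup>1\<close> norm of the first derivative and \<open>\<bar>y - z\<bar>\<close> times the \<open>L\<^sup>1\<close> norm
  of the second. Both constants are four times those of the pointwise estimate \<open>gauss_holder\<close>, so the
  interpolated constant is too.
\<close>
lemma gauss_deriv_L1_holder:
  assumes r: "0 < r" and \<alpha>: "0 \<le> \<alpha>" "\<alpha> \<le> 1"
  shows "integrable lborel (\<lambda>x. \<bar>extremal_density_dx 0 r (x - y) - extremal_density_dx 0 r (x - z)\<bar>)"
    and "(\<integral>x. \<bar>extremal_density_dx 0 r (x - y) - extremal_density_dx 0 r (x - z)\<bar> \<partial>lborel)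
      \<le> 4 / sqrt (2 * pi * exp \<alpha>) * r powr - ((1 + \<alpha>) / 2) * \<bar>y - z\<bar> powr \<alpha>"
proof -
  let ?v = "extremal_density_dx 0 r"
  have shift: "integrable lborel (\<lambda>x. ?v (x - y))" "(\<integral>x. \<bar>?v (x - y)\<bar> \<partial>lborel) = 2 / sqrt (2 * pi * r)" for y
    using lborel_integrable_real_affine[OF integrable_gauss_deriv(1)[OF r], of 1 "- y"]
      integrable_gauss_deriv(2)[OF r] lborel_integral_real_affine[of 1 "\<lambda>x. \<bar>?v x\<bar>" "- y"] by simp_all
  show int: "integrable lborel (\<lambda>x. \<bar>?v (x - y) - ?v (x - z)\<bar>)" for y z
    using shift(1)[of y] shift(1)[of z] by auto
  define I where "I y z = (\<integral>x. \<bar>?v (x - y) - ?v (x - z)\<bar> \<partial>lborel)" for y z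
  have I0: "0 \<le> I y z" for y z by (simp add: I_def)
  have A: "I y z \<le> 4 * (1 / sqrt (2 * pi * r))"
  proof -
    have "I y z \<le> (\<integral>x. \<bar>?v (x - y)\<bar> + \<bar>?v (x - z)\<bar> \<partial>lborel)"
      unfolding I_def using int shift(1)[of y] shift(1)[of z] by (intro integral_mono) auto
    also have "\<dots> = (\<integral>x. \<bar>?v (x - y)\<bar> \<partial>lborel) + (\<integral>x. \<bar>?v (x - z)\<bar> \<partial>lborel)"
      using shift(1)[of y] shift(1)[of z] by (intro Bochner_Integration.integral_add) auto
    finally show ?thesis using shift(2)[of y] shift(2)[of z] by simp
  qed
  have B: "I y z \<le> 4 * (1 / (r * sqrt (2 * pi * exp 1))) * (z - y)" if "y \<le> z" for y z
  proof -
    have "ennreal (I y z) = (\<integral>\<^sup>+x. ennreal \<bar>?v (x - y) - ?v (x - z)\<bar> \<partial>lborel)"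
      unfolding I_def using int by (intro nn_integral_eq_integral[symmetric]) auto
    also have "\<dots> = (\<integral>\<^sup>+x. ennreal \<bar>?v (x + (z - y)) - ?v x\<bar> \<partial>lborel)"
    proof -
      have [measurable]: "?v \<in> borel_measurable borel" using integrable_gauss_deriv(1)[OF r] by auto
      show ?thesis by (subst nn_integral_real_affine[of _ 1 z]) (auto simp: algebra_simps)
    qed
    also have "\<dots> \<le> ennreal (z - y) * (\<integral>\<^sup>+x. ennreal \<bar>extremal_density_dxx 0 r x\<bar> \<partial>lborel)"
      using that by (intro nn_integral_translation_difference_le DERIV_extremal_density_dx[OF r] continuous_extremal_density_dxx r) auto
    also have "\<dots> \<le> ennreal (z - y) * ennreal (4 / (r * sqrt (2 * pi * exp 1)))"
      by (intro mult_left_mono nn_integral_gauss_second_deriv r) auto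
    also have "\<dots> = ennreal ((z - y) * (4 / (r * sqrt (2 * pi * exp 1))))"
      using that r by (intro ennreal_mult[symmetric]) auto
    finally have "I y z \<le> (z - y) * (4 / (r * sqrt (2 * pi * exp 1)))"
      by (rule ennreal_le_iff[THEN iffD1, rotated]) (use that r in auto)
    then show ?thesis by (simp add: mult_ac)
  qed
  have sym: "I y z = I z y" for y z by (simp add: I_def abs_minus_commute)
  have B': "I y z \<le> 4 * (1 / (r * sqrt (2 * pi * exp 1))) * \<bar>y - z\<bar>"
    using B[of y z] B[of z y] sym[of y z] by (cases "y \<le> z") auto
  have "I y z / 4 \<le> (1 / sqrt (2 * pi * r)) powr (1 - \<alpha>) * (1 / (r * sqrt (2 * pi * exp 1))) powr \<alpha> * \<bar>y - z\<bar> powr \<alpha>"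
    by (rule le_powr_interpolation[OF \<alpha>]) (use A B' I0 r in \<open>auto simp: mult.commute\<close>)
  then have "I y z \<le> 4 * ((1 / sqrt (2 * pi * r)) powr (1 - \<alpha>) * (1 / (r * sqrt (2 * pi * exp 1))) powr \<alpha> * \<bar>y - z\<bar> powr \<alpha>)"
    by simp
  then show "(\<integral>x. \<bar>?v (x - y) - ?v (x - z)\<bar> \<partial>lborel)
      \<le> 4 / sqrt (2 * pi * exp \<alpha>) * r powr - ((1 + \<alpha>) / 2) * \<bar>y - z\<bar> powr \<alpha>"
    unfolding gauss_interpolated_constant[OF r] I_def by simp
qed

section \<open>Motions with bounded drift\<close>
lemma extremal_density_le_center:
  assumes "0 < r" shows "extremal_density K r x \<le> extremal_density K r 0"
proof -
  have "drift_profile K r \<bar>x\<bar> \<le> drift_profile K r 0"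
  proof (rule DERIV_nonpos_imp_nonincreasing[of 0 "\<bar>x\<bar>" "drift_profile K r"])
    fix z :: real assume "0 \<le> z"
    then show "\<exists>y. (drift_profile K r has_real_derivative y) (at z) \<and> y \<le> 0"
      using DERIV_drift_profile[OF assms, of K z UNIV] gauss_nonneg[OF assms, of "z - K * r"] assms
      by (intro exI[of _ "- (z / r) * gauss r (z - K * r)"]) auto
  qed simp
  then show ?thesis by (simp add: extremal_density_def)
qed

lemma extremal_density_center_antimono:
  assumes "0 < r" "r \<le> r'" shows "extremal_density K r' 0 \<le> extremal_density K r 0"
proof (rule DERIV_nonpos_imp_nonincreasing[OF assms(2)])
  fix s assume s: "r \<le> s"
  then have s0: "0 < s" using assms by simp
  have "extremal_density_dr K s 0 \<le> 0"
    unfolding extremal_density_dr_def using s0 gauss_nonneg[OF s0] by (auto intro!: mult_nonpos_nonneg)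
  then show "\<exists>y. ((\<lambda>r. extremal_density K r 0) has_real_derivative y) (at s) \<and> y \<le> 0"
    using DERIV_extremal_density_variance[OF s0] by blast
qed

lemma gauss_le_extremal_density:
  assumes r: "0 < r" and K: "0 \<le> K"
  shows "gauss r x \<le> exp (K\<^sup>2 * r / 2) * extremal_density K r x"
proof -
  have "- x\<^sup>2 / (2 * r) \<le> K\<^sup>2 * r / 2 + - (\<bar>x\<bar> - K * r)\<^sup>2 / (2 * r)"
  proof -
    have "K\<^sup>2 * r / 2 + - (\<bar>x\<bar> - K * r)\<^sup>2 / (2 * r) = - x\<^sup>2 / (2 * r) + K * \<bar>x\<bar>"
      using r by (simp add: power2_diff divide_simps) (simp add: algebra_simps power2_eq_square)
    then show ?thesis using K by simp
  qed
  then have "exp (- x\<^sup>2 / (2 * r)) \<le> exp (K\<^sup>2 * r / 2) * exp (- (\<bar>x\<bar> - K * r)\<^sup>2 / (2 * r))"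
    by (subst exp_add[symmetric]) simp
  then have "gauss r x \<le> exp (K\<^sup>2 * r / 2) * gauss r (\<bar>x\<bar> - K * r)"
    unfolding gauss_def times_divide_eq_right using r by (intro divide_right_mono) auto
  also have "\<dots> \<le> exp (K\<^sup>2 * r / 2) * extremal_density K r x"
    unfolding extremal_density_def drift_profile_def using K by (intro mult_left_mono) (auto simp: cdf_def)
  finally show ?thesis .
qed

text \<open>
  All that is used of a solution: normal increments that are independent of the current position,
  perturbed by at most \<open>K\<close> times the elapsed time. The perturbation may depend on the normal part.
\<close>
locale bounded_drift_motion = prob_space M for M :: "'a measure" +
  fixes X :: "real \<Rightarrow> 'a \<Rightarrow> real" and K :: real
  assumes K_pos: "0 < K"
    and X_measurable: "0 \<le> t \<Longrightarrow> random_variable borel (X t)"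
    and increments: "0 \<le> s \<Longrightarrow> s < t \<Longrightarrow> \<exists>N. indep_var borel (X s) borel N \<and>
          distributed M lborel N (\<lambda>x. ennreal (normal_density 0 (sqrt (t - s)) x)) \<and>
          (AE \<omega> in M. \<bar>X t \<omega> - X s \<omega> - N \<omega>\<bar> \<le> K * (t - s))"
begin

text \<open>
  The variable \<open>b\<close> is the accumulated drift. It does not depend on \<open>y\<close>, so that the estimates for two
  points can be subtracted from each other.
\<close>
lemma extremal_density_increment:
  assumes a: "0 < a" and J: "0 \<le> J"
  obtains C where "0 \<le> C"
    "\<And>t h r. 0 \<le> t \<Longrightarrow> 0 < h \<Longrightarrow> h \<le> 1 \<Longrightarrow> a \<le> r \<Longrightarrow> r + h \<le> c \<Longrightarrow>
      \<exists>b. random_variable borel b \<and> (AE \<omega> in M. \<bar>b \<omega>\<bar> \<le> K * h) \<and>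
       (\<forall>y. \<bar>expectation (\<lambda>\<omega>. extremal_density J r (X (t + h) \<omega> - y))
        - expectation (\<lambda>\<omega>. extremal_density J (r + h) (X t \<omega> - y))
        - expectation (\<lambda>\<omega>. b \<omega> * extremal_density_dx J r (X t \<omega> - y))
        + h * J * expectation (\<lambda>\<omega>. \<bar>extremal_density_dx J r (X t \<omega> - y)\<bar>)\<bar> \<le> C * (h * sqrt h))"
proof -
  obtain C where C: "0 \<le> C"
    "\<And>Y N b h r y. indep_var borel Y borel N \<Longrightarrow>
       distributed M lborel N (\<lambda>x. ennreal (normal_density 0 (sqrt h) x)) \<Longrightarrow>
       0 < h \<Longrightarrow> h \<le> 1 \<Longrightarrow> random_variable borel b \<Longrightarrow> (AE \<omega> in M. \<bar>b \<omega>\<bar> \<le> K * h) \<Longrightarrow>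
       a \<le> r \<Longrightarrow> r + h \<le> c \<Longrightarrow>
       \<bar>expectation (\<lambda>\<omega>. extremal_density J r (Y \<omega> + N \<omega> + b \<omega> - y))
        - expectation (\<lambda>\<omega>. extremal_density J (r + h) (Y \<omega> - y))
        - expectation (\<lambda>\<omega>. b \<omega> * extremal_density_dx J r (Y \<omega> - y))
        + h * J * expectation (\<lambda>\<omega>. \<bar>extremal_density_dx J r (Y \<omega> - y)\<bar>)\<bar> \<le> C * (h * sqrt h)"
    using extremal_density_step[OF a J less_imp_le[OF K_pos], of c] by blast
  show thesis
  proof (rule that[OF C(1)])
    fix t h r :: real assume t: "0 \<le> t" and h: "0 < h" "h \<le> 1" and r: "a \<le> r" "r + h \<le> c"
    obtain N where N: "indep_var borel (X t) borel N"
      "distributed M lborel N (\<lambda>x. ennreal (normal_density 0 (sqrt h) x))"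
      "AE \<omega> in M. \<bar>X (t + h) \<omega> - X t \<omega> - N \<omega>\<bar> \<le> K * h"
      using increments[OF t, of "t + h"] h by auto
    define b where "b \<omega> = X (t + h) \<omega> - X t \<omega> - N \<omega>" for \<omega>
    have [measurable]: "random_variable borel (X t)" "random_variable borel (X (t + h))" "random_variable borel N"
      using t h X_measurable indep_var_rv2[OF N(1)] by auto
    have b: "random_variable borel b" "AE \<omega> in M. \<bar>b \<omega>\<bar> \<le> K * h"
      unfolding b_def[abs_def] using N(3) by auto
    have eq: "X (t + h) \<omega> = X t \<omega> + N \<omega> + b \<omega>" for \<omega> by (simp add: b_def)
    show "\<exists>b. random_variable borel b \<and> (AE \<omega> in M. \<bar>b \<omega>\<bar> \<le> K * h) \<and>
       (\<forall>y. \<bar>expectation (\<lambda>\<omega>. extremal_density J r (X (t + h) \<omega> - y))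
        - expectation (\<lambda>\<omega>. extremal_density J (r + h) (X t \<omega> - y))
        - expectation (\<lambda>\<omega>. b \<omega> * extremal_density_dx J r (X t \<omega> - y))
        + h * J * expectation (\<lambda>\<omega>. \<bar>extremal_density_dx J r (X t \<omega> - y)\<bar>)\<bar> \<le> C * (h * sqrt h))"
      unfolding eq using C(2)[OF N(1,2) h b r] b by blast
  qed
qed

text \<open>
  The comparison principle. Along the motion, \<open>E (extremal_density K (s + \<delta> - t) (X t - y))\<close> is
  nonincreasing in \<open>t\<close>: the drift contributes at most \<open>K * h * E \<bar>extremal_density_dx\<bar>\<close> per step,
  and this is exactly what the equation subtracts. At \<open>t = 0\<close> the function is largest at its centre.
  The additional time \<open>\<delta>\<close> keeps the elapsed time away from \<open>0\<close>, where the density is singular.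
\<close>
lemma expectation_extremal_density_le:
  assumes s: "0 \<le> s" and \<delta>: "0 < \<delta>"
  shows "expectation (\<lambda>\<omega>. extremal_density K \<delta> (X s \<omega> - y)) \<le> extremal_density K (s + \<delta>) 0"
proof -
  have K: "0 \<le> K" using K_pos by simp
  define D where "D t = expectation (\<lambda>\<omega>. extremal_density K (s + \<delta> - t) (X t \<omega> - y))" for t
  obtain C where C: "0 \<le> C"
    "\<And>t h r. 0 \<le> t \<Longrightarrow> 0 < h \<Longrightarrow> h \<le> 1 \<Longrightarrow> \<delta> \<le> r \<Longrightarrow> r + h \<le> s + \<delta> \<Longrightarrow>
      \<exists>b. random_variable borel b \<and> (AE \<omega> in M. \<bar>b \<omega>\<bar> \<le> K * h) \<and>
       (\<forall>y. \<bar>expectation (\<lambda>\<omega>. extremal_density K r (X (t + h) \<omega> - y))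
        - expectation (\<lambda>\<omega>. extremal_density K (r + h) (X t \<omega> - y))
        - expectation (\<lambda>\<omega>. b \<omega> * extremal_density_dx K r (X t \<omega> - y))
        + h * K * expectation (\<lambda>\<omega>. \<bar>extremal_density_dx K r (X t \<omega> - y)\<bar>)\<bar> \<le> C * (h * sqrt h))"
    using extremal_density_increment[OF \<delta> K, of "s + \<delta>"] by blast
  obtain C1 where C1: "\<And>r x. r \<in> {\<delta>..s + \<delta>} \<Longrightarrow> \<bar>extremal_density_dx K r x\<bar> \<le> C1"
    using extremal_density_bounded[OF \<delta> K, of "s + \<delta>"] by metis
  obtain C0 where C0: "\<And>r x. r \<in> {\<delta>..s + \<delta>} \<Longrightarrow> \<bar>extremal_density K r x\<bar> \<le> C0"
    using extremal_density_bounded[OF \<delta> K, of "s + \<delta>"] by metis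
  have "D s - D 0 \<le> integral {0..s} (\<lambda>_. 0)"
  proof (rule increment_le_integral[OF s, of _ 1 _ C])
    fix t h :: real assume t: "0 \<le> t" "t + h \<le> s" and h: "0 < h" "h \<le> 1"
    define r where "r = s + \<delta> - (t + h)"
    have r: "\<delta> \<le> r" "r + h \<le> s + \<delta>" "r \<in> {\<delta>..s + \<delta>}" using t h by (auto simp: r_def)
    have [measurable]: "random_variable borel (X t)" using t X_measurable by auto
    let ?v = "\<lambda>\<omega>. extremal_density_dx K r (X t \<omega> - y)"
    obtain b where b [measurable]: "random_variable borel b" and b_le: "AE \<omega> in M. \<bar>b \<omega>\<bar> \<le> K * h"
      and step: "\<bar>expectation (\<lambda>\<omega>. extremal_density K r (X (t + h) \<omega> - y))
        - expectation (\<lambda>\<omega>. extremal_density K (r + h) (X t \<omega> - y))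
        - expectation (\<lambda>\<omega>. b \<omega> * ?v \<omega>) + h * K * expectation (\<lambda>\<omega>. \<bar>?v \<omega>\<bar>)\<bar> \<le> C * (h * sqrt h)"
      using C(2)[OF t(1) h r(1,2)] by blast
    have bv: "AE \<omega> in M. \<bar>b \<omega> * ?v \<omega>\<bar> \<le> K * h * \<bar>?v \<omega>\<bar>"
      using b_le by eventually_elim (auto simp: abs_mult intro!: mult_right_mono)
    have v: "integrable M (\<lambda>\<omega>. K * h * \<bar>?v \<omega>\<bar>)"
      using C1[OF r(3)] by (auto intro!: integrable_mult_right integrable_const_bound[where B=C1])
    have "expectation (\<lambda>\<omega>. b \<omega> * ?v \<omega>) \<le> expectation (\<lambda>\<omega>. K * h * \<bar>?v \<omega>\<bar>)"
    proof (rule integral_mono_AE)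
      show "integrable M (\<lambda>\<omega>. b \<omega> * ?v \<omega>)"
        using v by (rule Bochner_Integration.integrable_bound) (use bv K h in \<open>auto simp: abs_mult\<close>)
      show "AE \<omega> in M. b \<omega> * ?v \<omega> \<le> K * h * \<bar>?v \<omega>\<bar>"
        using bv by eventually_elim auto
    qed (rule v)
    also have "\<dots> = h * K * expectation (\<lambda>\<omega>. \<bar>?v \<omega>\<bar>)" by simp
    finally have "expectation (\<lambda>\<omega>. extremal_density K r (X (t + h) \<omega> - y))
        - expectation (\<lambda>\<omega>. extremal_density K (r + h) (X t \<omega> - y)) \<le> C * (h * sqrt h)"
      using step by linarith
    then show "D (t + h) - D t \<le> h * 0 + C * (h * sqrt h)"
      unfolding D_def r_def by (simp add: algebra_simps)
  qed auto
  then have "D s \<le> D 0" by simp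
  also have "D 0 \<le> expectation (\<lambda>\<omega>. extremal_density K (s + \<delta>) 0)"
  proof -
    have "extremal_density K (s + \<delta>) \<in> borel_measurable borel"
      using s \<delta> by (intro borel_measurable_extremal_density) simp
    moreover have "random_variable borel (X 0)" using X_measurable by auto
    ultimately show ?thesis
      unfolding D_def using C0[of "s + \<delta>"] s \<delta>
      by (intro integral_mono integrable_const_bound[where B=C0]) (auto intro!: extremal_density_le_center)
  qed
  finally show ?thesis by (simp add: D_def prob_space)
qed

lemma integrable_bounded_function:
  fixes f :: "real \<Rightarrow> real" and B :: real
  assumes "f \<in> borel_measurable borel" "\<And>x. \<bar>f x\<bar> \<le> B" "0 \<le> t"
  shows "integrable M (\<lambda>\<omega>. f (X t \<omega>))"
  using assms X_measurable[OF assms(3)] by (intro integrable_const_bound[where B=B]) auto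

lemma integrable_gauss_motion:
  "0 < r \<Longrightarrow> 0 \<le> t \<Longrightarrow> integrable M (\<lambda>\<omega>. gauss r (X t \<omega> - y))"
  using gauss_le_max[of r] gauss_nonneg[of r]
  by (intro integrable_bounded_function[of "\<lambda>x. gauss r (x - y)" "1 / sqrt (2 * pi * r)"]) auto

lemma expectation_gauss_le:
  assumes s: "0 \<le> s" and \<delta>: "0 < \<delta>"
  shows "expectation (\<lambda>\<omega>. gauss \<delta> (X s \<omega> - y)) \<le> exp (K\<^sup>2 * \<delta> / 2) * extremal_density K (s + \<delta>) 0"
proof -
  have K: "0 \<le> K" using K_pos by simp
  obtain C where C: "\<And>r x. r \<in> {\<delta>..\<delta>} \<Longrightarrow> \<bar>extremal_density K r x\<bar> \<le> C"
    using extremal_density_bounded[OF \<delta> K, of \<delta>] by metis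
  have "extremal_density K \<delta> \<in> borel_measurable borel"
    using \<delta> by (rule borel_measurable_extremal_density)
  then have int: "integrable M (\<lambda>\<omega>. extremal_density K \<delta> (X s \<omega> - y))"
    using C s by (intro integrable_bounded_function[of "\<lambda>x. extremal_density K \<delta> (x - y)" C]) auto
  have "expectation (\<lambda>\<omega>. gauss \<delta> (X s \<omega> - y)) \<le> expectation (\<lambda>\<omega>. exp (K\<^sup>2 * \<delta> / 2) * extremal_density K \<delta> (X s \<omega> - y))"
    using gauss_le_max[OF \<delta>] gauss_nonneg[OF \<delta>] s
    by (intro integral_mono gauss_le_extremal_density \<delta> K integrable_mult_right int
        integrable_bounded_function[of "\<lambda>x. gauss \<delta> (x - y)" "1 / sqrt (2 * pi * \<delta>)"]) auto
  also have "\<dots> \<le> exp (K\<^sup>2 * \<delta> / 2) * extremal_density K (s + \<delta>) 0"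
    using expectation_extremal_density_le[OF s \<delta>] by simp
  finally show ?thesis .
qed

text \<open>
  This says that \<open>extremal_density K s 0\<close> bounds the density of \<open>X s\<close>, in a form that does not require
  that density to exist: \<open>\<psi>\<close> is mollified by a Gaussian, the bound for Gaussian test functions is
  integrated against \<open>\<psi>\<close>, and the mollification error is \<open>O(sqrt \<delta>)\<close> as \<open>\<psi>\<close> is Lipschitz.
\<close>
lemma expectation_le_extremal_density_times_integral:
  fixes \<psi> :: "real \<Rightarrow> real"
  assumes s: "0 < s" and \<psi>: "integrable lborel \<psi>" "\<And>x. 0 \<le> \<psi> x" "\<And>x. \<psi> x \<le> B"
    and lip: "\<And>x y. \<bar>\<psi> x - \<psi> y\<bar> \<le> L * \<bar>x - y\<bar>"
  shows "expectation (\<lambda>\<omega>. \<psi> (X s \<omega>)) \<le> extremal_density K s 0 * (\<integral>x. \<psi> x \<partial>lborel)"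
proof -
  have K: "0 \<le> K" using K_pos by simp
  have [measurable]: "\<psi> \<in> borel_measurable borel" using \<psi>(1) by auto
  have [measurable]: "random_variable borel (X s)" using X_measurable s by auto
  let ?I = "\<integral>x. \<psi> x \<partial>lborel"
  have I: "0 \<le> ?I" using \<psi>(2) by simp
  have bound: "expectation (\<lambda>\<omega>. \<psi> (X s \<omega>)) \<le> exp (K\<^sup>2 * \<delta> / 2) * (extremal_density K s 0 * ?I) + 2 * L * sqrt \<delta>"
    if \<delta>: "0 < \<delta>" for \<delta>
  proof -
    let ?c = "exp (K\<^sup>2 * \<delta> / 2) * extremal_density K s 0"
    have c: "0 \<le> ?c" using extremal_density_nonneg[OF s K] by simp
    define m where "m x = (\<integral>z. \<psi> z * gauss \<delta> (x - z) \<partial>lborel)" for x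
    have [measurable]: "m \<in> borel_measurable borel" unfolding m_def[abs_def] by measurable
    have int: "integrable lborel (\<lambda>z. \<psi> z * gauss \<delta> (x - z))" for x
    proof (rule Bochner_Integration.integrable_bound)
      show "integrable lborel (\<lambda>z. \<psi> z * (1 / sqrt (2 * pi * \<delta>)))" using \<psi>(1) by simp
      show "AE z in lborel. norm (\<psi> z * gauss \<delta> (x - z)) \<le> norm (\<psi> z * (1 / sqrt (2 * pi * \<delta>)))"
        using gauss_le_max[OF \<delta>] gauss_nonneg[OF \<delta>] \<psi>(2) \<delta>
        by (intro AE_I2) (simp only: real_norm_def abs_mult, intro mult_left_mono, auto)
    qed measurable
    have m0: "0 \<le> m x" for x unfolding m_def using \<psi>(2) gauss_nonneg[OF \<delta>] by simp
    have err: "\<bar>m x - \<psi> x\<bar> \<le> 2 * L * sqrt \<delta>" for x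
      using gauss_mollification_error[OF \<delta>, of 1 \<psi> B L x] \<psi>(2,3) lip \<delta>
      by (simp add: m_def powr_half_sqrt)
    have "(\<integral>\<^sup>+\<omega>. ennreal (m (X s \<omega>)) \<partial>M) = (\<integral>\<^sup>+\<omega>. \<integral>\<^sup>+z. ennreal (\<psi> z * gauss \<delta> (X s \<omega> - z)) \<partial>lborel \<partial>M)"
      unfolding m_def using int \<psi>(2) gauss_nonneg[OF \<delta>]
      by (intro nn_integral_cong nn_integral_eq_integral[symmetric]) auto
    also have "\<dots> = (\<integral>\<^sup>+z. \<integral>\<^sup>+\<omega>. ennreal (\<psi> z * gauss \<delta> (X s \<omega> - z)) \<partial>M \<partial>lborel)"
    proof -
      interpret P: pair_sigma_finite M lborel ..
      show ?thesis by (rule P.Fubini'[symmetric]) measurable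
    qed
    also have "\<dots> \<le> (\<integral>\<^sup>+z. ennreal (\<psi> z) * ennreal ?c \<partial>lborel)"
    proof (rule nn_integral_mono)
      fix z
      have "integrable M (\<lambda>\<omega>. gauss \<delta> (X s \<omega> - z))"
        using gauss_le_max[OF \<delta>] gauss_nonneg[OF \<delta>] s
        by (intro integrable_bounded_function[of "\<lambda>x. gauss \<delta> (x - z)" "1 / sqrt (2 * pi * \<delta>)"]) auto
      then have "(\<integral>\<^sup>+\<omega>. ennreal (gauss \<delta> (X s \<omega> - z)) \<partial>M) = ennreal (expectation (\<lambda>\<omega>. gauss \<delta> (X s \<omega> - z)))"
        using gauss_nonneg[OF \<delta>] by (intro nn_integral_eq_integral) auto
      also have "\<dots> \<le> ennreal ?c"
        using order_trans[OF expectation_gauss_le[OF less_imp_le[OF s] \<delta>, of z] mult_left_mono[OF extremal_density_center_antimono[OF s, of "s + \<delta>" K]]] \<delta>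
        by (intro ennreal_leI) auto
      finally have "ennreal (\<psi> z) * (\<integral>\<^sup>+\<omega>. ennreal (gauss \<delta> (X s \<omega> - z)) \<partial>M) \<le> ennreal (\<psi> z) * ennreal ?c"
        by (rule mult_left_mono) simp
      then show "(\<integral>\<^sup>+\<omega>. ennreal (\<psi> z * gauss \<delta> (X s \<omega> - z)) \<partial>M) \<le> ennreal (\<psi> z) * ennreal ?c"
        using \<psi>(2) by (simp add: ennreal_mult' nn_integral_cmult)
    qed
    also have "\<dots> = ennreal (?c * ?I)"
      using \<psi> c I by (simp add: nn_integral_multc nn_integral_eq_integral ennreal_mult'' mult.commute)
    finally have mle: "(\<integral>\<^sup>+\<omega>. ennreal (m (X s \<omega>)) \<partial>M) \<le> ennreal (?c * ?I)" .
    have mb: "\<bar>m x\<bar> \<le> B + 2 * L * sqrt \<delta>" for x using err[of x] \<psi>(2,3)[of x] by linarith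
    have mi: "integrable M (\<lambda>\<omega>. m (X s \<omega>))" using mb s by (intro integrable_bounded_function[of m]) auto
    have "expectation (\<lambda>\<omega>. \<psi> (X s \<omega>)) \<le> expectation (\<lambda>\<omega>. m (X s \<omega>) + 2 * L * sqrt \<delta>)"
    proof (rule integral_mono)
      show "integrable M (\<lambda>\<omega>. \<psi> (X s \<omega>))" using \<psi>(2,3) s by (intro integrable_bounded_function[of \<psi> B]) auto
      show "\<psi> (X s \<omega>) \<le> m (X s \<omega>) + 2 * L * sqrt \<delta>" for \<omega> using err[of "X s \<omega>"] by linarith
    qed (use mi in auto)
    also have "\<dots> = expectation (\<lambda>\<omega>. m (X s \<omega>)) + 2 * L * sqrt \<delta>" using mi by (simp add: prob_space)
    also have "expectation (\<lambda>\<omega>. m (X s \<omega>)) \<le> ?c * ?I"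
    proof -
      have "ennreal (expectation (\<lambda>\<omega>. m (X s \<omega>))) \<le> ennreal (?c * ?I)"
        using mle mi m0 by (subst nn_integral_eq_integral[symmetric]) auto
      then show ?thesis using c I by (subst (asm) ennreal_le_iff) auto
    qed
    finally show ?thesis by (simp add: mult.assoc)
  qed
  have "((\<lambda>\<delta>. exp (K\<^sup>2 * \<delta> / 2) * (extremal_density K s 0 * ?I) + 2 * L * sqrt \<delta>) \<longlongrightarrow>
      exp (K\<^sup>2 * 0 / 2) * (extremal_density K s 0 * ?I) + 2 * L * sqrt 0) (at_right 0)"
    by (intro tendsto_intros) simp
  then have "expectation (\<lambda>\<omega>. \<psi> (X s \<omega>)) \<le> exp (K\<^sup>2 * 0 / 2) * (extremal_density K s 0 * ?I) + 2 * L * sqrt 0"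
    by (rule tendsto_lowerbound) (auto simp: eventually_at_filter intro!: always_eventually bound)
  then show ?thesis by simp
qed

end

section \<open>The Hoelder bound for mollified densities\<close>
lemma extremal_density_center_scaling:
  assumes t: "0 < t" and K: "0 < K"
  shows "extremal_density K t 0 = K * (std_normal_density (sqrt (K\<^sup>2 * t)) / sqrt (K\<^sup>2 * t) + std_normal_cdf (sqrt (K\<^sup>2 * t)))"
proof -
  have s: "sqrt (K\<^sup>2 * t) = K * sqrt t" "K * t / sqrt t = K * sqrt t"
    using t K real_div_sqrt[of t] by (auto simp: real_sqrt_mult times_divide_eq_right[symmetric] simp del: times_divide_eq_right)
  have "gauss t (0 - K * t) = std_normal_density (K * sqrt t) / sqrt t"
    using t s(2) by (simp add: gauss_even gauss_eq_std_normal)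
  then show ?thesis
    unfolding extremal_density_def drift_profile_def s(1) using s(2) K by (simp add: field_simps)
qed

lemma set_integrable_beta_scaled:
  fixes a b T :: real
  assumes "0 < a" "0 < b" "0 < T"
  shows "set_integrable lborel {0..T} (\<lambda>t. t powr (a - 1) * (T - t) powr (b - 1))"
proof -
  have "integrable lborel (\<lambda>u. indicator {0..1} u *\<^sub>R (u powr (a - 1) * (1 - u) powr (b - 1)))"
    using integrable_Beta[OF assms(1,2)] by (simp add: set_integrable_def)
  from lborel_integrable_real_affine[OF this, of "1 / T" 0]
  have 1: "integrable lborel (\<lambda>t. indicator {0..1} (t / T) *\<^sub>R ((t / T) powr (a - 1) * (1 - t / T) powr (b - 1)))"
    using assms by simp
  have "integrable lborel (\<lambda>t. (T powr (a - 1) * T powr (b - 1)) * (indicator {0..1} (t / T) *\<^sub>R ((t / T) powr (a - 1) * (1 - t / T) powr (b - 1))))"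
    using 1 by (rule integrable_mult_right)
  also have "(\<lambda>t. (T powr (a - 1) * T powr (b - 1)) * (indicator {0..1} (t / T) *\<^sub>R ((t / T) powr (a - 1) * (1 - t / T) powr (b - 1))))
      = (\<lambda>t. indicator {0..T} t *\<^sub>R (t powr (a - 1) * (T - t) powr (b - 1)))"
  proof
    fix t
    show "(T powr (a - 1) * T powr (b - 1)) * (indicator {0..1} (t / T) *\<^sub>R ((t / T) powr (a - 1) * (1 - t / T) powr (b - 1)))
      = indicator {0..T} t *\<^sub>R (t powr (a - 1) * (T - t) powr (b - 1))"
    proof (cases "t \<in> {0..T}")
      case True
      have "T * (t / T) = t" "T * (1 - t / T) = T - t"
        using assms by (simp_all add: right_diff_distrib)
      with True have "T powr (a - 1) * (t / T) powr (a - 1) = t powr (a - 1)"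
        "T powr (b - 1) * (1 - t / T) powr (b - 1) = (T - t) powr (b - 1)"
        using assms by (simp_all add: powr_mult[symmetric])
      then have "(T powr (a - 1) * T powr (b - 1)) * ((t / T) powr (a - 1) * (1 - t / T) powr (b - 1)) = t powr (a - 1) * (T - t) powr (b - 1)"
        by (metis (no_types, lifting) mult.assoc mult.left_commute)
      then show ?thesis using True assms by simp
    next
      case False
      then have "t / T \<notin> {0..1}" using assms by (auto simp: field_simps)
      then show ?thesis using False by simp
    qed
  qed
  finally show ?thesis by (simp add: set_integrable_def)
qed

lemma borel_measurable_extremal_density_center:
  "(\<lambda>t. indicator {0<..<T} t * (extremal_density K t 0 * (T - t) powr c)) \<in> borel_measurable borel"
proof -
  have "continuous_on {0<..<T} (\<lambda>t. extremal_density K t 0 * (T - t) powr c)"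
    by (intro continuous_on_mult DERIV_continuous_on[OF DERIV_extremal_density_variance] continuous_intros) auto
  then show ?thesis
    using borel_measurable_continuous_on_indicator[of "{0<..<T}" "\<lambda>t. extremal_density K t 0 * (T - t) powr c"] by simp
qed

text \<open>
  The singularities at \<open>0\<close>, of order \<open>t powr -(1/2)\<close>, and at \<open>T\<close>, of order \<open>(T - t) powr - c\<close>, are those
  of an Euler beta integral.
\<close>
lemma set_integrable_extremal_density_center:
  assumes K: "0 \<le> K" and T: "0 < T" and c: "0 < c" "c < 1"
  shows "set_integrable lborel {0<..<T} (\<lambda>t. extremal_density K t 0 * (T - t) powr - c)"
proof -
  interpret N: real_distribution std_normal_distribution by (rule real_dist_normal_dist)
  let ?C = "1 / sqrt (2 * pi) + K * sqrt T"
  have le: "extremal_density K t 0 \<le> ?C * t powr (1 / 2 - 1)" if t: "0 < t" "t < T" for t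
  proof -
    have h: "t powr (1 / 2 - 1) = 1 / sqrt t"
      using t by (simp add: powr_half_sqrt powr_minus inverse_eq_divide)
    have "extremal_density K t 0 \<le> 1 / sqrt (2 * pi * t) + K * 1"
      unfolding extremal_density_def drift_profile_def using t K N.cdf_bounded_prob
      by (intro add_mono gauss_le_max mult_left_mono) auto
    also have "K * 1 \<le> K * (sqrt T / sqrt t)" using K t by (intro mult_left_mono) auto
    finally show ?thesis unfolding h by (simp add: real_sqrt_mult add_divide_distrib)
  qed
  have "integrable lborel (\<lambda>t. ?C * (indicator {0..T} t *\<^sub>R (t powr (1 / 2 - 1) * (T - t) powr ((1 - c) - 1))))"
    using set_integrable_beta_scaled[of "1/2" "1 - c" T] c T unfolding set_integrable_def
    by (intro integrable_mult_right) auto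
  then show ?thesis
    unfolding set_integrable_def
  proof (rule Bochner_Integration.integrable_bound)
    show "AE t in lborel. norm (indicator {0<..<T} t *\<^sub>R (extremal_density K t 0 * (T - t) powr - c))
        \<le> norm (?C * (indicator {0..T} t *\<^sub>R (t powr (1 / 2 - 1) * (T - t) powr ((1 - c) - 1))))"
    proof (rule AE_I2)
      fix t
      show "norm (indicator {0<..<T} t *\<^sub>R (extremal_density K t 0 * (T - t) powr - c))
        \<le> norm (?C * (indicator {0..T} t *\<^sub>R (t powr (1 / 2 - 1) * (T - t) powr ((1 - c) - 1))))"
      proof (cases "t \<in> {0<..<T}")
        case True
        then have "extremal_density K t 0 * (T - t) powr - c \<le> ?C * t powr (1 / 2 - 1) * (T - t) powr - c"
          using le[of t] by (intro mult_right_mono) auto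
        then show ?thesis using True K extremal_density_nonneg[of t K 0] T by (simp add: abs_mult mult_ac)
      qed simp
    qed
  qed (use borel_measurable_extremal_density_center in simp)
qed

text \<open>
  Brownian scaling: the substitution \<open>s = K\<^sup>2 * t\<close> turns the constant, which is written for unit speed,
  into the form in which the estimate for speed \<open>K\<close> arises.
\<close>
lemma holder_bound_eq:
  assumes K: "0 < K" and T: "0 < T"
  shows "holder_bound K \<alpha> T = 1 / sqrt (2 * pi * exp \<alpha>) * T powr - ((1 + \<alpha>) / 2)
     + K * (4 / sqrt (2 * pi * exp \<alpha>)) * (LBINT t:{0<..<T}. extremal_density K t 0 * (T - t) powr - ((1 + \<alpha>) / 2))"
proof -
  define \<gamma> where "\<gamma> = (1 + \<alpha>) / 2"
  have pK: "(u * K\<^sup>2) powr \<gamma> = u powr \<gamma> * K powr (1 + \<alpha>)" if "0 \<le> u" for u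
  proof -
    have "(u * K\<^sup>2) powr \<gamma> = u powr \<gamma> * (K powr 2) powr \<gamma>" using that K by (simp add: powr_mult)
    also have "(K powr 2) powr \<gamma> = K powr (2 * \<gamma>)" by (rule powr_powr)
    also have "2 * \<gamma> = 1 + \<alpha>" by (simp add: \<gamma>_def)
    finally show ?thesis .
  qed
  let ?f = "\<lambda>s. (std_normal_density (sqrt s) / sqrt s + std_normal_cdf (sqrt s)) * (1 / (T * K\<^sup>2 - s) powr \<gamma>)"
  have "(LBINT s:{0<..<T * K\<^sup>2}. ?f s) = K\<^sup>2 * (\<integral>t. indicator {0<..<T * K\<^sup>2} (K\<^sup>2 * t) * ?f (K\<^sup>2 * t) \<partial>lborel)"
    using lborel_integral_real_affine[of "K\<^sup>2" "\<lambda>s. indicator {0<..<T * K\<^sup>2} s * ?f s" 0] K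
    by (simp add: set_lebesgue_integral_def)
  also have "\<dots> = K\<^sup>2 * (\<integral>t. (1 / K * K powr - (1 + \<alpha>)) * (indicator {0<..<T} t * (extremal_density K t 0 * (T - t) powr - \<gamma>)) \<partial>lborel)"
  proof (intro arg_cong[where f="\<lambda>x. K\<^sup>2 * x"] Bochner_Integration.integral_cong refl)
    fix t
    have i: "(indicator {0<..<T * K\<^sup>2} (K\<^sup>2 * t) :: real) = indicator {0<..<T} t"
      using K by (auto simp: indicator_def zero_less_mult_iff mult.commute)
    have "?f (K\<^sup>2 * t) = (1 / K * K powr - (1 + \<alpha>)) * (extremal_density K t 0 * (T - t) powr - \<gamma>)" if t: "0 < t" "t < T"
    proof -
      have "(T * K\<^sup>2 - K\<^sup>2 * t) powr \<gamma> = (T - t) powr \<gamma> * K powr (1 + \<alpha>)"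
        using pK[of "T - t"] t by (simp add: algebra_simps)
      moreover have "std_normal_density (sqrt (K\<^sup>2 * t)) / sqrt (K\<^sup>2 * t) + std_normal_cdf (sqrt (K\<^sup>2 * t)) = extremal_density K t 0 / K"
        using extremal_density_center_scaling[OF t(1) K] K by simp
      ultimately show ?thesis unfolding powr_minus by (simp add: divide_inverse mult_ac)
    qed
    then show "indicator {0<..<T * K\<^sup>2} (K\<^sup>2 * t) * ?f (K\<^sup>2 * t)
        = (1 / K * K powr - (1 + \<alpha>)) * (indicator {0<..<T} t * (extremal_density K t 0 * (T - t) powr - \<gamma>))"
      unfolding i by (auto split: split_indicator)
  qed
  also have "\<dots> = K * K powr - (1 + \<alpha>) * (LBINT t:{0<..<T}. extremal_density K t 0 * (T - t) powr - \<gamma>)"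
    using K by (simp add: set_lebesgue_integral_def power2_eq_square)
  finally have int: "(LBINT s:{0<..<T * K\<^sup>2}. ?f s) = K * K powr - (1 + \<alpha>) * (LBINT t:{0<..<T}. extremal_density K t 0 * (T - t) powr - \<gamma>)" .
  have KK: "K powr (1 + \<alpha>) * K powr - (1 + \<alpha>) = 1" unfolding powr_minus using K by simp
  have ring: "A * (1 / (s * (t * A)) + 4 / s * (K * B * I)) = 1 / s * inverse t + K * (4 / s) * I"
    if "A * B = 1" "s \<noteq> 0" "t \<noteq> 0" for A B s t I :: real
  proof -
    have "A \<noteq> 0" using that by auto
    have "A * (1 / (s * (t * A)) + 4 / s * (K * B * I)) = 1 / (s * t) + 4 / s * K * I * (A * B)"
      using that \<open>A \<noteq> 0\<close> by (simp add: divide_simps) (simp add: algebra_simps)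
    then show ?thesis using that by (simp add: divide_inverse mult_ac)
  qed
  show ?thesis
    unfolding holder_bound_def \<gamma>_def[symmetric] int pK[OF less_imp_le[OF T]]
    by (subst ring[OF KK]) (use T in \<open>auto simp: powr_minus\<close>)
qed

context bounded_drift_motion
begin

text \<open>
  The difference \<open>D t\<close> of the expectations of \<open>gauss (T + \<epsilon> - t)\<close> at \<open>X t - y\<close> and \<open>X t - z\<close> is
  followed from \<open>t = \<epsilon>\<close> to \<open>t = T\<close>. It grows at a rate of at most \<open>a t\<close>, by the density bound and the
  \<open>L\<^sup>1\<close> estimate. The starting time \<open>\<epsilon>\<close> avoids the singularity of \<open>extremal_density K t 0\<close> at
  \<open>t = 0\<close>, and with this choice the initial value \<open>D \<epsilon>\<close> involves exactly \<open>gauss T\<close>, whose Hoelder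
  constant is the first summand of \<open>holder_bound\<close>.
\<close>
lemma expectation_gauss_diff_le:
  assumes \<alpha>: "0 < \<alpha>" "\<alpha> < 1" and T: "0 < T" and \<epsilon>: "0 < \<epsilon>" "\<epsilon> \<le> T"
  shows "expectation (\<lambda>\<omega>. gauss \<epsilon> (X T \<omega> - y)) - expectation (\<lambda>\<omega>. gauss \<epsilon> (X T \<omega> - z))
    \<le> holder_bound K \<alpha> T * \<bar>y - z\<bar> powr \<alpha>"
proof -
  have K: "0 \<le> K" using K_pos by simp
  define \<gamma> where "\<gamma> = (1 + \<alpha>) / 2"
  define c where "c = 1 / sqrt (2 * pi * exp \<alpha>)"
  define d where "d = \<bar>y - z\<bar> powr \<alpha>"
  have c0: "0 \<le> c" "0 \<le> d" by (auto simp: c_def d_def)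
  define D where "D t = expectation (\<lambda>\<omega>. gauss (T + \<epsilon> - t) (X t \<omega> - y)) - expectation (\<lambda>\<omega>. gauss (T + \<epsilon> - t) (X t \<omega> - z))" for t
  define a where "a t = K * (4 * c) * d * (extremal_density K t 0 * (T + \<epsilon> / 2 - t) powr - \<gamma>)" for t
  note ig = integrable_gauss_motion
  obtain C where C: "0 \<le> C"
    "\<And>t h r. 0 \<le> t \<Longrightarrow> 0 < h \<Longrightarrow> h \<le> 1 \<Longrightarrow> \<epsilon> \<le> r \<Longrightarrow> r + h \<le> T + \<epsilon> \<Longrightarrow>
      \<exists>b. random_variable borel b \<and> (AE \<omega> in M. \<bar>b \<omega>\<bar> \<le> K * h) \<and>
       (\<forall>y. \<bar>expectation (\<lambda>\<omega>. extremal_density 0 r (X (t + h) \<omega> - y))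
        - expectation (\<lambda>\<omega>. extremal_density 0 (r + h) (X t \<omega> - y))
        - expectation (\<lambda>\<omega>. b \<omega> * extremal_density_dx 0 r (X t \<omega> - y))
        + h * 0 * expectation (\<lambda>\<omega>. \<bar>extremal_density_dx 0 r (X t \<omega> - y)\<bar>)\<bar> \<le> C * (h * sqrt h))"
    using extremal_density_increment[OF \<epsilon>(1) order_refl, of "T + \<epsilon>"] by blast
  have "D T - D \<epsilon> \<le> integral {\<epsilon>..T} a"
  \<comment> \<open>The kernel is evaluated at the end of a step, but \<open>a\<close> at its beginning. Steps of length at most
    \<open>\<epsilon> / 2\<close> let the other half of \<open>\<epsilon>\<close> absorb the difference.\<close>
  proof (rule increment_le_integral[OF \<epsilon>(2), of _ "min 1 (\<epsilon> / 2)" _ "2 * C"])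
    show "continuous_on {\<epsilon>..T} a"
      unfolding a_def[abs_def] using \<epsilon>
      by (intro continuous_on_mult DERIV_continuous_on[OF DERIV_extremal_density_variance] continuous_intros) auto
    show "0 < min 1 (\<epsilon> / 2)" using \<epsilon> by simp
    fix t h :: real assume t: "\<epsilon> \<le> t" "t + h \<le> T" and h: "0 < h" "h \<le> min 1 (\<epsilon> / 2)"
    define r where "r = T + \<epsilon> - (t + h)"
    have r: "\<epsilon> \<le> r" "r + h \<le> T + \<epsilon>" "0 < r" "T + \<epsilon> / 2 - t \<le> r" "0 < T + \<epsilon> / 2 - t" using t h \<epsilon> by (auto simp: r_def)
    have t0: "0 < t" using t \<epsilon> by simp
    have [measurable]: "random_variable borel (X t)" using t0 X_measurable by auto
    let ?v = "\<lambda>y \<omega>. extremal_density_dx 0 r (X t \<omega> - y)"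
    obtain b where b [measurable]: "random_variable borel b" and b_le: "AE \<omega> in M. \<bar>b \<omega>\<bar> \<le> K * h"
      and step: "\<And>y. \<bar>expectation (\<lambda>\<omega>. gauss r (X (t + h) \<omega> - y))
        - expectation (\<lambda>\<omega>. gauss (r + h) (X t \<omega> - y)) - expectation (\<lambda>\<omega>. b \<omega> * ?v y \<omega>)\<bar> \<le> C * (h * sqrt h)"
      using C(2)[of t h r] t0 h r unfolding extremal_density_zero_drift by fastforce
    obtain C1 where C1: "\<And>x. \<bar>extremal_density_dx 0 r x\<bar> \<le> C1" "\<And>x. \<bar>extremal_density_dxx 0 r x\<bar> \<le> C1"
      using extremal_density_bounded[OF r(3) order_refl, of r] by (metis atLeastAtMost_singleton singletonI)
    define \<psi> where "\<psi> x = \<bar>extremal_density_dx 0 r (x - y) - extremal_density_dx 0 r (x - z)\<bar>" for x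
    have E\<psi>: "expectation (\<lambda>\<omega>. \<psi> (X t \<omega>)) \<le> extremal_density K t 0 * (\<integral>x. \<psi> x \<partial>lborel)"
    proof (rule expectation_le_extremal_density_times_integral[OF t0])
      show "integrable lborel \<psi>"
        unfolding \<psi>_def[abs_def] using gauss_deriv_L1_holder(1)[OF r(3), of \<alpha> y z] \<alpha> by simp
      show "\<psi> x \<le> 2 * C1" for x unfolding \<psi>_def using C1(1)[of "x - y"] C1(1)[of "x - z"] by linarith
      have l: "\<bar>extremal_density_dx 0 r x - extremal_density_dx 0 r x'\<bar> \<le> C1 * \<bar>x - x'\<bar>" for x x'
        using DERIV_extremal_density_dx[OF r(3)] C1(2) by (rule lipschitz_of_bounded_deriv)
      show "\<bar>\<psi> x - \<psi> x'\<bar> \<le> 2 * C1 * \<bar>x - x'\<bar>" for x x'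
      proof -
        have "\<bar>\<bar>A - B\<bar> - \<bar>A' - B'\<bar>\<bar> \<le> 2 * e" if "\<bar>A - A'\<bar> \<le> e" "\<bar>B - B'\<bar> \<le> e" for A A' B B' e :: real
          using that by linarith
        from this[OF l[of "x - y" "x' - y"]] l[of "x - z" "x' - z"] show ?thesis
          unfolding \<psi>_def by (simp add: mult.assoc)
      qed
    qed (simp add: \<psi>_def)
    have iv: "integrable M (\<lambda>\<omega>. ?v y \<omega>)" for y
      using C1(1) t0 by (intro integrable_bounded_function[of "\<lambda>x. extremal_density_dx 0 r (x - y)" C1]) auto
    have ib: "integrable M (\<lambda>\<omega>. b \<omega> * ?v y \<omega>)" for y
    proof (rule integrable_const_bound[where B="K * h * C1"])
      show "AE \<omega> in M. norm (b \<omega> * ?v y \<omega>) \<le> K * h * C1"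
        using b_le by eventually_elim (use C1(1) K h in \<open>auto simp: abs_mult intro!: mult_mono\<close>)
    qed measurable
    have "expectation (\<lambda>\<omega>. b \<omega> * ?v y \<omega>) - expectation (\<lambda>\<omega>. b \<omega> * ?v z \<omega>) = expectation (\<lambda>\<omega>. b \<omega> * ?v y \<omega> - b \<omega> * ?v z \<omega>)"
      using ib by simp
    also have "\<dots> \<le> expectation (\<lambda>\<omega>. K * h * \<psi> (X t \<omega>))"
    proof (rule integral_mono_AE)
      show "AE \<omega> in M. b \<omega> * ?v y \<omega> - b \<omega> * ?v z \<omega> \<le> K * h * \<psi> (X t \<omega>)"
        using b_le
      proof eventually_elim
        fix \<omega> assume "\<bar>b \<omega>\<bar> \<le> K * h"
        then have "\<bar>b \<omega> * (?v y \<omega> - ?v z \<omega>)\<bar> \<le> K * h * \<psi> (X t \<omega>)"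
          unfolding abs_mult \<psi>_def by (rule mult_right_mono) simp
        then show "b \<omega> * ?v y \<omega> - b \<omega> * ?v z \<omega> \<le> K * h * \<psi> (X t \<omega>)" by (simp add: right_diff_distrib)
      qed
      show "integrable M (\<lambda>\<omega>. K * h * \<psi> (X t \<omega>))" unfolding \<psi>_def using iv by auto
    qed (use ib in auto)
    also have "\<dots> = K * h * expectation (\<lambda>\<omega>. \<psi> (X t \<omega>))" by simp
    also have "\<dots> \<le> K * h * (extremal_density K t 0 * (4 * c * (T + \<epsilon> / 2 - t) powr - \<gamma> * d))"
    proof (intro mult_left_mono order_trans[OF E\<psi>])
      have "(\<integral>x. \<psi> x \<partial>lborel) \<le> 4 * c * r powr - \<gamma> * d"
        using gauss_deriv_L1_holder(2)[OF r(3), of \<alpha> y z] \<alpha> unfolding \<psi>_def c_def d_def \<gamma>_def by simp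
      also have "\<dots> \<le> 4 * c * (T + \<epsilon> / 2 - t) powr - \<gamma> * d"
        using r \<alpha> c0 by (intro mult_right_mono mult_left_mono powr_mono2') (auto simp: \<gamma>_def)
      finally show "(\<integral>x. \<psi> x \<partial>lborel) \<le> 4 * c * (T + \<epsilon> / 2 - t) powr - \<gamma> * d" .
      show "0 \<le> extremal_density K t 0" by (rule extremal_density_nonneg[OF t0 K])
    qed (use K h in auto)
    finally have "expectation (\<lambda>\<omega>. b \<omega> * ?v y \<omega>) - expectation (\<lambda>\<omega>. b \<omega> * ?v z \<omega>) \<le> h * a t"
      by (simp add: a_def mult_ac)
    moreover have "D (t + h) - D t = (expectation (\<lambda>\<omega>. gauss r (X (t + h) \<omega> - y)) - expectation (\<lambda>\<omega>. gauss (r + h) (X t \<omega> - y)))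
       - (expectation (\<lambda>\<omega>. gauss r (X (t + h) \<omega> - z)) - expectation (\<lambda>\<omega>. gauss (r + h) (X t \<omega> - z)))"
    proof -
      have rh: "r + h = T + \<epsilon> - t" by (simp add: r_def)
      show ?thesis unfolding D_def rh r_def[symmetric] by simp
    qed
    ultimately show "D (t + h) - D t \<le> h * a t + 2 * C * (h * sqrt h)"
      using step[of y] step[of z] by (simp add: abs_le_iff)
  qed
  moreover have "D \<epsilon> \<le> c * T powr - \<gamma> * d"
  proof -
    have "D \<epsilon> = expectation (\<lambda>\<omega>. gauss T (X \<epsilon> \<omega> - y) - gauss T (X \<epsilon> \<omega> - z))"
      unfolding D_def using ig[OF T, of \<epsilon>] \<epsilon> by simp
    also have "\<dots> \<le> expectation (\<lambda>\<omega>. c * T powr - \<gamma> * d)"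
    proof (rule integral_mono)
      fix \<omega>
      have "\<bar>gauss T (X \<epsilon> \<omega> - y) - gauss T (X \<epsilon> \<omega> - z)\<bar> \<le> c * T powr - \<gamma> * \<bar>(X \<epsilon> \<omega> - y) - (X \<epsilon> \<omega> - z)\<bar> powr \<alpha>"
        unfolding c_def \<gamma>_def using \<alpha> by (intro gauss_holder T) auto
      then show "gauss T (X \<epsilon> \<omega> - y) - gauss T (X \<epsilon> \<omega> - z) \<le> c * T powr - \<gamma> * d"
        by (simp add: d_def abs_minus_commute)
    qed (use ig[OF T] \<epsilon> in auto)
    finally show ?thesis by (simp add: prob_space)
  qed
  moreover have "integral {\<epsilon>..T} a \<le> K * (4 * c) * d * (LBINT t:{0<..<T}. extremal_density K t 0 * (T - t) powr - \<gamma>)"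
  proof -
    have ca: "continuous_on {\<epsilon>..T} a"
      unfolding a_def[abs_def] using \<epsilon>
      by (intro continuous_on_mult DERIV_continuous_on[OF DERIV_extremal_density_variance] continuous_intros) auto
    then have ia: "set_integrable lborel {\<epsilon>..T} a" by (rule borel_integrable_atLeastAtMost')
    have ib: "integrable lborel (\<lambda>t. K * (4 * c) * d * (indicator {0<..<T} t *\<^sub>R (extremal_density K t 0 * (T - t) powr - \<gamma>)))"
      using set_integrable_extremal_density_center[OF K T, of \<gamma>] \<alpha> unfolding set_integrable_def \<gamma>_def
      by (intro integrable_mult_right) auto
    have "integral {\<epsilon>..T} a = (LBINT t:{\<epsilon>..T}. a t)"
      using set_borel_integral_eq_integral(2)[OF ia] by simp
    also have "\<dots> \<le> (\<integral>t. K * (4 * c) * d * (indicator {0<..<T} t *\<^sub>R (extremal_density K t 0 * (T - t) powr - \<gamma>)) \<partial>lborel)"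
      unfolding set_lebesgue_integral_def
    proof (rule integral_mono_AE)
      show "AE t in lborel. indicator {\<epsilon>..T} t *\<^sub>R a t \<le> K * (4 * c) * d * (indicator {0<..<T} t *\<^sub>R (extremal_density K t 0 * (T - t) powr - \<gamma>))"
        using AE_lborel_singleton[of T]
      proof eventually_elim
        fix t assume "t \<noteq> T"
        show "indicator {\<epsilon>..T} t *\<^sub>R a t \<le> K * (4 * c) * d * (indicator {0<..<T} t *\<^sub>R (extremal_density K t 0 * (T - t) powr - \<gamma>))"
        proof (cases "t \<in> {\<epsilon>..T}")
          case True
          then have t: "0 < t" "t < T" using \<open>t \<noteq> T\<close> \<epsilon> by auto
          have "(T + \<epsilon> / 2 - t) powr - \<gamma> \<le> (T - t) powr - \<gamma>"
            using t \<epsilon> \<alpha> by (intro powr_mono2') (auto simp: \<gamma>_def)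
          then have "a t \<le> K * (4 * c) * d * (extremal_density K t 0 * (T - t) powr - \<gamma>)"
            unfolding a_def using K c0 extremal_density_nonneg[OF t(1) K] by (intro mult_left_mono) auto
          then show ?thesis using True t by simp
        next
          case False
          have "0 \<le> K * (4 * c) * d * (indicator {0<..<T} t *\<^sub>R (extremal_density K t 0 * (T - t) powr - \<gamma>))"
            using K c0 extremal_density_nonneg[of t K 0] by (auto split: split_indicator)
          then show ?thesis using False by simp
        qed
      qed
    qed (use ia ib in \<open>auto simp: set_integrable_def\<close>)
    finally show ?thesis by (simp add: set_lebesgue_integral_def)
  qed
  ultimately have "D T \<le> c * T powr - \<gamma> * d + K * (4 * c) * d * (LBINT t:{0<..<T}. extremal_density K t 0 * (T - t) powr - \<gamma>)"
    by linarith
  also have "\<dots> = holder_bound K \<alpha> T * d"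
    unfolding holder_bound_eq[OF K_pos T] c_def \<gamma>_def by (simp add: algebra_simps)
  finally show ?thesis by (simp add: D_def d_def)
qed

end

section \<open>Removing the mollification\<close>
lemma gauss_semigroup:
  assumes "0 < \<delta>" "\<delta> < \<epsilon>"
  shows "ennreal (gauss \<epsilon> (x - y)) = (\<integral>\<^sup>+z. ennreal (gauss \<delta> (x - z) * gauss (\<epsilon> - \<delta>) (y - z)) \<partial>lborel)"
proof -
  have "sqrt \<epsilon> = sqrt ((sqrt \<delta>)\<^sup>2 + (sqrt (\<epsilon> - \<delta>))\<^sup>2)" using assms by simp
  then have "ennreal (gauss \<epsilon> (x - y)) = (\<integral>\<^sup>+w. ennreal (normal_density 0 (sqrt \<delta>) (x - y - w) * normal_density 0 (sqrt (\<epsilon> - \<delta>)) w) \<partial>lborel)"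
    using assms by (simp add: gauss_eq_normal_density conv_normal_density_zero_mean[THEN fun_cong])
  also have "\<dots> = (\<integral>\<^sup>+w. ennreal (gauss \<delta> (x - (y + w)) * gauss (\<epsilon> - \<delta>) (y - (y + w))) \<partial>lborel)"
    using assms by (intro nn_integral_cong) (simp add: gauss_eq_normal_density[symmetric] gauss_even algebra_simps)
  also have "\<dots> = (\<integral>\<^sup>+z. ennreal (gauss \<delta> (x - z) * gauss (\<epsilon> - \<delta>) (y - z)) \<partial>lborel)"
    by (subst nn_integral_real_affine[of _ 1 y]) auto
  finally show ?thesis .
qed

text \<open>
  Chebyshev's inequality: if exactly one of \<open>x\<close> and \<open>y\<close> lies in the interval, then their distance is at
  least the distance \<open>m\<close> of \<open>x\<close> to the end points, so the error is at most the variance divided by \<open>m\<^sup>2\<close>.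
\<close>
lemma gauss_interval_mass_tendsto:
  assumes x: "x \<noteq> a" "x \<noteq> b" and \<epsilon>: "\<And>n. 0 < \<epsilon> n" "\<epsilon> \<longlonglongrightarrow> 0"
  shows "(\<lambda>n::nat. \<integral>y. indicator {a..b} y * gauss (\<epsilon> n) (x - y) \<partial>lborel) \<longlonglongrightarrow> indicator {a..b} x"
proof -
  define m where "m = min \<bar>x - a\<bar> \<bar>x - b\<bar>"
  have m: "0 < m" using x by (simp add: m_def)
  have le: "\<bar>(indicator {a..b} y :: real) - indicator {a..b} x\<bar> \<le> (y - x)\<^sup>2 / m\<^sup>2" for y
  proof (cases "(y \<in> {a..b}) = (x \<in> {a..b})")
    case False
    then have "m \<le> \<bar>y - x\<bar>" unfolding m_def by (auto simp: min_def abs_if split: if_splits)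
    then have "m\<^sup>2 \<le> (y - x)\<^sup>2" using m by (metis abs_le_square_iff abs_of_pos)
    then have "1 \<le> (y - x)\<^sup>2 / m\<^sup>2" using m by simp
    then show ?thesis using False by (auto split: split_indicator)
  qed (auto split: split_indicator)
  have err: "\<bar>(\<integral>y. indicator {a..b} y * gauss (\<epsilon> n) (x - y) \<partial>lborel) - indicator {a..b} x\<bar> \<le> \<epsilon> n / m\<^sup>2" for n
  proof -
    have s: "0 < sqrt (\<epsilon> n)" using \<epsilon>(1)[of n] by simp
    define g where "g = normal_density x (sqrt (\<epsilon> n))"
    have g: "integrable lborel g" "(\<integral>z. g z \<partial>lborel) = 1" "\<And>z. 0 \<le> g z"
      using s by (auto simp: g_def)
    have g2: "integrable lborel (\<lambda>z. g z * (z - x)\<^sup>2)" "(\<integral>z. g z * (z - x)\<^sup>2 \<partial>lborel) = \<epsilon> n"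
      using integrable_normal_moment[OF s, of x 2] integral_normal_moment_even[OF s, of x 1] \<epsilon>(1)[of n] by (auto simp: g_def)
    have ig: "integrable lborel (\<lambda>y. indicator {a..b} y * g y)"
      using integrable_mult_indicator[of "{a..b}" lborel g] g by simp
    have "(\<integral>y. indicator {a..b} y * gauss (\<epsilon> n) (x - y) \<partial>lborel) - indicator {a..b} x
        = (\<integral>y. indicator {a..b} y * g y - indicator {a..b} x * g y \<partial>lborel)"
      using g ig \<epsilon>(1)[of n] by (simp add: gauss_eq_normal_density_centered g_def[symmetric])
    also have "\<bar>\<dots>\<bar> \<le> (\<integral>y. \<bar>indicator {a..b} y * g y - indicator {a..b} x * g y\<bar> \<partial>lborel)"
      by (rule integral_abs_bound)
    also have "\<dots> \<le> (\<integral>y. g y * (y - x)\<^sup>2 / m\<^sup>2 \<partial>lborel)"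
    proof (rule integral_mono)
      fix y
      have "\<bar>indicator {a..b} y * g y - indicator {a..b} x * g y\<bar> = \<bar>indicator {a..b} y - indicator {a..b} x\<bar> * g y"
        using g(3)[of y] by (simp add: left_diff_distrib[symmetric] abs_mult)
      also have "\<dots> \<le> (y - x)\<^sup>2 / m\<^sup>2 * g y" by (intro mult_right_mono le g)
      finally show "\<bar>indicator {a..b} y * g y - indicator {a..b} x * g y\<bar> \<le> g y * (y - x)\<^sup>2 / m\<^sup>2" by (simp add: mult_ac)
    qed (use g g2 ig in auto)
    also have "\<dots> = \<epsilon> n / m\<^sup>2" using g2 by simp
    finally show ?thesis .
  qed
  have "(\<lambda>n. \<epsilon> n / m\<^sup>2) \<longlonglongrightarrow> 0 / m\<^sup>2" using \<epsilon>(2) m by (intro tendsto_divide) auto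
  then have "(\<lambda>n. \<epsilon> n / m\<^sup>2) \<longlonglongrightarrow> 0" by (simp only: div_0)
  from _ this have "(\<lambda>n. (\<integral>y. indicator {a..b} y * gauss (\<epsilon> n) (x - y) \<partial>lborel) - indicator {a..b} x) \<longlonglongrightarrow> 0"
  proof (rule Lim_null_comparison)
    show "\<forall>\<^sub>F n in sequentially.
      norm ((\<integral>y. indicator {a..b} y * gauss (\<epsilon> n) (x - y) \<partial>lborel) - indicator {a..b} x) \<le> \<epsilon> n / m\<^sup>2"
      unfolding real_norm_def by (intro always_eventually allI err)
  qed
  then show ?thesis
    by (rule LIM_zero_cancel)
qed

lemma exp_variance_le: "\<epsilon> \<le> 1 \<Longrightarrow> exp (K\<^sup>2 * \<epsilon> / 2) \<le> exp (K\<^sup>2 / 2)" for K \<epsilon> :: real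
  using mult_left_mono[of \<epsilon> 1 "K\<^sup>2"] by simp

definition mollified_density :: "'a measure \<Rightarrow> ('a \<Rightarrow> real) \<Rightarrow> real \<Rightarrow> real \<Rightarrow> real" where
  "mollified_density M Y \<epsilon> y = (\<integral>\<omega>. gauss \<epsilon> (Y \<omega> - y) \<partial>M)"

text \<open>
  The sequence of variances is fixed in order that the limit depends on neither the bound of the drift nor
  the Hoelder exponent.
\<close>
definition limit_density :: "'a measure \<Rightarrow> ('a \<Rightarrow> real) \<Rightarrow> real \<Rightarrow> real" where
  "limit_density M Y y = lim (\<lambda>n. mollified_density M Y (1 / Suc n) y)"

context bounded_drift_motion
begin

lemma mollified_density_nonneg: "0 < \<epsilon> \<Longrightarrow> 0 \<le> mollified_density M (X T) \<epsilon> y"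
  unfolding mollified_density_def by (simp add: gauss_nonneg)

lemma mollified_density_le:
  assumes "0 < \<epsilon>" "0 < T"
  shows "mollified_density M (X T) \<epsilon> y \<le> exp (K\<^sup>2 * \<epsilon> / 2) * extremal_density K T 0"
proof -
  have "mollified_density M (X T) \<epsilon> y \<le> exp (K\<^sup>2 * \<epsilon> / 2) * extremal_density K (T + \<epsilon>) 0"
    unfolding mollified_density_def using assms by (intro expectation_gauss_le) auto
  also have "\<dots> \<le> exp (K\<^sup>2 * \<epsilon> / 2) * extremal_density K T 0"
    using assms by (intro mult_left_mono extremal_density_center_antimono) auto
  finally show ?thesis .
qed

lemma mollified_density_holder:
  assumes "0 < \<alpha>" "\<alpha> < 1" "0 < T" "0 < \<epsilon>" "\<epsilon> \<le> T"
  shows "\<bar>mollified_density M (X T) \<epsilon> y - mollified_density M (X T) \<epsilon> z\<bar> \<le> holder_bound K \<alpha> T * \<bar>y - z\<bar> powr \<alpha>"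
  using expectation_gauss_diff_le[OF assms, of y z] expectation_gauss_diff_le[OF assms, of z y]
  by (auto simp: mollified_density_def abs_le_iff abs_minus_commute)

lemma borel_measurable_mollified_density [measurable]:
  assumes "0 \<le> T"
  shows "mollified_density M (X T) \<epsilon> \<in> borel_measurable borel"
proof -
  have [measurable]: "random_variable borel (X T)" using X_measurable assms by auto
  show ?thesis unfolding mollified_density_def[abs_def] by measurable
qed

lemma mollified_density_semigroup:
  assumes "0 < \<delta>" "\<delta> < \<epsilon>" "0 \<le> T"
  shows "mollified_density M (X T) \<epsilon> y = (\<integral>z. mollified_density M (X T) \<delta> z * gauss (\<epsilon> - \<delta>) (y - z) \<partial>lborel)"
proof -
  have [measurable]: "random_variable borel (X T)" using X_measurable assms by auto
  note [measurable] = borel_measurable_mollified_density[OF assms(3)]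
  have \<epsilon>: "0 < \<epsilon>" "0 < \<epsilon> - \<delta>" using assms by auto
  have nn: "ennreal (mollified_density M (X T) \<epsilon> y) = (\<integral>\<^sup>+\<omega>. ennreal (gauss \<epsilon> (X T \<omega> - y)) \<partial>M)" if "0 < \<epsilon>" for \<epsilon> y
    unfolding mollified_density_def using integrable_gauss_motion[OF that assms(3)] gauss_nonneg[OF that]
    by (intro nn_integral_eq_integral[symmetric]) auto
  interpret P: pair_sigma_finite M lborel ..
  have "ennreal (mollified_density M (X T) \<epsilon> y)
      = (\<integral>\<^sup>+\<omega>. \<integral>\<^sup>+z. ennreal (gauss \<delta> (X T \<omega> - z) * gauss (\<epsilon> - \<delta>) (y - z)) \<partial>lborel \<partial>M)"
    unfolding nn[OF \<epsilon>(1)] gauss_semigroup[OF assms(1,2)] ..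
  also have "\<dots> = (\<integral>\<^sup>+z. \<integral>\<^sup>+\<omega>. ennreal (gauss \<delta> (X T \<omega> - z) * gauss (\<epsilon> - \<delta>) (y - z)) \<partial>M \<partial>lborel)"
    by (rule P.Fubini'[symmetric]) measurable
  also have "\<dots> = (\<integral>\<^sup>+z. ennreal (mollified_density M (X T) \<delta> z * gauss (\<epsilon> - \<delta>) (y - z)) \<partial>lborel)"
    using gauss_nonneg[OF \<epsilon>(2)] gauss_nonneg[OF assms(1)] mollified_density_nonneg[OF assms(1)]
    by (intro nn_integral_cong) (simp add: ennreal_mult nn[OF assms(1)] nn_integral_multc)
  finally have "(\<integral>\<^sup>+z. ennreal (mollified_density M (X T) \<delta> z * gauss (\<epsilon> - \<delta>) (y - z)) \<partial>lborel) = ennreal (mollified_density M (X T) \<epsilon> y)" ..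
  then have "has_bochner_integral lborel (\<lambda>z. mollified_density M (X T) \<delta> z * gauss (\<epsilon> - \<delta>) (y - z)) (mollified_density M (X T) \<epsilon> y)"
    using gauss_nonneg[OF \<epsilon>(2)] mollified_density_nonneg[OF assms(1)] mollified_density_nonneg[OF \<epsilon>(1)]
    by (intro has_bochner_integral_nn_integral) auto
  then show ?thesis by (simp add: has_bochner_integral_integral_eq)
qed

text \<open>
  By the semigroup property the mollified density for \<open>\<epsilon>\<close> is a mollification of the one for \<open>\<delta>\<close>, which is
  Hoelder continuous with a constant independent of \<open>\<delta>\<close>. Any exponent would do for this estimate;
  \<open>1 / 2\<close> is chosen.
\<close>
lemma mollified_density_diff_le:
  assumes T: "0 < T" and \<delta>: "0 < \<delta>" "\<delta> \<le> \<epsilon>" and \<epsilon>: "\<epsilon> \<le> T"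
  shows "\<bar>mollified_density M (X T) \<epsilon> y - mollified_density M (X T) \<delta> y\<bar> \<le> 2 * holder_bound K (1 / 2) T * \<epsilon> powr (1 / 4)"
proof -
  let ?C = "holder_bound K (1 / 2) T" and ?p = "mollified_density M (X T)"
  have h: "\<bar>?p \<delta> u - ?p \<delta> v\<bar> \<le> ?C * \<bar>u - v\<bar> powr (1 / 2)" for u v
    using T \<delta> \<epsilon> by (intro mollified_density_holder) auto
  have C: "0 \<le> ?C" using h[of 1 0] by simp
  show ?thesis
  proof (cases "\<delta> = \<epsilon>")
    case True then show ?thesis using C by simp
  next
    case False
    then have d: "0 < \<epsilon> - \<delta>" "\<delta> < \<epsilon>" using \<delta> by auto
    have "\<bar>(\<integral>z. ?p \<delta> z * gauss (\<epsilon> - \<delta>) (y - z) \<partial>lborel) - ?p \<delta> y\<bar> \<le> 2 * ?C * (\<epsilon> - \<delta>) powr (1 / 2 / 2)"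
      using mollified_density_nonneg[OF \<delta>(1), of T] mollified_density_le[OF \<delta>(1) T] T
      by (intro gauss_mollification_error[OF d(1), where B="exp (K\<^sup>2 * \<delta> / 2) * extremal_density K T 0"] h
          borel_measurable_mollified_density) auto
    also have "\<dots> \<le> 2 * ?C * \<epsilon> powr (1 / 4)"
      using C d \<delta> powr_mono2[of "1 / 4" "\<epsilon> - \<delta>" \<epsilon>] by (intro mult_mono) auto
    finally show ?thesis using mollified_density_semigroup[OF \<delta>(1) d(2), of T y] T by simp
  qed
qed

lemma mollified_density_tendsto:
  assumes T: "0 < T"
  shows "(\<lambda>n. mollified_density M (X T) (1 / Suc n) y) \<longlonglongrightarrow> limit_density M (X T) y"
proof -
  let ?p = "\<lambda>n. mollified_density M (X T) (1 / Suc n) y" and ?C = "holder_bound K (1 / 2) T"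
  have small: "\<forall>\<^sub>F n in sequentially. 1 / real (Suc n) < c" if "0 < c" for c
    using order_tendstoD(2)[OF LIMSEQ_inverse_real_of_nat that] by (simp add: inverse_eq_divide)
  have "(\<lambda>n. 2 * ?C * (1 / real (Suc n)) powr (1 / 4)) \<longlonglongrightarrow> 2 * ?C * 0 powr (1 / 4)"
    using LIMSEQ_inverse_real_of_nat
    by (intro tendsto_intros tendsto_powr') (auto simp: inverse_eq_divide)
  then have lim0: "(\<lambda>n. 2 * ?C * (1 / real (Suc n)) powr (1 / 4)) \<longlonglongrightarrow> 0" by simp
  have "Cauchy ?p"
  proof (rule metric_CauchyI)
    fix e :: real assume e: "0 < e"
    from eventually_conj[OF small[OF T] order_tendstoD(2)[OF lim0, of "e / 2"]] e
    obtain N where N: "1 / real (Suc N) < T" "2 * ?C * (1 / real (Suc N)) powr (1 / 4) < e / 2"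
      by (auto simp: eventually_sequentially)
    have "\<bar>?p N - ?p n\<bar> < e / 2" if "N \<le> n" for n
      using mollified_density_diff_le[OF T, of "1 / Suc n" "1 / Suc N" y] N that
      by (force simp: frac_le)
    then show "\<exists>N. \<forall>m\<ge>N. \<forall>n\<ge>N. dist (?p m) (?p n) < e"
      by (intro exI[of _ N]) (smt (verit) dist_real_def field_sum_of_halves)
  qed
  then show ?thesis
    unfolding limit_density_def by (simp add: Cauchy_convergent_iff convergent_LIMSEQ_iff)
qed

lemma limit_density_nonneg: "0 < T \<Longrightarrow> 0 \<le> limit_density M (X T) y"
  by (rule LIMSEQ_le_const[OF mollified_density_tendsto]) (auto intro!: mollified_density_nonneg)

lemma limit_density_holder:
  assumes \<alpha>: "0 < \<alpha>" "\<alpha> < 1" and T: "0 < T"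
  shows "\<bar>limit_density M (X T) y - limit_density M (X T) z\<bar> \<le> holder_bound K \<alpha> T * \<bar>y - z\<bar> powr \<alpha>"
proof (rule tendsto_upperbound)
  show "(\<lambda>n. \<bar>mollified_density M (X T) (1 / Suc n) y - mollified_density M (X T) (1 / Suc n) z\<bar>)
      \<longlonglongrightarrow> \<bar>limit_density M (X T) y - limit_density M (X T) z\<bar>"
    by (intro tendsto_intros mollified_density_tendsto T)
  have "\<forall>\<^sub>F n in sequentially. 1 / real (Suc n) < T"
    using order_tendstoD(2)[OF LIMSEQ_inverse_real_of_nat T] by (simp add: inverse_eq_divide)
  then show "\<forall>\<^sub>F n in sequentially. \<bar>mollified_density M (X T) (1 / Suc n) y - mollified_density M (X T) (1 / Suc n) z\<bar>
      \<le> holder_bound K \<alpha> T * \<bar>y - z\<bar> powr \<alpha>"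
    by eventually_elim (intro mollified_density_holder \<alpha> T; simp)
qed simp

text \<open>
  An atom of mass \<open>p\<close> at \<open>y\<close> would contribute \<open>p / sqrt (2 * pi * \<epsilon>)\<close> to the mollified density at \<open>y\<close>,
  which stays bounded as \<open>\<epsilon>\<close> tends to \<open>0\<close>.
\<close>
lemma motion_avoids_point:
  assumes T: "0 < T"
  shows "AE \<omega> in M. X T \<omega> \<noteq> y"
proof -
  have [measurable]: "random_variable borel (X T)" using X_measurable T by auto
  let ?A = "{\<omega> \<in> space M. X T \<omega> = y}" and ?C = "exp (K\<^sup>2 / 2) * extremal_density K T 0"
  have C: "0 \<le> ?C" using extremal_density_nonneg[OF T less_imp_le[OF K_pos]] by simp
  have le: "prob ?A \<le> ?C * sqrt (2 * pi * (1 / Suc n))" for n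
  proof -
    let ?\<delta> = "1 / Suc n :: real"
    have "prob ?A * (1 / sqrt (2 * pi * ?\<delta>)) = expectation (\<lambda>\<omega>. indicator ?A \<omega> * (1 / sqrt (2 * pi * ?\<delta>)))"
      by (simp add: Int_def conj_commute)
    also have "\<dots> \<le> mollified_density M (X T) ?\<delta> y"
      unfolding mollified_density_def
    proof (rule integral_mono)
      show "integrable M (\<lambda>\<omega>. indicator ?A \<omega> * (1 / sqrt (2 * pi * ?\<delta>)))"
        by (intro integrable_mult_left integrable_real_indicator) (auto simp: emeasure_eq_measure)
      show "integrable M (\<lambda>\<omega>. gauss ?\<delta> (X T \<omega> - y))" using T by (intro integrable_gauss_motion) auto
      show "indicator ?A \<omega> * (1 / sqrt (2 * pi * ?\<delta>)) \<le> gauss ?\<delta> (X T \<omega> - y)" if "\<omega> \<in> space M" for \<omega>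
        using that gauss_nonneg[of ?\<delta> "X T \<omega> - y"] by (auto simp: gauss_def split: split_indicator)
    qed
    also have "\<dots> \<le> exp (K\<^sup>2 * ?\<delta> / 2) * extremal_density K T 0"
      by (intro mollified_density_le T) auto
    also have "\<dots> \<le> ?C"
    proof (intro mult_right_mono extremal_density_nonneg[OF T] less_imp_le[OF K_pos])
      show "exp (K\<^sup>2 * ?\<delta> / 2) \<le> exp (K\<^sup>2 / 2)" by (rule exp_variance_le) simp
    qed
    finally have "prob ?A / sqrt (2 * pi * ?\<delta>) \<le> ?C" by simp
    moreover have "0 < sqrt (2 * pi * ?\<delta>)" by simp
    ultimately show ?thesis by (simp only: pos_divide_le_eq)
  qed
  have "(\<lambda>n. ?C * sqrt (2 * pi * (1 / Suc n))) \<longlonglongrightarrow> ?C * sqrt (2 * pi * 0)"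
    using LIMSEQ_inverse_real_of_nat by (intro tendsto_intros) (simp add: inverse_eq_divide)
  then have "prob ?A \<le> ?C * sqrt (2 * pi * 0)"
    by (rule LIMSEQ_le_const) (use le in auto)
  then have "prob ?A = 0" using measure_nonneg[of M ?A] by simp
  then show ?thesis
    by (subst AE_iff_measurable[OF _ refl]) (auto simp: emeasure_eq_measure)
qed

text \<open>
  The integral of the mollified density over an interval is the expected Gaussian mass of that interval
  around \<open>X T\<close>. As the variance tends to \<open>0\<close>, one side converges by boundedness of the mollified
  densities, the other because \<open>X T\<close> almost surely avoids the end points.
\<close>
lemma limit_density_interval:
  assumes T: "0 < T"
  shows "emeasure M {\<omega> \<in> space M. X T \<omega> \<in> {a..b}} = (\<integral>\<^sup>+y. ennreal (limit_density M (X T) y) * indicator {a..b} y \<partial>lborel)"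
proof -
  have K: "0 \<le> K" using K_pos by simp
  have [measurable]: "random_variable borel (X T)" using X_measurable T by auto
  note [measurable] = borel_measurable_mollified_density[OF less_imp_le[OF T]]
  let ?p = "mollified_density M (X T)" and ?l = "limit_density M (X T)" and ?\<epsilon> = "\<lambda>n::nat. 1 / real (Suc n)"
  let ?C = "exp (K\<^sup>2 / 2) * extremal_density K T 0"
  have [measurable]: "?l \<in> borel_measurable borel"
    by (rule borel_measurable_LIMSEQ_real[OF mollified_density_tendsto[OF T]]) measurable
  have pC: "?p (?\<epsilon> n) y \<le> ?C" for n y
  proof (rule order_trans[OF mollified_density_le[OF _ T]])
    show "exp (K\<^sup>2 * ?\<epsilon> n / 2) * extremal_density K T 0 \<le> ?C"
      by (intro mult_right_mono extremal_density_nonneg[OF T K] exp_variance_le) simp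
  qed simp
  have swap: "(\<integral>y. indicator {a..b} y * ?p \<epsilon> y \<partial>lborel) = expectation (\<lambda>\<omega>. \<integral>y. indicator {a..b} y * gauss \<epsilon> (X T \<omega> - y) \<partial>lborel)"
    if \<epsilon>: "0 < \<epsilon>" for \<epsilon>
  proof -
    interpret P: pair_sigma_finite M lborel ..
    have int: "integrable (M \<Otimes>\<^sub>M lborel) (\<lambda>(\<omega>, y). indicator {a..b} y * gauss \<epsilon> (X T \<omega> - y))"
    proof (rule Bochner_Integration.integrable_bound)
      have "integrable (M \<Otimes>\<^sub>M lborel) (indicator (space M \<times> {a..b}) :: _ \<Rightarrow> real)"
        by (intro integrable_real_indicator) (auto simp: lborel.emeasure_pair_measure_Times emeasure_eq_measure ennreal_mult_less_top emeasure_lborel_Icc_eq)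
      then show "integrable (M \<Otimes>\<^sub>M lborel) (\<lambda>z. (1 / sqrt (2 * pi * \<epsilon>)) * indicator (space M \<times> {a..b}) z :: real)"
        by (rule integrable_mult_right)
      show "AE z in M \<Otimes>\<^sub>M lborel. norm (case z of (\<omega>, y) \<Rightarrow> indicator {a..b} y * gauss \<epsilon> (X T \<omega> - y))
          \<le> norm ((1 / sqrt (2 * pi * \<epsilon>)) * indicator (space M \<times> {a..b}) z :: real)"
        using gauss_le_max[OF \<epsilon>] gauss_nonneg[OF \<epsilon>] \<epsilon>
        by (intro AE_I2) (auto simp: space_pair_measure indicator_def)
    qed measurable
    show ?thesis
      unfolding mollified_density_def using P.Fubini_integral[OF int]
      by (simp add: integral_mult_right_zero)
  qed
  have "(\<lambda>n. expectation (\<lambda>\<omega>. \<integral>y. indicator {a..b} y * gauss (?\<epsilon> n) (X T \<omega> - y) \<partial>lborel)) \<longlonglongrightarrow> expectation (\<lambda>\<omega>. indicator {a..b} (X T \<omega>))"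
  proof (rule integral_dominated_convergence[where w="\<lambda>_. 1"])
    have "?\<epsilon> \<longlonglongrightarrow> 0" using LIMSEQ_inverse_real_of_nat by (simp add: inverse_eq_divide)
    then have conv: "(\<lambda>n. \<integral>y. indicator {a..b} y * gauss (?\<epsilon> n) (x - y) \<partial>lborel) \<longlonglongrightarrow> indicator {a..b} x"
      if "x \<noteq> a" "x \<noteq> b" for x
      by (intro gauss_interval_mass_tendsto that) auto
    show "AE \<omega> in M. (\<lambda>n. \<integral>y. indicator {a..b} y * gauss (?\<epsilon> n) (X T \<omega> - y) \<partial>lborel) \<longlonglongrightarrow> indicator {a..b} (X T \<omega>)"
      using motion_avoids_point[OF T, of a] motion_avoids_point[OF T, of b] by eventually_elim (rule conv)
    show "AE \<omega> in M. norm (\<integral>y. indicator {a..b} y * gauss (?\<epsilon> n) (X T \<omega> - y) \<partial>lborel) \<le> 1" for n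
    proof (rule AE_I2)
      fix \<omega>
      have s: "0 < sqrt (?\<epsilon> n)" by simp
      have g: "gauss (?\<epsilon> n) (X T \<omega> - y) = normal_density (X T \<omega>) (sqrt (?\<epsilon> n)) y" for y
        by (rule gauss_eq_normal_density_centered) simp
      have "(\<integral>y. indicator {a..b} y * gauss (?\<epsilon> n) (X T \<omega> - y) \<partial>lborel) \<le> (\<integral>y. gauss (?\<epsilon> n) (X T \<omega> - y) \<partial>lborel)"
        unfolding g using integrable_mult_indicator[of "{a..b}" lborel "normal_density (X T \<omega>) (sqrt (?\<epsilon> n))"] s
        by (intro integral_mono) (auto split: split_indicator)
      also have "\<dots> = 1" unfolding g by (rule integral_normal_density[OF s])
      finally show "norm (\<integral>y. indicator {a..b} y * gauss (?\<epsilon> n) (X T \<omega> - y) \<partial>lborel) \<le> 1"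
        using gauss_nonneg[of "?\<epsilon> n"] by simp
    qed
  qed auto
  then have 1: "(\<lambda>n. \<integral>y. indicator {a..b} y * ?p (?\<epsilon> n) y \<partial>lborel) \<longlonglongrightarrow> expectation (\<lambda>\<omega>. indicator {a..b} (X T \<omega>))"
    by (subst swap) auto
  have ind: "integrable lborel (\<lambda>y. ?C * indicator {a..b} y)"
    by (intro integrable_mult_right integrable_real_indicator) (auto simp: emeasure_lborel_Icc_eq)
  have dom: "AE y in lborel. norm (indicator {a..b} y * ?p (?\<epsilon> n) y) \<le> ?C * indicator {a..b} y" for n
    using pC[of n] mollified_density_nonneg[of "?\<epsilon> n" T] by (intro AE_I2) (auto split: split_indicator)
  have lim: "AE y in lborel. (\<lambda>n. indicator {a..b} y * ?p (?\<epsilon> n) y) \<longlonglongrightarrow> indicator {a..b} y * ?l y"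
    by (intro AE_I2 tendsto_intros mollified_density_tendsto T)
  have il: "integrable lborel (\<lambda>y. indicator {a..b} y * ?l y)"
    by (rule integrable_dominated_convergence[OF _ _ ind lim dom]) measurable
  have "(\<lambda>n. \<integral>y. indicator {a..b} y * ?p (?\<epsilon> n) y \<partial>lborel) \<longlonglongrightarrow> (\<integral>y. indicator {a..b} y * ?l y \<partial>lborel)"
    by (rule integral_dominated_convergence[OF _ _ ind lim dom]) measurable
  from LIMSEQ_unique[OF 1 this]
  have "expectation (\<lambda>\<omega>. indicator {a..b} (X T \<omega>)) = (\<integral>y. indicator {a..b} y * ?l y \<partial>lborel)" .
  moreover have "expectation (\<lambda>\<omega>. indicat_real {a..b} (X T \<omega>)) = prob {\<omega> \<in> space M. X T \<omega> \<in> {a..b}}"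
  proof -
    have "expectation (\<lambda>\<omega>. indicat_real {a..b} (X T \<omega>)) = expectation (indicat_real {\<omega> \<in> space M. X T \<omega> \<in> {a..b}})"
      by (intro Bochner_Integration.integral_cong) (auto split: split_indicator)
    then show ?thesis by (simp add: Int_def conj_commute)
  qed
  ultimately have "emeasure M {\<omega> \<in> space M. X T \<omega> \<in> {a..b}} = ennreal (\<integral>y. indicator {a..b} y * ?l y \<partial>lborel)"
    by (simp add: emeasure_eq_measure)
  also have "\<dots> = (\<integral>\<^sup>+y. ennreal (indicator {a..b} y * ?l y) \<partial>lborel)"
    using il limit_density_nonneg[OF T] by (intro nn_integral_eq_integral[symmetric]) auto
  also have "\<dots> = (\<integral>\<^sup>+y. ennreal (?l y) * indicator {a..b} y \<partial>lborel)"
    by (intro nn_integral_cong) (auto split: split_indicator)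
  finally show ?thesis .
qed

lemma has_density_limit_density:
  assumes T: "0 < T"
  shows "has_density M (X T) (limit_density M (X T))"
proof -
  have [measurable]: "random_variable borel (X T)" using X_measurable T by auto
  note [measurable] = borel_measurable_mollified_density[OF less_imp_le[OF T]]
  have [measurable]: "limit_density M (X T) \<in> borel_measurable borel"
    by (rule borel_measurable_LIMSEQ_real[OF mollified_density_tendsto[OF T]]) measurable
  let ?E = "range (\<lambda>(a, b). {a..b::real})"
  have eq: "emeasure (distr M lborel (X T)) {a..b} = emeasure (density lborel (\<lambda>x. ennreal (limit_density M (X T) x))) {a..b}" for a b
    using limit_density_interval[OF T, of a b]
    by (simp add: emeasure_distr emeasure_density vimage_def Int_def conj_commute)
  have "distr M lborel (X T) = density lborel (\<lambda>x. ennreal (limit_density M (X T) x))"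
  proof (rule measure_eqI_generator_eq[where E="?E" and \<Omega>=UNIV and A="\<lambda>n::nat. {- real n..real n}"])
    show "Int_stable ?E" by (auto simp: Int_stable_def)
    show "emeasure (distr M lborel (X T)) A = emeasure (density lborel (\<lambda>x. ennreal (limit_density M (X T) x))) A" if "A \<in> ?E" for A
      using that eq by auto
    show "sets (distr M lborel (X T)) = sigma_sets UNIV ?E"
      "sets (density lborel (\<lambda>x. ennreal (limit_density M (X T) x))) = sigma_sets UNIV ?E"
      by (simp_all add: borel_eq_atLeastAtMost)
    show "(\<Union>n::nat. {- real n..real n}) = UNIV"
    proof (intro equalityI subsetI UNIV_I)
      fix x :: real
      obtain n :: nat where "\<bar>x\<bar> \<le> real n" using real_arch_simple by blast
      then have "x \<in> {- real n..real n}" by auto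
      then show "x \<in> (\<Union>n::nat. {- real n..real n})" by blast
    qed
    show "emeasure (distr M lborel (X T)) {- real n..real n} \<noteq> \<infinity>" for n
      by (simp add: emeasure_distr emeasure_eq_measure)
  qed auto
  then show ?thesis
    unfolding has_density_def distributed_def using limit_density_nonneg[OF T] by simp
qed

end

section \<open>Solutions of the stochastic differential equation\<close>

text \<open>
  Progressive measurability serves to make the paths of \<open>\<beta>\<close> measurable, hence integrable over bounded
  intervals; only then are the integrals over \<open>[0, s]\<close> and \<open>[s, t]\<close> additive. The increments of \<open>W\<close>
  are independent of \<open>X s\<close> because \<open>X\<close> is adapted.
\<close>
lemma bounded_drift_motion_of_sde:
  fixes M :: "'a measure" and F :: "real \<Rightarrow> 'a measure" and W \<beta> X :: "real \<Rightarrow> 'a \<Rightarrow> real" and K :: real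
  assumes F: "usual_filtered_prob_space M F"
    and W: "standard_brownian_motion M F W"
    and \<beta>: "progressively_measurable F \<beta>" "process_bounded_by M \<beta> K" and K: "0 < K"
    and X: "adapted_process F X"
    and sde: "AE \<omega> in M. \<forall>t\<ge>0. X t \<omega> = X 0 \<omega> + (LBINT s:{0..t}. \<beta> s \<omega>) + W t \<omega>"
  shows "bounded_drift_motion M X K"
proof -
  interpret usual_filtered_prob_space M F by fact
  have space_F: "space (F t) = space M" if "0 \<le> t" for t
    using subalgebra_F[OF that] by (simp add: subalgebra_def)
  have rv: "random_variable borel (Z t)" if "adapted_process F Z" "0 \<le> t" for Z :: "real \<Rightarrow> 'a \<Rightarrow> real" and t
    using that measurable_from_subalg[OF subalgebra_F[OF that(2)]] by (auto simp: adapted_process_def)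
  have W_adapted: "adapted_process F W" using W by (simp add: standard_brownian_motion_def)
  have \<beta>_int: "set_integrable lborel {a..b} (\<lambda>s. \<beta> s \<omega>)" if "0 \<le> a" "\<omega> \<in> space M" for a b \<omega>
  proof (cases "a \<le> b")
    case True
    then have b: "0 \<le> b" using that by simp
    have "(\<lambda>s. (s, \<omega>)) \<in> restrict_space borel {0..b} \<rightarrow>\<^sub>M restrict_space borel {0..b} \<Otimes>\<^sub>M F b"
      using that space_F[OF b] by (intro measurable_Pair) auto
    from measurable_compose[OF this \<beta>(1)[unfolded progressively_measurable_def, rule_format, OF b]]
    have "(\<lambda>s. \<beta> s \<omega>) \<in> borel_measurable (restrict_space borel {0..b})" by simp
    then have "(\<lambda>s. indicator {0..b} s *\<^sub>R \<beta> s \<omega>) \<in> borel_measurable borel"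
      by (subst (asm) borel_measurable_restrict_space_iff) auto
    then have "(\<lambda>s. indicator {a..b} s *\<^sub>R (indicator {0..b} s *\<^sub>R \<beta> s \<omega>)) \<in> borel_measurable borel"
      by measurable
    also have "(\<lambda>s. indicator {a..b} s *\<^sub>R (indicator {0..b} s *\<^sub>R \<beta> s \<omega>)) = (\<lambda>s. indicator {a..b} s *\<^sub>R \<beta> s \<omega>)"
      using that by (auto simp: fun_eq_iff split: split_indicator)
    finally have m: "(\<lambda>s. indicator {a..b} s *\<^sub>R \<beta> s \<omega>) \<in> borel_measurable lborel" by simp
    have "integrable lborel (\<lambda>s. K * indicator {a..b} s :: real)"
      by (intro integrable_mult_right integrable_real_indicator) (auto simp: emeasure_lborel_Icc_eq)
    then show ?thesis
      unfolding set_integrable_def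
      by (rule Bochner_Integration.integrable_bound[OF _ m])
         (use \<beta>(2) K that in \<open>auto simp: process_bounded_by_def split: split_indicator\<close>)
  qed (simp add: set_integrable_def)
  show ?thesis
  proof (intro bounded_drift_motion.intro bounded_drift_motion_axioms.intro K rv[OF X] prob_space_axioms)
    fix s t :: real assume s: "0 \<le> s" and st: "s < t"
    then have t: "0 \<le> t" by simp
    let ?N = "\<lambda>\<omega>. W t \<omega> - W s \<omega>"
    have N: "distributed M lborel ?N (\<lambda>x. ennreal (normal_density 0 (sqrt (t - s)) x))"
      and ind: "indep_set (sets (F s)) (sets (vimage_algebra (space M) ?N borel))"
      using W s st by (auto simp: standard_brownian_motion_def)
    have [measurable]: "random_variable borel ?N" using rv[OF W_adapted s] rv[OF W_adapted t] by simp
    have "indep_var borel (X s) borel ?N"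
      unfolding indep_var_eq
    proof (intro conjI rv[OF X s])
      have Xs: "X s \<in> borel_measurable (F s)" using X s by (simp add: adapted_process_def)
      have 1: "sigma_sets (space M) {X s -` A \<inter> space M |A. A \<in> sets borel} \<subseteq> sets (F s)"
        unfolding space_F[OF s, symmetric] using Xs by (intro sets.sigma_sets_subset) (auto dest: measurable_sets)
      have 2: "sigma_sets (space M) {?N -` A \<inter> space M |A. A \<in> sets borel} = sets (vimage_algebra (space M) ?N borel)"
        by (simp only: sets_vimage_algebra)
      show "indep_set (sigma_sets (space M) {X s -` A \<inter> space M |A. A \<in> sets borel})
          (sigma_sets (space M) {?N -` A \<inter> space M |A. A \<in> sets borel})"
        unfolding 2 using ind 1 unfolding indep_sets2_eq by blast
    qed measurable
    moreover have "AE \<omega> in M. \<bar>X t \<omega> - X s \<omega> - ?N \<omega>\<bar> \<le> K * (t - s)"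
      using sde AE_space
    proof eventually_elim
      fix \<omega> assume x: "\<forall>t\<ge>0. X t \<omega> = X 0 \<omega> + (LBINT s:{0..t}. \<beta> s \<omega>) + W t \<omega>" and \<omega>: "\<omega> \<in> space M"
      have "{0..t} = {0..s} \<union> {s<..t}" using s st by auto
      moreover have i: "set_integrable lborel {s<..t} (\<lambda>s. \<beta> s \<omega>)"
        using \<beta>_int[OF s \<omega>, of t] by (rule set_integrable_subset) auto
      ultimately have "(LBINT u:{0..t}. \<beta> u \<omega>) = (LBINT u:{0..s}. \<beta> u \<omega>) + (LBINT u:{s<..t}. \<beta> u \<omega>)"
        using \<beta>_int[OF order_refl \<omega>, of s] by (simp only:) (rule set_integral_Un, auto)
      then have "X t \<omega> - X s \<omega> - ?N \<omega> = (LBINT u:{s<..t}. \<beta> u \<omega>)"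
        using x[rule_format, OF s] x[rule_format, OF t] by simp
      also have "\<bar>\<dots>\<bar> \<le> (LBINT u:{s<..t}. \<bar>\<beta> u \<omega>\<bar>)"
        using set_integral_norm_bound[OF i] by simp
      also have "\<dots> \<le> (LBINT u:{s<..t}. K)"
      proof (intro set_integral_mono set_integrable_abs i)
        show "set_integrable lborel {s<..t} (\<lambda>_. K)"
          unfolding set_integrable_def using st
          by (intro integrable_scaleR_left integrable_real_indicator) auto
      qed (use \<beta>(2) s \<omega> in \<open>auto simp: process_bounded_by_def\<close>)
      also have "\<dots> = K * (t - s)" using st by (simp add: set_lebesgue_integral_def)
      finally show "\<bar>X t \<omega> - X s \<omega> - ?N \<omega>\<bar> \<le> K * (t - s)" .
    qed
    ultimately show "\<exists>N. indep_var borel (X s) borel N \<and>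
        distributed M lborel N (\<lambda>x. ennreal (normal_density 0 (sqrt (t - s)) x)) \<and>
        (AE \<omega> in M. \<bar>X t \<omega> - X s \<omega> - N \<omega>\<bar> \<le> K * (t - s))"
      using N by blast
  qed
qed

text \<open>
  The density \<open>limit_density M (X T)\<close> is chosen before \<open>K\<close>, so that a single version satisfies the bound
  for every admissible \<open>K\<close>. For the existence of a Hoelder constant a possibly nonpositive bound \<open>B\<close> is
  replaced by \<open>max B 1\<close>.
\<close>
theorem theorem2p1:
  fixes M :: "'a measure" and F :: "real \<Rightarrow> 'a measure"
    and W \<beta> X :: "real \<Rightarrow> 'a \<Rightarrow> real" and \<alpha> T :: real
  assumes "usual_filtered_prob_space M F"
    and "standard_brownian_motion M F W"
    and "progressively_measurable F \<beta>"
    and "\<exists>B. process_bounded_by M \<beta> B"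
    and "0 < \<alpha>" and "\<alpha> < 1"
    and "adapted_process F X"
    and "AE \<omega> in M. \<forall>t\<ge>0. X t \<omega> = X 0 \<omega> + (LBINT s:{0..t}. \<beta> s \<omega>) + W t \<omega>"
    and "0 < T"
  shows "\<exists>p. has_density M (X T) p \<and>
             (\<exists>C. holder_continuous_on \<alpha> C UNIV p) \<and>
             (\<forall>K>0. process_bounded_by M \<beta> K \<longrightarrow>
                holder_continuous_on \<alpha> (holder_bound K \<alpha> T) UNIV p)"
proof -
  have motion: "bounded_drift_motion M X K" if "0 < K" "process_bounded_by M \<beta> K" for K
    using bounded_drift_motion_of_sde[OF assms(1-3) that(2,1) assms(7,8)] .
  have holder: "holder_continuous_on \<alpha> (holder_bound K \<alpha> T) UNIV (limit_density M (X T))"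
    if "0 < K" "process_bounded_by M \<beta> K" for K
    unfolding holder_continuous_on_def
    using bounded_drift_motion.limit_density_holder[OF motion[OF that] assms(5,6,9)] by blast
  obtain B where "process_bounded_by M \<beta> B" using assms(4) by blast
  then have B: "0 < max B 1" "process_bounded_by M \<beta> (max B 1)"
    unfolding process_bounded_by_def by (auto simp: le_max_iff_disj)
  have "has_density M (X T) (limit_density M (X T))"
    by (rule bounded_drift_motion.has_density_limit_density[OF motion[OF B] assms(9)])
  then show ?thesis using holder holder[OF B] by blast
qed

end
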